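(* Let $\mathbf i:\mathbf{pOpe}\to\mathbf{pOpeCard}$ be the inclusion functor. The adjunction between $Set^{\mathbf{pOpe}^{op}}$ and $Set^{\mathbf{pOpeCard}^{op}}$ given by the functor $\mathbf i^*$ of precomposition with $\mathbf i$ and its right adjoint $Ran_{\mathbf i}$ (right Kan extension along $\mathbf i$) restricts to an equivalence of categories $$Ran_{\mathbf i}:Set^{\mathbf{pOpe}^{op}}\rightleftarrows sPb(\mathbf{pOpeCard}^{op},Set):\mathbf i^*.$$
   Context: **Positive hypergraphs.** A positive hypergraph $S$ is a family $(S_k)_{k\in\omega}$ of finite sets of faces (pairwise disjoint, only finitely many non-empty), functions $\gamma:S_{k+1}\to S_k$ and, for each $a\in S_{k+1}$, a non-empty set $\delta(a)\subseteq S_k$, where $\delta(a)$ is a singleton for $a\in S_1$. A morphism $f:S\to T$ is a family of functions $f_k:S_k\to T_k$ commuting with $\gamma$ and such that for every $a$ of dimension $\ge1$, $f$ restricts to a bijection $\delta(a)\to\delta(f(a))$. For a set $A$ of faces, $\delta(A)=\bigcup_{a\in A}\delta(a)$, $\gamma(A)=\{\gamma(a):a\in A\}$; singletons are identified with elements. For $a$ of dimension $\ge 2$, $\iota(a)=\delta\delta(a)\cap\gamma\delta(a)$, and $\iota(A)=\bigcup_{a\in A}\iota(a)$. On $S_k$: $<^-$ is the transitive closure of the relation "$\gamma(a)\in\delta(b)$" (empty for $k=0$); $<^+$ is the transitive closure of the relation "there is $\alpha\in S_{k+1}$ with $a\in\delta(\alpha)$, $\gamma(\alpha)=b$"; $a\perp^{\pm}b$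 means $a<^{\pm}b$ or $b<^{\pm}a$. **Positive opetopic cardinals.** A positive hypergraph $S$ with $S_0\ne\emptyset$ is a positive opetopic cardinal if: (globularity) for all $a$ of dimension $\ge2$, $\gamma\gamma(a)=\gamma\delta(a)-\delta\delta(a)$ and $\delta\gamma(a)=\delta\delta(a)-\gamma\delta(a)$; (strictness) $<^+$ is a strict order on each $S_k$, and linear on $S_0$; (disjointness) for $k>0$ no two faces $a,b\in S_k$ satisfy both $a\perp^+b$ and $a\perp^-b$; (pencil linearity) for $k>0$ and $x\in S_{k-1}$ the sets $\{a\in S_k: x=\gamma(a)\}$ and $\{a\in S_k:x\in\delta(a)\}$ are linearly ordered by $<^+$. $\dim(S)$ is the largest $k$ with $S_k\neq\emptyset$. $\mathbf{pOpeCard}$ is the full subcategory of positive hypergraphs on these. $S$ is a positive opetope if $|S_l-\delta(S_{l+1})|=1$ for all $l\le\dim(S)$; $\mathbf{pOpe}\subseteq\mathbf{pOpeCard}$ is the full subcategory of positive opetopes. **Special pushouts.** For $S$ in $\mathbf{pOpeCard}$ and $k\in\omega$, $\mathbf d^{(k)}S\subseteq S$ has faces $S_l$ for $l<k$, $S_k-\gamma(S_{k+1})$ in dimension $k$, none above; $\mathbf c^{(k)}S\subseteq S$ has faces $S_l$ for $l<k-1$, $S_{k-1}-\iota(S_{k+1})$ in dimension $k-1$ (if $k>0$), $S_k-\delta(S_{k+1})$ in dimension $k$, none above; these are positive opetopic cardinals. If $\mathbf c^{(k)}S=\mathbf d^{(k)}T$, the pushout $T\oplus_kS$ in $\mathbf{pOpeCard}$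 of the inclusions $\mathbf c^{(k)}S\to S$ and $\mathbf c^{(k)}S=\mathbf d^{(k)}T\to T$ exists; such squares are called special pushouts. $sPb(\mathbf{pOpeCard}^{op},Set)$ is the full subcategory of $Set^{\mathbf{pOpeCard}^{op}}$ on functors sending all special pushouts to pullbacks in $Set$. *)

theory Defs
  imports Main "HOL-Library.FuncSet"
begin

section \<open>Categories\<close>

text \<open>
  Composition is written in the classical order: \<open>Cmp C g f\<close> is \<open>g\<close> after \<open>f\<close>.
\<close>

record ('o, 'm) cat =
  Ob :: "'o set"
  Ar :: "'m set"
  Src :: "'m \<Rightarrow> 'o"
  Tgt :: "'m \<Rightarrow> 'o"
  Idn :: "'o \<Rightarrow> 'm"
  Cmp :: "'m \<Rightarrow> 'm \<Rightarrow> 'm"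

definition category :: "('o, 'm) cat \<Rightarrow> bool" where
  "category C \<longleftrightarrow>
     (\<forall>f\<in>Ar C. Src C f \<in> Ob C \<and> Tgt C f \<in> Ob C) \<and>
     (\<forall>x\<in>Ob C. Idn C x \<in> Ar C \<and> Src C (Idn C x) = x \<and> Tgt C (Idn C x) = x) \<and>
     (\<forall>f\<in>Ar C. \<forall>g\<in>Ar C. Tgt C f = Src C g \<longrightarrow>
        Cmp C g f \<in> Ar C \<and> Src C (Cmp C g f) = Src C f \<and> Tgt C (Cmp C g f) = Tgt C g) \<and>
     (\<forall>f\<in>Ar C. Cmp C f (Idn C (Src C f)) = f \<and> Cmp C (Idn C (Tgt C f)) f = f) \<and>
     (\<forall>f\<in>Ar C. \<forall>g\<in>Ar C. \<forall>h\<in>Ar C. Tgt C f = Src C g \<longrightarrow> Tgt C g = Src C h \<longrightarrow>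
        Cmp C h (Cmp C g f) = Cmp C (Cmp C h g) f)"

definition op_cat :: "('o, 'm) cat \<Rightarrow> ('o, 'm) cat" where
  "op_cat C = \<lparr>Ob = Ob C, Ar = Ar C, Src = Tgt C, Tgt = Src C, Idn = Idn C,
               Cmp = (\<lambda>g f. Cmp C f g)\<rparr>"

definition full_subcat :: "('o, 'm) cat \<Rightarrow> ('o \<Rightarrow> bool) \<Rightarrow> ('o, 'm) cat" where
  "full_subcat C P = C\<lparr>Ob := {x \<in> Ob C. P x}, Ar := {f \<in> Ar C. P (Src C f) \<and> P (Tgt C f)}\<rparr>"

definition is_iso :: "('o, 'm) cat \<Rightarrow> 'm \<Rightarrow> bool" where
  "is_iso C f \<longleftrightarrow> f \<in> Ar C \<and>
     (\<exists>g\<in>Ar C. Src C g = Tgt C f \<and> Tgt C g = Src C f \<and>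
        Cmp C g f = Idn C (Src C f) \<and> Cmp C f g = Idn C (Tgt C f))"

text \<open>
  The square with legs \<open>p\<close>, \<open>q\<close> out of the corner is a pullback of the cospan \<open>f\<close>, \<open>g\<close>,
  where \<open>f \<circ> p = g \<circ> q\<close>.
\<close>

definition is_pullback :: "('o, 'm) cat \<Rightarrow> 'm \<Rightarrow> 'm \<Rightarrow> 'm \<Rightarrow> 'm \<Rightarrow> bool" where
  "is_pullback C f g p q \<longleftrightarrow>
     {f, g, p, q} \<subseteq> Ar C \<and> Tgt C f = Tgt C g \<and> Src C p = Src C q \<and>
     Tgt C p = Src C f \<and> Tgt C q = Src C g \<and> Cmp C f p = Cmp C g q \<and>
     (\<forall>p'\<in>Ar C. \<forall>q'\<in>Ar C.
        Src C p' = Src C q' \<and> Tgt C p' = Src C f \<and> Tgt C q' = Src C g \<and>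
        Cmp C f p' = Cmp C g q' \<longrightarrow>
        (\<exists>!u. u \<in> Ar C \<and> Src C u = Src C p' \<and> Tgt C u = Src C p \<and>
              Cmp C p u = p' \<and> Cmp C q u = q'))"

definition is_pushout :: "('o, 'm) cat \<Rightarrow> 'm \<Rightarrow> 'm \<Rightarrow> 'm \<Rightarrow> 'm \<Rightarrow> bool" where
  "is_pushout C = is_pullback (op_cat C)"


section \<open>Functors and natural transformations\<close>

text \<open>
  Functors are required to be extensional, so that two functors are equal iff they agree on
  the objects and arrows of their domain.
\<close>

record ('o, 'm, 'p, 'n) func =
  obm :: "'o \<Rightarrow> 'p"
  arm :: "'m \<Rightarrow> 'n"

definition is_functor ::
    "('o, 'm) cat \<Rightarrow> ('p, 'n) cat \<Rightarrow> ('o, 'm, 'p, 'n) func \<Rightarrow> bool" where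
  "is_functor A B F \<longleftrightarrow>
     obm F \<in> Ob A \<rightarrow>\<^sub>E Ob B \<and> arm F \<in> Ar A \<rightarrow>\<^sub>E Ar B \<and>
     (\<forall>f\<in>Ar A. Src B (arm F f) = obm F (Src A f) \<and> Tgt B (arm F f) = obm F (Tgt A f)) \<and>
     (\<forall>x\<in>Ob A. arm F (Idn A x) = Idn B (obm F x)) \<and>
     (\<forall>f\<in>Ar A. \<forall>g\<in>Ar A. Tgt A f = Src A g \<longrightarrow>
        arm F (Cmp A g f) = Cmp B (arm F g) (arm F f))"

definition id_func :: "('o, 'm) cat \<Rightarrow> ('o, 'm, 'o, 'm) func" where
  "id_func A = \<lparr>obm = (\<lambda>x\<in>Ob A. x), arm = (\<lambda>f\<in>Ar A. f)\<rparr>"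

definition comp_func :: "('o, 'm) cat \<Rightarrow> ('p, 'n, 'q, 'l) func \<Rightarrow> ('o, 'm, 'p, 'n) func
    \<Rightarrow> ('o, 'm, 'q, 'l) func" where
  "comp_func A G F = \<lparr>obm = (\<lambda>x\<in>Ob A. obm G (obm F x)), arm = (\<lambda>f\<in>Ar A. arm G (arm F f))\<rparr>"

definition restrict_func ::
    "('o, 'm, 'p, 'n) func \<Rightarrow> ('o, 'm) cat \<Rightarrow> ('o, 'm, 'p, 'n) func" where
  "restrict_func F A = \<lparr>obm = restrict (obm F) (Ob A), arm = restrict (arm F) (Ar A)\<rparr>"

definition nat_trans :: "('o, 'm) cat \<Rightarrow> ('p, 'n) cat \<Rightarrow> ('o, 'm, 'p, 'n) func
    \<Rightarrow> ('o, 'm, 'p, 'n) func \<Rightarrow> ('o \<Rightarrow> 'n) \<Rightarrow> bool" where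
  "nat_trans A B F G \<tau> \<longleftrightarrow>
     is_functor A B F \<and> is_functor A B G \<and> \<tau> \<in> Ob A \<rightarrow>\<^sub>E Ar B \<and>
     (\<forall>x\<in>Ob A. Src B (\<tau> x) = obm F x \<and> Tgt B (\<tau> x) = obm G x) \<and>
     (\<forall>f\<in>Ar A. Cmp B (arm G f) (\<tau> (Src A f)) = Cmp B (\<tau> (Tgt A f)) (arm F f))"

type_synonym ('o, 'm, 'p, 'n) ntr =
  "('o, 'm, 'p, 'n) func \<times> ('o \<Rightarrow> 'n) \<times> ('o, 'm, 'p, 'n) func"

definition functor_cat :: "('o, 'm) cat \<Rightarrow> ('p, 'n) cat
    \<Rightarrow> (('o, 'm, 'p, 'n) func, ('o, 'm, 'p, 'n) ntr) cat" where
  "functor_cat A B =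
     \<lparr>Ob = {F. is_functor A B F},
      Ar = {(F, \<tau>, G). nat_trans A B F G \<tau>},
      Src = (\<lambda>(F, \<tau>, G). F),
      Tgt = (\<lambda>(F, \<tau>, G). G),
      Idn = (\<lambda>F. (F, \<lambda>x\<in>Ob A. Idn B (obm F x), F)),
      Cmp = (\<lambda>(G, \<sigma>, H) (F, \<tau>, G'). (F, \<lambda>x\<in>Ob A. Cmp B (\<sigma> x) (\<tau> x), H))\<rparr>"

definition precomp :: "('o, 'm) cat \<Rightarrow> ('p, 'n) cat \<Rightarrow> ('q, 'l) cat \<Rightarrow> ('o, 'm, 'p, 'n) func
    \<Rightarrow> (('p, 'n, 'q, 'l) func, ('p, 'n, 'q, 'l) ntr,
        ('o, 'm, 'q, 'l) func, ('o, 'm, 'q, 'l) ntr) func" where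
  "precomp A B E K =
     \<lparr>obm = (\<lambda>X\<in>Ob (functor_cat B E). comp_func A X K),
      arm = (\<lambda>(X, \<tau>, Y)\<in>Ar (functor_cat B E).
               (comp_func A X K, \<lambda>x\<in>Ob A. \<tau> (obm K x), comp_func A Y K))\<rparr>"

text \<open>
  \<open>(R, \<epsilon>)\<close> with \<open>\<epsilon> : R \<circ> K \<Rightarrow> X\<close> is a right Kan extension of \<open>X : A \<rightarrow> E\<close> along \<open>K : A \<rightarrow> B\<close>.
\<close>

definition right_Kan_extension :: "('o, 'm) cat \<Rightarrow> ('p, 'n) cat \<Rightarrow> ('q, 'l) cat
    \<Rightarrow> ('o, 'm, 'p, 'n) func \<Rightarrow> ('o, 'm, 'q, 'l) func
    \<Rightarrow> ('p, 'n, 'q, 'l) func \<Rightarrow> ('o \<Rightarrow> 'l) \<Rightarrow> bool" where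
  "right_Kan_extension A B E K X R \<epsilon> \<longleftrightarrow>
     is_functor B E R \<and> nat_trans A E (comp_func A R K) X \<epsilon> \<and>
     (\<forall>Y \<alpha>. is_functor B E Y \<and> nat_trans A E (comp_func A Y K) X \<alpha> \<longrightarrow>
        (\<exists>!\<sigma>. nat_trans B E Y R \<sigma> \<and> (\<forall>a\<in>Ob A. \<alpha> a = Cmp E (\<epsilon> a) (\<sigma> (obm K a)))))"

text \<open>
  \<open>F : D \<rightarrow> C\<close> is left adjoint to \<open>G : C \<rightarrow> D\<close>, with unit \<open>\<eta> : 1 \<Rightarrow> G F\<close> and counit \<open>\<epsilon> : F G \<Rightarrow> 1\<close>.
\<close>

definition adjunction :: "('p, 'n) cat \<Rightarrow> ('o, 'm) cat
    \<Rightarrow> ('p, 'n, 'o, 'm) func \<Rightarrow> ('o, 'm, 'p, 'n) func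
    \<Rightarrow> ('p \<Rightarrow> 'n) \<Rightarrow> ('o \<Rightarrow> 'm) \<Rightarrow> bool" where
  "adjunction D C F G \<eta> \<epsilon> \<longleftrightarrow>
     category D \<and> category C \<and> is_functor D C F \<and> is_functor C D G \<and>
     nat_trans D D (id_func D) (comp_func D G F) \<eta> \<and>
     nat_trans C C (comp_func C F G) (id_func C) \<epsilon> \<and>
     (\<forall>y\<in>Ob D. Cmp C (\<epsilon> (obm F y)) (arm F (\<eta> y)) = Idn C (obm F y)) \<and>
     (\<forall>x\<in>Ob C. Cmp D (arm G (\<epsilon> x)) (\<eta> (obm G x)) = Idn D (obm G x))"

text \<open>An equivalence of categories given by an adjunction: unit and counit are invertible.\<close>

definition adjoint_equivalence :: "('p, 'n) cat \<Rightarrow> ('o, 'm) cat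
    \<Rightarrow> ('p, 'n, 'o, 'm) func \<Rightarrow> ('o, 'm, 'p, 'n) func
    \<Rightarrow> ('p \<Rightarrow> 'n) \<Rightarrow> ('o \<Rightarrow> 'm) \<Rightarrow> bool" where
  "adjoint_equivalence D C F G \<eta> \<epsilon> \<longleftrightarrow>
     adjunction D C F G \<eta> \<epsilon> \<and>
     (\<forall>y\<in>Ob D. is_iso D (\<eta> y)) \<and> (\<forall>x\<in>Ob C. is_iso C (\<epsilon> x))"


section \<open>The category of sets\<close>

text \<open>
  \<open>Set\<close> is the category of all sets of a universe \<open>\<U>\<close> of small sets over an arbitrary type.
  Of the closure properties of a universe only these are demanded: there is a set with two
  elements, every set that injects into a small set is small (subsets and replacement), and the
  product of two small sets is small up to bijection.  They hold for the small sets of any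
  Grothendieck universe, and also for the family of all subsets of any infinite type.
\<close>

definition set_universe :: "'u set set \<Rightarrow> bool" where
  "set_universe \<U> \<longleftrightarrow>
     (\<exists>x y. x \<noteq> y \<and> {x, y} \<in> \<U>) \<and>
     (\<forall>A\<in>\<U>. \<forall>B f. inj_on f B \<and> f ` B \<subseteq> A \<longrightarrow> B \<in> \<U>) \<and>
     (\<forall>A\<in>\<U>. \<forall>B\<in>\<U>. \<exists>C\<in>\<U>. \<exists>f. bij_betw f (A \<times> B) C)"

type_synonym 'u set_arrow = "'u set \<times> ('u \<Rightarrow> 'u) \<times> 'u set"

definition set_cat :: "'u set set \<Rightarrow> ('u set, 'u set_arrow) cat" where
  "set_cat \<U> =
     \<lparr>Ob = \<U>,
      Ar = {(A, f, B). A \<in> \<U> \<and> B \<in> \<U> \<and> f \<in> A \<rightarrow>\<^sub>E B},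
      Src = (\<lambda>(A, f, B). A),
      Tgt = (\<lambda>(A, f, B). B),
      Idn = (\<lambda>A. (A, \<lambda>x\<in>A. x, A)),
      Cmp = (\<lambda>(B, g, C) (A, f, B'). (A, \<lambda>x\<in>A. g (f x), C))\<rparr>"

definition presheaves :: "('o, 'm) cat \<Rightarrow> 'u set set
    \<Rightarrow> (('o, 'm, 'u set, 'u set_arrow) func, ('o, 'm, 'u set, 'u set_arrow) ntr) cat" where
  "presheaves C \<U> = functor_cat (op_cat C) (set_cat \<U>)"


section \<open>Positive hypergraphs\<close>

text \<open>
  Since the sets \<open>S\<^sub>k\<close> are pairwise disjoint, a single \<open>\<gamma>\<close> and a single \<open>\<delta>\<close> serve all dimensions.
  Outside the faces of positive dimension they have fixed dummy values, which makes equality of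
  hypergraphs the intended one.
\<close>

record 'f hypergraph =
  faces :: "nat \<Rightarrow> 'f set"
  gam :: "'f \<Rightarrow> 'f"
  del :: "'f \<Rightarrow> 'f set"

definition all_faces :: "'f hypergraph \<Rightarrow> 'f set" where
  "all_faces S = (\<Union>k. faces S k)"

definition pos_faces :: "'f hypergraph \<Rightarrow> 'f set" where
  "pos_faces S = (\<Union>k. faces S (Suc k))"

definition positive_hypergraph :: "'f hypergraph \<Rightarrow> bool" where
  "positive_hypergraph S \<longleftrightarrow>
     (\<forall>k. finite (faces S k)) \<and> finite {k. faces S k \<noteq> {}} \<and>
     (\<forall>k l. k \<noteq> l \<longrightarrow> faces S k \<inter> faces S l = {}) \<and>
     (\<forall>k. \<forall>a\<in>faces S (Suc k). gam S a \<in> faces S k \<and> del S a \<subseteq> faces S k \<and> del S a \<noteq> {}) \<and>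
     (\<forall>a\<in>faces S 1. is_singleton (del S a)) \<and>
     (\<forall>a. a \<notin> pos_faces S \<longrightarrow> gam S a = undefined \<and> del S a = {})"

definition hypergraph_morphism ::
    "'f hypergraph \<Rightarrow> 'f hypergraph \<Rightarrow> ('f \<Rightarrow> 'f) \<Rightarrow> bool" where
  "hypergraph_morphism S T f \<longleftrightarrow>
     f \<in> extensional (all_faces S) \<and>
     (\<forall>k. f ` faces S k \<subseteq> faces T k) \<and>
     (\<forall>a\<in>pos_faces S. f (gam S a) = gam T (f a) \<and> bij_betw f (del S a) (del T (f a)))"

type_synonym 'f hyper_arrow = "'f hypergraph \<times> ('f \<Rightarrow> 'f) \<times> 'f hypergraph"

definition pHg :: "('f hypergraph, 'f hyper_arrow) cat" where
  "pHg =
     \<lparr>Ob = {S. positive_hypergraph S},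
      Ar = {(S, f, T). positive_hypergraph S \<and> positive_hypergraph T \<and> hypergraph_morphism S T f},
      Src = (\<lambda>(S, f, T). S),
      Tgt = (\<lambda>(S, f, T). T),
      Idn = (\<lambda>S. (S, \<lambda>a\<in>all_faces S. a, S)),
      Cmp = (\<lambda>(T, g, U) (S, f, T'). (S, \<lambda>a\<in>all_faces S. g (f a), U))\<rparr>"

definition dels :: "'f hypergraph \<Rightarrow> 'f set \<Rightarrow> 'f set" where
  "dels S A = (\<Union>a\<in>A. del S a)"

definition gams :: "'f hypergraph \<Rightarrow> 'f set \<Rightarrow> 'f set" where
  "gams S A = gam S ` A"

definition iota :: "'f hypergraph \<Rightarrow> 'f \<Rightarrow> 'f set" where
  "iota S a = dels S (del S a) \<inter> gams S (del S a)"

definition iotas :: "'f hypergraph \<Rightarrow> 'f set \<Rightarrow> 'f set" where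
  "iotas S A = (\<Union>a\<in>A. iota S a)"

text \<open>The relations \<open><\<^sup>-\<close> and \<open><\<^sup>+\<close> on \<open>S\<^sub>k\<close>.\<close>

definition lt_minus :: "'f hypergraph \<Rightarrow> nat \<Rightarrow> ('f \<times> 'f) set" where
  "lt_minus S k =
     {(a, b). 0 < k \<and> a \<in> faces S k \<and> b \<in> faces S k \<and> gam S a \<in> del S b}\<^sup>+"

definition lt_plus :: "'f hypergraph \<Rightarrow> nat \<Rightarrow> ('f \<times> 'f) set" where
  "lt_plus S k =
     {(a, b). a \<in> faces S k \<and> b \<in> faces S k \<and>
        (\<exists>\<alpha>\<in>faces S (Suc k). a \<in> del S \<alpha> \<and> gam S \<alpha> = b)}\<^sup>+"

definition perp :: "('f \<times> 'f) set \<Rightarrow> 'f \<Rightarrow> 'f \<Rightarrow> bool" where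
  "perp r a b \<longleftrightarrow> (a, b) \<in> r \<or> (b, a) \<in> r"


section \<open>Positive opetopic cardinals and positive opetopes\<close>

definition globularity :: "'f hypergraph \<Rightarrow> bool" where
  "globularity S \<longleftrightarrow> (\<forall>k\<ge>2. \<forall>a\<in>faces S k.
     {gam S (gam S a)} = gams S (del S a) - dels S (del S a) \<and>
     del S (gam S a) = dels S (del S a) - gams S (del S a))"

text \<open>Transitivity of \<open><\<^sup>+\<close> is built in, so it is a strict order iff it is irreflexive.\<close>

definition strictness :: "'f hypergraph \<Rightarrow> bool" where
  "strictness S \<longleftrightarrow> (\<forall>k. irrefl (lt_plus S k)) \<and> total_on (faces S 0) (lt_plus S 0)"

definition disjointness :: "'f hypergraph \<Rightarrow> bool" where
  "disjointness S \<longleftrightarrow> (\<forall>k>0. \<forall>a\<in>faces S k. \<forall>b\<in>faces S k.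
     \<not> (perp (lt_plus S k) a b \<and> perp (lt_minus S k) a b))"

definition pencil_linearity :: "'f hypergraph \<Rightarrow> bool" where
  "pencil_linearity S \<longleftrightarrow> (\<forall>k. \<forall>x\<in>faces S k.
     total_on {a \<in> faces S (Suc k). x = gam S a} (lt_plus S (Suc k)) \<and>
     total_on {a \<in> faces S (Suc k). x \<in> del S a} (lt_plus S (Suc k)))"

definition positive_opetopic_cardinal :: "'f hypergraph \<Rightarrow> bool" where
  "positive_opetopic_cardinal S \<longleftrightarrow>
     positive_hypergraph S \<and> faces S 0 \<noteq> {} \<and>
     globularity S \<and> strictness S \<and> disjointness S \<and> pencil_linearity S"

definition hdim :: "'f hypergraph \<Rightarrow> nat" where
  "hdim S = Max {k. faces S k \<noteq> {}}"

definition positive_opetope :: "'f hypergraph \<Rightarrow> bool" where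
  "positive_opetope S \<longleftrightarrow> positive_opetopic_cardinal S \<and>
     (\<forall>l\<le>hdim S. card (faces S l - dels S (faces S (Suc l))) = 1)"

definition pOpeCard :: "('f hypergraph, 'f hyper_arrow) cat" where
  "pOpeCard = full_subcat pHg positive_opetopic_cardinal"

definition pOpe :: "('f hypergraph, 'f hyper_arrow) cat" where
  "pOpe = full_subcat pHg positive_opetope"

text \<open>
  The inclusion functor \<open>\<^bold>i : pOpe \<rightarrow> pOpeCard\<close>; the same data are the functor
  \<open>pOpe\<^sup>o\<^sup>p \<rightarrow> pOpeCard\<^sup>o\<^sup>p\<close>.
\<close>

definition incl_func ::
    "('f hypergraph, 'f hyper_arrow, 'f hypergraph, 'f hyper_arrow) func" where
  "incl_func = \<lparr>obm = (\<lambda>S\<in>Ob pOpe. S), arm = (\<lambda>f\<in>Ar pOpe. f)\<rparr>"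


section \<open>Special pushouts\<close>

definition sub_hypergraph :: "'f hypergraph \<Rightarrow> (nat \<Rightarrow> 'f set) \<Rightarrow> 'f hypergraph" where
  "sub_hypergraph S G =
     \<lparr>faces = G,
      gam = (\<lambda>a. if a \<in> (\<Union>k. G (Suc k)) then gam S a else undefined),
      del = (\<lambda>a. if a \<in> (\<Union>k. G (Suc k)) then del S a else {})\<rparr>"

definition dom_part :: "nat \<Rightarrow> 'f hypergraph \<Rightarrow> 'f hypergraph" where
  "dom_part k S = sub_hypergraph S (\<lambda>l.
     if l < k then faces S l
     else if l = k then faces S k - gams S (faces S (Suc k))
     else {})"

definition cod_part :: "nat \<Rightarrow> 'f hypergraph \<Rightarrow> 'f hypergraph" where
  "cod_part k S = sub_hypergraph S (\<lambda>l.
     if Suc l < k then faces S l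
     else if Suc l = k then faces S l - iotas S (faces S (Suc k))
     else if l = k then faces S k - dels S (faces S (Suc k))
     else {})"

definition incl_arrow :: "'f hypergraph \<Rightarrow> 'f hypergraph \<Rightarrow> 'f hyper_arrow" where
  "incl_arrow S T = (S, \<lambda>a\<in>all_faces S. a, T)"

text \<open>
  \<open>j\<^sub>T : T \<rightarrow> P\<close> and \<open>j\<^sub>S : S \<rightarrow> P\<close> exhibit \<open>P\<close> as \<open>T \<oplus>\<^sub>k S\<close>.  No representative of the pushout is
  singled out.
\<close>

definition special_pushout :: "nat \<Rightarrow> 'f hypergraph \<Rightarrow> 'f hypergraph
    \<Rightarrow> 'f hyper_arrow \<Rightarrow> 'f hyper_arrow \<Rightarrow> bool" where
  "special_pushout k T S jT jS \<longleftrightarrow>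
     T \<in> Ob pOpeCard \<and> S \<in> Ob pOpeCard \<and> cod_part k S = dom_part k T \<and>
     is_pushout pOpeCard (incl_arrow (dom_part k T) T) (incl_arrow (cod_part k S) S) jT jS"

type_synonym ('f, 'u) psh = "('f hypergraph, 'f hyper_arrow, 'u set, 'u set_arrow) func"

type_synonym ('f, 'u) psh_arrow = "('f hypergraph, 'f hyper_arrow, 'u set, 'u set_arrow) ntr"

definition preserves_special :: "'u set set \<Rightarrow> ('f, 'u) psh \<Rightarrow> bool" where
  "preserves_special \<U> X \<longleftrightarrow> (\<forall>k T S jT jS. special_pushout k T S jT jS \<longrightarrow>
     is_pullback (set_cat \<U>)
       (arm X (incl_arrow (dom_part k T) T)) (arm X (incl_arrow (cod_part k S) S))
       (arm X jT) (arm X jS))"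

definition sPb :: "'u set set \<Rightarrow> (('f, 'u) psh, ('f, 'u) psh_arrow) cat" where
  "sPb \<U> = full_subcat (presheaves pOpeCard \<U>) (preserves_special \<U>)"

text \<open>The functor \<open>\<^bold>i\<^sup>*\<close>.\<close>

definition incl_star :: "'u set set
    \<Rightarrow> (('f, 'u) psh, ('f, 'u) psh_arrow, ('f, 'u) psh, ('f, 'u) psh_arrow) func" where
  "incl_star \<U> = precomp (op_cat pOpe) (op_cat pOpeCard) (set_cat \<U>) incl_func"

text \<open>
  \<open>Ran\<close> with unit \<open>\<eta>\<close> and counit \<open>\<epsilon>\<close> is right adjoint to \<open>\<^bold>i\<^sup>*\<close>, its values being right Kan
  extensions along \<open>\<^bold>i\<close> with the counit as structure map.  The middle component of the arrow
  \<open>\<epsilon> X\<close> of the presheaf category is the underlying family of functions.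
\<close>

definition is_Ran :: "'u set set
    \<Rightarrow> (('f, 'u) psh, ('f, 'u) psh_arrow, ('f, 'u) psh, ('f, 'u) psh_arrow) func
    \<Rightarrow> (('f, 'u) psh \<Rightarrow> ('f, 'u) psh_arrow)
    \<Rightarrow> (('f, 'u) psh \<Rightarrow> ('f, 'u) psh_arrow) \<Rightarrow> bool" where
  "is_Ran \<U> Ran \<eta> \<epsilon> \<longleftrightarrow>
     adjunction (presheaves pOpeCard \<U>) (presheaves pOpe \<U>) (incl_star \<U>) Ran \<eta> \<epsilon> \<and>
     (\<forall>X\<in>Ob (presheaves pOpe \<U>).
        right_Kan_extension (op_cat pOpe) (op_cat pOpeCard) (set_cat \<U>) incl_func X
          (obm Ran X) (fst (snd (\<epsilon> X))))"

end

(*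
  A right Kan extension along the full inclusion pOpe -> pOpeCard is computed pointwise: its value
  at S is the set of compatible families indexed by the maps Q -> S with Q an opetope.  This set is
  small because the size of Q is bounded in terms of S.  Hence the counit is always invertible, and
  everything reduces to two facts about special pushouts P = T (+)_k S.

  (1) In a special pushout the legs are injective, jointly surjective, and meet exactly in
  d^(k)T.  An opetope is generated by its top face, so a map from an opetope to P factors through T
  or through S, and Ran X sends the square to a pullback.  To see that the pushout has this form,
  glue T and S to a hypergraph P0.  The universal map P0 -> P already forces strictness and
  disjointness on P0, and globularity is local, so only pencil linearity is left; faces of T and of
  S in one pencil are compared through a common face of d^(k)T.

  (2) A cardinal S that is not an opetope has, in some dimension k + 1, two <+-maximal faces.  If m
  is one of them with gamma(m) <+-minimal, the faces below m split S as a special pushout of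
  two smaller cardinals.  By induction every presheaf Y that sends special pushouts to pullbacks is
  the right Kan extension of its restriction.
*)
theory Submission
  imports Defs
begin


section \<open>Categories and universal arrows\<close>

text \<open>Of the axioms of an opetopic cardinal, irreflexivity of \<open>lt_plus\<close> and
  disjointness pull back along any morphism to a cardinal, while pencil linearity and linearity on
  vertices assert that chains exist. A part of a cardinal closed under \<open>gam\<close> and
  \<open>del\<close> may have lost the faces that such a chain runs through; most of the work on
  cutting consists in rerouting chains through faces that remain. Minimality of
  \<open>gam S m\<close> makes the cut possible: it excludes a face outside the region below
  \<open>m\<close> whose codomain is consumed inside that region, so the lower part can be composed
  before the upper one. A special pushout is given by its universal property alone, which says
  nothing about elements; this is why a gluing has to be built by hand. Faces of \<open>T\<close>
  and \<open>S\<close> outside the common part may coincide by accident, so those of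
  \<open>T\<close> are renamed. This takes fresh elements, whence the infinite type of
  faces.\<close>

lemma cat_Src: "category C \<Longrightarrow> f \<in> Ar C \<Longrightarrow> Src C f \<in> Ob C"
  and cat_Tgt: "category C \<Longrightarrow> f \<in> Ar C \<Longrightarrow> Tgt C f \<in> Ob C"
  and cat_Idn: "category C \<Longrightarrow> x \<in> Ob C \<Longrightarrow> Idn C x \<in> Ar C"
  and cat_Src_Idn: "category C \<Longrightarrow> x \<in> Ob C \<Longrightarrow> Src C (Idn C x) = x"
  and cat_Tgt_Idn: "category C \<Longrightarrow> x \<in> Ob C \<Longrightarrow> Tgt C (Idn C x) = x"
  and cat_Idn_right: "category C \<Longrightarrow> f \<in> Ar C \<Longrightarrow> Src C f = x \<Longrightarrow> Cmp C f (Idn C x) = f"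
  and cat_Idn_left: "category C \<Longrightarrow> f \<in> Ar C \<Longrightarrow> Tgt C f = x \<Longrightarrow> Cmp C (Idn C x) f = f"
  by (auto simp: category_def)

lemma cat_Cmp:
  assumes "category C" "f \<in> Ar C" "g \<in> Ar C" "Tgt C f = Src C g"
  shows "Cmp C g f \<in> Ar C" "Src C (Cmp C g f) = Src C f" "Tgt C (Cmp C g f) = Tgt C g"
  using assms by (auto simp: category_def)

lemma cat_assoc:
  assumes "category C" "f \<in> Ar C" "g \<in> Ar C" "h \<in> Ar C" "Tgt C f = Src C g" "Tgt C g = Src C h"
  shows "Cmp C h (Cmp C g f) = Cmp C (Cmp C h g) f"
  using assms by (auto simp: category_def)

lemmas cat_rules = cat_Src cat_Tgt cat_Idn cat_Src_Idn cat_Tgt_Idn cat_Idn_right cat_Idn_left cat_Cmp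

lemma op_cat_simps [simp]:
  "Ob (op_cat C) = Ob C" "Ar (op_cat C) = Ar C" "Src (op_cat C) = Tgt C" "Tgt (op_cat C) = Src C"
  "Idn (op_cat C) = Idn C" "Cmp (op_cat C) g f = Cmp C f g"
  by (simp_all add: op_cat_def)

lemma full_subcat_simps [simp]:
  "Ob (full_subcat C P) = {x \<in> Ob C. P x}"
  "Ar (full_subcat C P) = {f \<in> Ar C. P (Src C f) \<and> P (Tgt C f)}"
  "Src (full_subcat C P) = Src C" "Tgt (full_subcat C P) = Tgt C"
  "Idn (full_subcat C P) = Idn C" "Cmp (full_subcat C P) = Cmp C"
  by (simp_all add: full_subcat_def)

lemma category_op: "category C \<Longrightarrow> category (op_cat C)"
  unfolding category_def by auto

lemma category_full_subcat: "category C \<Longrightarrow> category (full_subcat C P)"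
  unfolding category_def by auto

lemma functor_Ob: "is_functor A B F \<Longrightarrow> x \<in> Ob A \<Longrightarrow> obm F x \<in> Ob B"
  and functor_Ar: "is_functor A B F \<Longrightarrow> f \<in> Ar A \<Longrightarrow> arm F f \<in> Ar B"
  and functor_Src: "is_functor A B F \<Longrightarrow> f \<in> Ar A \<Longrightarrow> Src B (arm F f) = obm F (Src A f)"
  and functor_Tgt: "is_functor A B F \<Longrightarrow> f \<in> Ar A \<Longrightarrow> Tgt B (arm F f) = obm F (Tgt A f)"
  and functor_Idn: "is_functor A B F \<Longrightarrow> x \<in> Ob A \<Longrightarrow> arm F (Idn A x) = Idn B (obm F x)"
  and functor_Cmp: "is_functor A B F \<Longrightarrow> f \<in> Ar A \<Longrightarrow> g \<in> Ar A \<Longrightarrow> Tgt A f = Src A g \<Longrightarrow>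
    arm F (Cmp A g f) = Cmp B (arm F g) (arm F f)"
  unfolding is_functor_def by auto

lemmas functor_rules = functor_Ob functor_Ar functor_Src functor_Tgt

lemma nat_Ar: "nat_trans A B F G t \<Longrightarrow> x \<in> Ob A \<Longrightarrow> t x \<in> Ar B"
  and nat_Src: "nat_trans A B F G t \<Longrightarrow> x \<in> Ob A \<Longrightarrow> Src B (t x) = obm F x"
  and nat_Tgt: "nat_trans A B F G t \<Longrightarrow> x \<in> Ob A \<Longrightarrow> Tgt B (t x) = obm G x"
  and nat_ext: "nat_trans A B F G t \<Longrightarrow> t \<in> extensional (Ob A)"
  and nat_sq: "nat_trans A B F G t \<Longrightarrow> f \<in> Ar A \<Longrightarrow>
    Cmp B (arm G f) (t (Src A f)) = Cmp B (t (Tgt A f)) (arm F f)"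
  and nat_dom: "nat_trans A B F G t \<Longrightarrow> is_functor A B F"
  unfolding nat_trans_def by (auto simp: PiE_def)

lemmas nat_rules = nat_Ar nat_Src nat_Tgt

lemma nat_transI:
  assumes "is_functor A B F" "is_functor A B G" "t \<in> extensional (Ob A)"
    and "\<And>x. x \<in> Ob A \<Longrightarrow> t x \<in> Ar B \<and> Src B (t x) = obm F x \<and> Tgt B (t x) = obm G x"
    and "\<And>f. f \<in> Ar A \<Longrightarrow> Cmp B (arm G f) (t (Src A f)) = Cmp B (t (Tgt A f)) (arm F f)"
  shows "nat_trans A B F G t"
  using assms unfolding nat_trans_def by (auto simp: PiE_def)

lemma functor_cat_simps [simp]:
  "Ob (functor_cat A B) = {F. is_functor A B F}"
  "(F, t, G) \<in> Ar (functor_cat A B) \<longleftrightarrow> nat_trans A B F G t"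
  "Src (functor_cat A B) (F, t, G) = F" "Tgt (functor_cat A B) (F, t, G) = G"
  "Idn (functor_cat A B) F = (F, \<lambda>x\<in>Ob A. Idn B (obm F x), F)"
  "Cmp (functor_cat A B) (G, s, H) (F, t, G') = (F, \<lambda>x\<in>Ob A. Cmp B (s x) (t x), H)"
  by (simp_all add: functor_cat_def)

lemma functor_cat_ArE:
  assumes "a \<in> Ar (functor_cat A B)"
  obtains t where "a = (Src (functor_cat A B) a, t, Tgt (functor_cat A B) a)"
    "nat_trans A B (Src (functor_cat A B) a) (Tgt (functor_cat A B) a) t"
  using assms by (auto simp: functor_cat_def)

lemma nat_trans_Idn:
  assumes A: "category A" and B: "category B" and F: "is_functor A B F"
  shows "nat_trans A B F F (\<lambda>x\<in>Ob A. Idn B (obm F x))"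
  using F by (intro nat_transI) (auto simp: cat_rules[OF A] cat_rules[OF B] functor_rules[OF F])

lemma nat_trans_Cmp:
  assumes A: "category A" and B: "category B" and t: "nat_trans A B F G t" and s: "nat_trans A B G H s"
  shows "nat_trans A B F H (\<lambda>x\<in>Ob A. Cmp B (s x) (t x))"
proof (rule nat_transI)
  show F: "is_functor A B F" and H: "is_functor A B H" using s t by (auto simp: nat_trans_def)
  have G: "is_functor A B G" using t by (auto simp: nat_trans_def)
  fix f assume f: "f \<in> Ar A"
  let ?x = "Src A f" and ?y = "Tgt A f"
  have xy: "?x \<in> Ob A" "?y \<in> Ob A" using f A by (auto simp: cat_rules)
  have "Cmp B (arm H f) (Cmp B (s ?x) (t ?x)) = Cmp B (Cmp B (arm H f) (s ?x)) (t ?x)"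
    by (rule cat_assoc[OF B]) (use xy f in \<open>auto simp: nat_rules[OF t] nat_rules[OF s] functor_rules[OF H]\<close>)
  also have "\<dots> = Cmp B (Cmp B (s ?y) (arm G f)) (t ?x)" by (simp add: nat_sq[OF s f])
  also have "\<dots> = Cmp B (s ?y) (Cmp B (arm G f) (t ?x))"
    by (rule cat_assoc[OF B, symmetric]) (use xy f in \<open>auto simp: nat_rules[OF t] nat_rules[OF s] functor_rules[OF G]\<close>)
  also have "\<dots> = Cmp B (s ?y) (Cmp B (t ?y) (arm F f))" by (simp add: nat_sq[OF t f])
  also have "\<dots> = Cmp B (Cmp B (s ?y) (t ?y)) (arm F f)"
    by (rule cat_assoc[OF B]) (use xy f in \<open>auto simp: nat_rules[OF t] nat_rules[OF s] functor_rules[OF F]\<close>)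
  finally show "Cmp B (arm H f) ((\<lambda>x\<in>Ob A. Cmp B (s x) (t x)) (Src A f))
      = Cmp B ((\<lambda>x\<in>Ob A. Cmp B (s x) (t x)) (Tgt A f)) (arm F f)" using xy by simp
qed (auto simp: cat_Cmp[OF B] nat_rules[OF t] nat_rules[OF s])

lemma category_functor_cat:
  assumes A: "category A" and B: "category B"
  shows "category (functor_cat A B)"
  unfolding category_def
proof (intro conjI ballI impI)
  fix a assume "a \<in> Ar (functor_cat A B)"
  then obtain F t G where a: "a = (F, t, G)" "nat_trans A B F G t" by (metis functor_cat_ArE)
  show "Src (functor_cat A B) a \<in> Ob (functor_cat A B)" "Tgt (functor_cat A B) a \<in> Ob (functor_cat A B)"
    using a by (auto simp: nat_trans_def)
  show "Cmp (functor_cat A B) a (Idn (functor_cat A B) (Src (functor_cat A B) a)) = a"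
    "Cmp (functor_cat A B) (Idn (functor_cat A B) (Tgt (functor_cat A B) a)) a = a"
    using a by (auto intro!: extensionalityI[OF _ nat_ext[OF a(2)]] simp: cat_rules[OF B] nat_rules[OF a(2)])
next
  fix a b assume "a \<in> Ar (functor_cat A B)" "b \<in> Ar (functor_cat A B)"
    and e: "Tgt (functor_cat A B) a = Src (functor_cat A B) b"
  then obtain F t G s H where "a = (F, t, G)" "nat_trans A B F G t" "b = (G, s, H)" "nat_trans A B G H s"
    by (smt (verit) functor_cat_ArE functor_cat_simps(3,4))
  then show "Cmp (functor_cat A B) b a \<in> Ar (functor_cat A B)"
    "Src (functor_cat A B) (Cmp (functor_cat A B) b a) = Src (functor_cat A B) a"
    "Tgt (functor_cat A B) (Cmp (functor_cat A B) b a) = Tgt (functor_cat A B) b"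
    using nat_trans_Cmp[OF A B] by auto
next
  fix a b c assume "a \<in> Ar (functor_cat A B)" "b \<in> Ar (functor_cat A B)" "c \<in> Ar (functor_cat A B)"
    and e: "Tgt (functor_cat A B) a = Src (functor_cat A B) b" "Tgt (functor_cat A B) b = Src (functor_cat A B) c"
  then obtain F t G s H r K where *: "a = (F, t, G)" "nat_trans A B F G t" "b = (G, s, H)" "nat_trans A B G H s"
      "c = (H, r, K)" "nat_trans A B H K r"
    by (smt (verit) functor_cat_ArE functor_cat_simps(3,4))
  have "Cmp B (r x) (Cmp B (s x) (t x)) = Cmp B (Cmp B (r x) (s x)) (t x)" if "x \<in> Ob A" for x
    by (rule cat_assoc[OF B]) (use that in \<open>auto simp: nat_rules[OF *(2)] nat_rules[OF *(4)] nat_rules[OF *(6)]\<close>)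
  then show "Cmp (functor_cat A B) c (Cmp (functor_cat A B) b a) = Cmp (functor_cat A B) (Cmp (functor_cat A B) c b) a"
    using * by (auto intro!: restrict_ext)
qed (auto simp: nat_trans_Idn[OF A B])

lemma functor_id: "category A \<Longrightarrow> is_functor A A (id_func A)"
  unfolding is_functor_def id_func_def by (auto simp: cat_rules)

lemma functor_comp:
  assumes A: "category A" and F: "is_functor A B F" and G: "is_functor B C G"
  shows "is_functor A C (comp_func A G F)"
  using F G unfolding is_functor_def comp_func_def by (auto simp: cat_rules[OF A] PiE_iff)

lemma functor_precomp:
  assumes A: "category A" and B: "category B" and E: "category E" and K: "is_functor A B K"
  shows "is_functor (functor_cat B E) (functor_cat A E) (precomp A B E K)"
proof -
  have nt: "nat_trans A E (comp_func A X K) (comp_func A Y K) (\<lambda>x\<in>Ob A. t (obm K x))"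
    if t: "nat_trans B E X Y t" for X Y t
  proof (rule nat_transI)
    show "is_functor A E (comp_func A X K)" "is_functor A E (comp_func A Y K)"
      using t functor_comp[OF A K] by (auto simp: nat_trans_def)
    fix f assume f: "f \<in> Ar A"
    show "Cmp E (arm (comp_func A Y K) f) ((\<lambda>x\<in>Ob A. t (obm K x)) (Src A f)) =
         Cmp E ((\<lambda>x\<in>Ob A. t (obm K x)) (Tgt A f)) (arm (comp_func A X K) f)"
      using f nat_sq[OF t, of "arm K f"] K
      by (simp add: comp_func_def cat_rules[OF A] functor_rules[OF K])
  qed (auto simp: comp_func_def functor_rules[OF K] nat_rules[OF t])
  show ?thesis
    unfolding is_functor_def
  proof (intro conjI ballI impI)
    show "obm (precomp A B E K) \<in> Ob (functor_cat B E) \<rightarrow>\<^sub>E Ob (functor_cat A E)"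
      using functor_comp[OF A K] by (auto simp: precomp_def)
    show "arm (precomp A B E K) \<in> Ar (functor_cat B E) \<rightarrow>\<^sub>E Ar (functor_cat A E)"
      using nt by (auto simp: precomp_def elim!: functor_cat_ArE)
  next
    fix a assume a: "a \<in> Ar (functor_cat B E)"
    then obtain F t G where "a = (F, t, G)" "nat_trans B E F G t" by (metis functor_cat_ArE)
    then show "Src (functor_cat A E) (arm (precomp A B E K) a) = obm (precomp A B E K) (Src (functor_cat B E) a)"
      "Tgt (functor_cat A E) (arm (precomp A B E K) a) = obm (precomp A B E K) (Tgt (functor_cat B E) a)"
      by (auto simp: precomp_def nat_trans_def)
  next
    fix F assume F: "F \<in> Ob (functor_cat B E)"
    then have "nat_trans B E F F (\<lambda>x\<in>Ob B. Idn E (obm F x))" using nat_trans_Idn[OF B E] by auto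
    then show "arm (precomp A B E K) (Idn (functor_cat B E) F) = Idn (functor_cat A E) (obm (precomp A B E K) F)"
      using F by (auto simp: precomp_def comp_func_def functor_rules[OF K] intro!: restrict_ext)
  next
    fix a b assume "a \<in> Ar (functor_cat B E)" "b \<in> Ar (functor_cat B E)"
      and e: "Tgt (functor_cat B E) a = Src (functor_cat B E) b"
    then obtain F t G s H where *: "a = (F, t, G)" "nat_trans B E F G t" "b = (G, s, H)" "nat_trans B E G H s"
      by (smt (verit) functor_cat_ArE functor_cat_simps(3,4))
    moreover have "nat_trans B E F H (\<lambda>x\<in>Ob B. Cmp E (s x) (t x))" using * nat_trans_Cmp[OF B E] by auto
    ultimately show "arm (precomp A B E K) (Cmp (functor_cat B E) b a)
       = Cmp (functor_cat A E) (arm (precomp A B E K) b) (arm (precomp A B E K) a)"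
      by (auto simp: precomp_def functor_rules[OF K] intro!: restrict_ext)
  qed
qed

text \<open>Each \<open>e x\<close> is a universal arrow from \<open>F\<close> to \<open>x\<close>.
  Functoriality of \<open>G\<close>, naturality of the unit and the second triangle law are
  equations between arrows into some \<open>g x\<close>, so they can be checked after applying
  \<open>F\<close> and composing with \<open>e x\<close>. The values of \<open>G\<close> on objects
  are kept in the conclusion because they are to be Kan extensions.\<close>

lemma universal_arrows_adjunction:
  fixes F :: "('p, 'n, 'o, 'm) func"
  assumes D: "category D" and C: "category C" and F: "is_functor D C F"
    and ge: "\<And>x. x \<in> Ob C \<Longrightarrow> g x \<in> Ob D \<and> e x \<in> Ar C \<and> Src C (e x) = obm F (g x) \<and> Tgt C (e x) = x"
    and univ: "\<And>x y f. x \<in> Ob C \<Longrightarrow> y \<in> Ob D \<Longrightarrow> f \<in> Ar C \<Longrightarrow> Src C f = obm F y \<Longrightarrow> Tgt C f = x \<Longrightarrow>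
       \<exists>!h. h \<in> Ar D \<and> Src D h = y \<and> Tgt D h = g x \<and> Cmp C (e x) (arm F h) = f"
  shows "\<exists>G \<eta>. adjunction D C F G \<eta> (restrict e (Ob C)) \<and> (\<forall>x\<in>Ob C. obm G x = g x)"
proof -
  \<comment> \<open>The transpose of \<open>f\<close> under the adjunction to be built.\<close>
  define tr where "tr x y f = (THE h. h \<in> Ar D \<and> Src D h = y \<and> Tgt D h = g x \<and> Cmp C (e x) (arm F h) = f)" for x y f
  have tr: "tr x y f \<in> Ar D \<and> Src D (tr x y f) = y \<and> Tgt D (tr x y f) = g x \<and> Cmp C (e x) (arm F (tr x y f)) = f"
    if "x \<in> Ob C" "y \<in> Ob D" "f \<in> Ar C" "Src C f = obm F y" "Tgt C f = x" for x y f
    unfolding tr_def by (rule theI'[OF univ[OF that]])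
  note Cr = cat_rules[OF C] and Dr = cat_rules[OF D] and Fr = functor_rules[OF F] functor_Idn[OF F]
  \<comment> \<open>Uniqueness in \<open>univ\<close>, turned into a cancellation rule for
    \<open>e x\<close>.\<close>
  have uniq: "h = h'" if "x \<in> Ob C" "h \<in> Ar D" "h' \<in> Ar D" "Src D h = Src D h'" "Tgt D h = g x" "Tgt D h' = g x"
     "Cmp C (e x) (arm F h) = Cmp C (e x) (arm F h')" for x h h'
  proof -
    have "Cmp C (e x) (arm F h') \<in> Ar C \<and> Src C (Cmp C (e x) (arm F h')) = obm F (Src D h') \<and> Tgt C (Cmp C (e x) (arm F h')) = x"
      using that ge[OF that(1)] by (simp add: Cr Fr)
    then show ?thesis using univ[of x "Src D h'" "Cmp C (e x) (arm F h')"] that Dr(1)[of h'] by metis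
  qed
  define Ga where "Ga u = tr (Tgt C u) (g (Src C u)) (Cmp C u (e (Src C u)))" for u
  define eta where "eta y = tr (obm F y) y (Idn C (obm F y))" for y
  have Ga: "Ga u \<in> Ar D" "Src D (Ga u) = g (Src C u)" "Tgt D (Ga u) = g (Tgt C u)"
    "Cmp C (e (Tgt C u)) (arm F (Ga u)) = Cmp C u (e (Src C u))" if "u \<in> Ar C" for u
    using tr[of "Tgt C u" "g (Src C u)" "Cmp C u (e (Src C u))"] that ge[of "Src C u"] ge[of "Tgt C u"]
    by (simp_all add: Ga_def Cr)
  have eta: "eta y \<in> Ar D" "Src D (eta y) = y" "Tgt D (eta y) = g (obm F y)"
    "Cmp C (e (obm F y)) (arm F (eta y)) = Idn C (obm F y)" if "y \<in> Ob D" for y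
    using tr[of "obm F y" y "Idn C (obm F y)"] that by (simp_all add: eta_def Cr Fr)
  define G where "G = \<lparr>obm = restrict g (Ob C), arm = restrict Ga (Ar C)\<rparr>"
  have Gsimp: "x \<in> Ob C \<Longrightarrow> obm G x = g x" "u \<in> Ar C \<Longrightarrow> arm G u = Ga u" for x u
    by (simp_all add: G_def)
  have FC: "arm F (Cmp D k h) = Cmp C (arm F k) (arm F h)" if "h \<in> Ar D" "k \<in> Ar D" "Tgt D h = Src D k" for h k
    using functor_Cmp[OF F that] .
  have GF: "is_functor C D G"
    unfolding is_functor_def
  proof (intro conjI ballI impI)
    fix x assume x: "x \<in> Ob C"
    have "Ga (Idn C x) = Idn D (g x)"
      by (rule uniq[of x]) (use x ge[OF x] Ga[of "Idn C x"] in \<open>simp_all add: Cr Dr Fr\<close>)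
    then show "arm G (Idn C x) = Idn D (obm G x)" using x by (simp add: Gsimp Cr)
  next
    fix u v assume u: "u \<in> Ar C" and v: "v \<in> Ar C" and uv: "Tgt C u = Src C v"
    have cu: "Cmp C v u \<in> Ar C" "Src C (Cmp C v u) = Src C u" "Tgt C (Cmp C v u) = Tgt C v"
      using u v uv by (auto simp: Cr)
    have s: "Src C u \<in> Ob C" "Src C v \<in> Ob C" "Tgt C v \<in> Ob C" using u v by (auto simp: Cr)
    note gs = ge[OF s(1)] ge[OF s(2)] ge[OF s(3)]
    have "Ga (Cmp C v u) = Cmp D (Ga v) (Ga u)"
    proof (rule uniq[OF s(3)])
      have "Cmp C (e (Tgt C v)) (arm F (Cmp D (Ga v) (Ga u))) = Cmp C (e (Tgt C v)) (Cmp C (arm F (Ga v)) (arm F (Ga u)))"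
        using u v uv by (simp add: FC Ga)
      also have "\<dots> = Cmp C (Cmp C (e (Tgt C v)) (arm F (Ga v))) (arm F (Ga u))"
        by (rule cat_assoc[OF C]) (use u v uv gs in \<open>simp_all add: Fr Ga\<close>)
      also have "\<dots> = Cmp C (Cmp C v (e (Tgt C u))) (arm F (Ga u))" using v uv by (simp add: Ga)
      also have "\<dots> = Cmp C v (Cmp C (e (Tgt C u)) (arm F (Ga u)))"
        by (rule cat_assoc[OF C, symmetric]) (use u v uv gs in \<open>simp_all add: Fr Ga\<close>)
      also have "\<dots> = Cmp C v (Cmp C u (e (Src C u)))" using u by (simp add: Ga)
      also have "\<dots> = Cmp C (Cmp C v u) (e (Src C u))"
        by (rule cat_assoc[OF C]) (use u v uv gs in simp_all)
      finally show "Cmp C (e (Tgt C v)) (arm F (Ga (Cmp C v u))) = Cmp C (e (Tgt C v)) (arm F (Cmp D (Ga v) (Ga u)))"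
        using Ga[OF cu(1)] cu by simp
    qed (use u v uv cu in \<open>simp_all add: Ga Dr\<close>)
    then show "arm G (Cmp C v u) = Cmp D (arm G v) (arm G u)" using u v cu by (simp add: Gsimp)
  qed (use ge Ga in \<open>auto simp: G_def Cr\<close>)
  have comps: "x \<in> Ob C \<Longrightarrow> obm (comp_func C F G) x = obm F (g x)" "y \<in> Ob D \<Longrightarrow> obm (comp_func D G F) y = g (obm F y)"
    "u \<in> Ar C \<Longrightarrow> arm (comp_func C F G) u = arm F (Ga u)" "h \<in> Ar D \<Longrightarrow> arm (comp_func D G F) h = Ga (arm F h)" for x y u h
    by (simp_all add: comp_func_def Gsimp Fr)
  have ids: "y \<in> Ob D \<Longrightarrow> obm (id_func D) y = y" "x \<in> Ob C \<Longrightarrow> obm (id_func C) x = x"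
    "u \<in> Ar C \<Longrightarrow> arm (id_func C) u = u" "h \<in> Ar D \<Longrightarrow> arm (id_func D) h = h" for x y u h
    by (simp_all add: id_func_def)
  have nt1: "nat_trans D D (id_func D) (comp_func D G F) (restrict eta (Ob D))"
  proof (rule nat_transI)
    fix h assume h: "h \<in> Ar D"
    let ?y = "Src D h" and ?z = "Tgt D h"
    have yz: "?y \<in> Ob D" "?z \<in> Ob D" using h by (auto simp: Dr)
    have Fyz: "obm F ?y \<in> Ob C" "obm F ?z \<in> Ob C" using yz by (auto simp: Fr)
    note g' = ge[OF Fyz(1)] ge[OF Fyz(2)]
    have Fh: "arm F h \<in> Ar C" "Src C (arm F h) = obm F ?y" "Tgt C (arm F h) = obm F ?z" using h by (auto simp: Fr)
    have "Cmp D (Ga (arm F h)) (eta ?y) = Cmp D (eta ?z) h"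
    proof (rule uniq[OF Fyz(2)])
      have "Cmp C (e (obm F ?z)) (arm F (Cmp D (Ga (arm F h)) (eta ?y)))
          = Cmp C (e (obm F ?z)) (Cmp C (arm F (Ga (arm F h))) (arm F (eta ?y)))"
        using yz Fh by (simp add: FC Ga eta)
      also have "\<dots> = Cmp C (Cmp C (e (obm F ?z)) (arm F (Ga (arm F h)))) (arm F (eta ?y))"
        by (rule cat_assoc[OF C]) (use yz Fh g' in \<open>simp_all add: Fr Ga eta\<close>)
      also have "\<dots> = Cmp C (Cmp C (arm F h) (e (obm F ?y))) (arm F (eta ?y))"
        using Ga(4)[OF Fh(1)] Fh by simp
      also have "\<dots> = Cmp C (arm F h) (Cmp C (e (obm F ?y)) (arm F (eta ?y)))"
        by (rule cat_assoc[OF C, symmetric]) (use yz Fh g' in \<open>simp_all add: Fr Ga eta\<close>)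
      also have "\<dots> = arm F h" using yz Fh by (simp add: eta Cr)
      also have "\<dots> = Cmp C (Cmp C (e (obm F ?z)) (arm F (eta ?z))) (arm F h)"
        using yz Fh by (simp add: eta Cr)
      also have "\<dots> = Cmp C (e (obm F ?z)) (Cmp C (arm F (eta ?z)) (arm F h))"
        by (rule cat_assoc[OF C, symmetric]) (use yz Fh g' in \<open>simp_all add: Fr Ga eta\<close>)
      also have "\<dots> = Cmp C (e (obm F ?z)) (arm F (Cmp D (eta ?z) h))"
        using yz h by (simp add: FC eta)
      finally show "Cmp C (e (obm F ?z)) (arm F (Cmp D (Ga (arm F h)) (eta ?y))) = Cmp C (e (obm F ?z)) (arm F (Cmp D (eta ?z) h))" .
    qed (use yz Fh h in \<open>simp_all add: Ga eta Dr\<close>)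
    then show "Cmp D (arm (comp_func D G F) h) (restrict eta (Ob D) (Src D h)) = Cmp D (restrict eta (Ob D) (Tgt D h)) (arm (id_func D) h)"
      using h yz by (simp add: comps ids)
  qed (use eta functor_id[OF D] functor_comp[OF D F GF] in \<open>auto simp: comps ids\<close>)
  have nt2: "nat_trans C C (comp_func C F G) (id_func C) (restrict e (Ob C))"
    by (rule nat_transI) (use ge Ga functor_id[OF C] functor_comp[OF C GF F] in \<open>auto simp: comps ids Cr\<close>)
  have "Cmp D (arm G (e x)) (eta (g x)) = Idn D (g x)" if x: "x \<in> Ob C" for x
  proof (rule uniq[OF x])
    note g' = ge[OF x] and Fg = functor_Ob[OF F, of "g x"]
    have eF: "e (obm F (g x)) \<in> Ar C" "Src C (e (obm F (g x))) = obm F (g (obm F (g x)))" "Tgt C (e (obm F (g x))) = obm F (g x)"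
      using ge[of "obm F (g x)"] g' Fg by auto
    have "Cmp C (e x) (arm F (Cmp D (Ga (e x)) (eta (g x)))) = Cmp C (e x) (Cmp C (arm F (Ga (e x))) (arm F (eta (g x))))"
      using g' by (simp add: FC Ga eta)
    also have "\<dots> = Cmp C (Cmp C (e x) (arm F (Ga (e x)))) (arm F (eta (g x)))"
      by (rule cat_assoc[OF C]) (use g' in \<open>simp_all add: Fr Ga eta\<close>)
    also have "\<dots> = Cmp C (Cmp C (e x) (e (obm F (g x)))) (arm F (eta (g x)))"
      using g' Ga(4)[of "e x"] by simp
    also have "\<dots> = Cmp C (e x) (Cmp C (e (obm F (g x))) (arm F (eta (g x))))"
      by (rule cat_assoc[OF C, symmetric]) (use g' eF in \<open>simp_all add: Fr Ga eta\<close>)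
    also have "\<dots> = Cmp C (e x) (arm F (Idn D (g x)))" using g' by (simp add: eta Fr)
    finally show "Cmp C (e x) (arm F (Cmp D (arm G (e x)) (eta (g x)))) = Cmp C (e x) (arm F (Idn D (g x)))"
      using g' by (simp add: Gsimp)
  qed (use ge[OF x] in \<open>simp_all add: Gsimp Ga eta Dr\<close>)
  then have "adjunction D C F G (restrict eta (Ob D)) (restrict e (Ob C))"
    unfolding adjunction_def using D C F GF nt1 nt2 eta ge by (simp add: Fr Gsimp)
  then show ?thesis using Gsimp by blast
qed

text \<open>Fullness makes the inverse of \<open>\<eta> y\<close> available in the subcategory as
  soon as both ends satisfy \<open>Q\<close>, and \<open>G\<close> lands there by assumption. The
  category \<open>C\<close> is not cut down, so \<open>\<epsilon>\<close> and its inverses stay the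
  same.\<close>

lemma adjoint_equivalence_full_subcat:
  assumes adj: "adjunction D C F G \<eta> \<epsilon>"
    and Q: "\<And>x. x \<in> Ob C \<Longrightarrow> Q (obm G x)"
    and eta: "\<And>y. y \<in> Ob D \<Longrightarrow> Q y \<Longrightarrow> is_iso D (\<eta> y)"
    and eps: "\<And>x. x \<in> Ob C \<Longrightarrow> is_iso C (\<epsilon> x)"
  shows "adjoint_equivalence (full_subcat D Q) C (restrict_func F (full_subcat D Q)) G
    (restrict \<eta> (Ob (full_subcat D Q))) \<epsilon>"
proof -
  let ?D = "full_subcat D Q" and ?F = "restrict_func F (full_subcat D Q)"
  have D: "category D" and C: "category C" and F: "is_functor D C F" and G: "is_functor C D G"
    and n1: "nat_trans D D (id_func D) (comp_func D G F) \<eta>"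
    and n2: "nat_trans C C (comp_func C F G) (id_func C) \<epsilon>"
    and t1: "\<And>y. y \<in> Ob D \<Longrightarrow> Cmp C (\<epsilon> (obm F y)) (arm F (\<eta> y)) = Idn C (obm F y)"
    and t2: "\<And>x. x \<in> Ob C \<Longrightarrow> Cmp D (arm G (\<epsilon> x)) (\<eta> (obm G x)) = Idn D (obm G x)"
    using adj unfolding adjunction_def by auto
  note Fr = functor_rules[OF F] functor_Idn[OF F] and Gr = functor_rules[OF G] functor_Idn[OF G]
  have D': "category ?D" by (rule category_full_subcat[OF D])
  have F': "is_functor ?D C ?F"
    using F unfolding is_functor_def restrict_func_def by (auto simp: cat_rules[OF D] PiE_iff)
  have G': "is_functor C ?D G"
    unfolding is_functor_def
    using G Q by (auto simp: Gr functor_Cmp[OF G] cat_rules[OF C] PiE_iff is_functor_def)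
  have e1: "comp_func C ?F G = comp_func C F G"
    using Q by (auto simp: comp_func_def restrict_func_def Gr cat_rules[OF C] intro!: restrict_ext)
  have e2: "obm (comp_func ?D G ?F) y = obm G (obm F y)" if "y \<in> Ob ?D" for y
    using that by (simp add: comp_func_def restrict_func_def)
  have e3: "arm (comp_func ?D G ?F) h = arm G (arm F h)" if "h \<in> Ar ?D" for h
    using that by (simp add: comp_func_def restrict_func_def)
  have eta': "\<eta> y \<in> Ar D" "Src D (\<eta> y) = y" "Tgt D (\<eta> y) = obm G (obm F y)" if "y \<in> Ob D" for y
    using nat_rules[OF n1 that] that by (auto simp: id_func_def comp_func_def)
  have n1': "nat_trans ?D ?D (id_func ?D) (comp_func ?D G ?F) (restrict \<eta> (Ob ?D))"
  proof (rule nat_transI)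
    show "is_functor ?D ?D (id_func ?D)" by (rule functor_id[OF D'])
    show "is_functor ?D ?D (comp_func ?D G ?F)" by (rule functor_comp[OF D' F' G'])
    fix h assume h: "h \<in> Ar ?D"
    then show "Cmp ?D (arm (comp_func ?D G ?F) h) (restrict \<eta> (Ob ?D) (Src ?D h)) =
         Cmp ?D (restrict \<eta> (Ob ?D) (Tgt ?D h)) (arm (id_func ?D) h)"
      using nat_sq[OF n1, of h] by (simp add: e3 cat_rules[OF D] id_func_def comp_func_def restrict_func_def)
  qed (use Q in \<open>auto simp: e2 eta' id_func_def Fr\<close>)
  have iso: "is_iso ?D (\<eta> y)" if "y \<in> Ob D" "Q y" for y
    using eta[OF that] Q[of "obm F y"] that eta'[OF that(1)] unfolding is_iso_def by (auto simp: Fr)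
  show ?thesis
    unfolding adjoint_equivalence_def adjunction_def
  proof (intro conjI ballI)
    show "category C" by (rule C)
    show "nat_trans C C (comp_func C ?F G) (id_func C) \<epsilon>" using n2 e1 by simp
    fix y assume y: "y \<in> Ob ?D"
    have "arm ?F (\<eta> y) = arm F (\<eta> y)" "obm ?F y = obm F y"
      using y eta'[of y] Q[of "obm F y"] by (auto simp: restrict_func_def Fr)
    then show "Cmp C (\<epsilon> (obm ?F y)) (arm ?F (restrict \<eta> (Ob ?D) y)) = Idn C (obm ?F y)"
      using y t1[of y] by simp
  next
    fix x assume x: "x \<in> Ob C"
    then have "obm G x \<in> Ob ?D" using Q Gr by auto
    then show "Cmp ?D (arm G (\<epsilon> x)) (restrict \<eta> (Ob ?D) (obm G x)) = Idn ?D (obm G x)"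
      using t2[OF x] by simp
  qed (use D' F' G' n1' iso eps in auto)
qed


section \<open>Presheaves of small sets\<close>

lemma restrict_eqD: "restrict f A = restrict g A \<Longrightarrow> x \<in> A \<Longrightarrow> f x = g x"
  by (metis restrict_apply')

abbreviation fn :: "'u set_arrow \<Rightarrow> 'u \<Rightarrow> 'u" where
  "fn a \<equiv> fst (snd a)"

abbreviation act :: "('o, 'm, 'u set, 'u set_arrow) func \<Rightarrow> 'm \<Rightarrow> 'u \<Rightarrow> 'u" where
  "act X f \<equiv> fn (arm X f)"

abbreviation presheaf :: "('o, 'm) cat \<Rightarrow> 'u set set \<Rightarrow> ('o, 'm, 'u set, 'u set_arrow) func \<Rightarrow> bool" where
  "presheaf C \<U> X \<equiv> is_functor (op_cat C) (set_cat \<U>) X"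

abbreviation psh_trans :: "('o, 'm) cat \<Rightarrow> 'u set set \<Rightarrow> ('o, 'm, 'u set, 'u set_arrow) func
    \<Rightarrow> ('o, 'm, 'u set, 'u set_arrow) func \<Rightarrow> ('o \<Rightarrow> 'u set_arrow) \<Rightarrow> bool" where
  "psh_trans C \<U> X Y t \<equiv> nat_trans (op_cat C) (set_cat \<U>) X Y t"

lemma set_cat_simps [simp]:
  "Ob (set_cat \<U>) = \<U>"
  "a \<in> Ar (set_cat \<U>) \<longleftrightarrow> fst a \<in> \<U> \<and> snd (snd a) \<in> \<U> \<and> fn a \<in> fst a \<rightarrow>\<^sub>E snd (snd a)"
  "Src (set_cat \<U>) a = fst a" "Tgt (set_cat \<U>) a = snd (snd a)"
  "Idn (set_cat \<U>) A = (A, \<lambda>x\<in>A. x, A)"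
  "Cmp (set_cat \<U>) b a = (fst a, \<lambda>x\<in>fst a. fn b (fn a x), snd (snd b))"
  by (auto simp: set_cat_def split: prod.splits)

lemma category_set_cat: "category (set_cat \<U>)"
  unfolding category_def by (auto simp: PiE_iff extensional_def prod_eq_iff restrict_def)

lemma category_presheaves: "category C \<Longrightarrow> category (presheaves C \<U>)"
  unfolding presheaves_def by (intro category_functor_cat category_op category_set_cat)

lemma presheaf_arm:
  assumes "presheaf C \<U> X" "f \<in> Ar C"
  shows "(obm X (Tgt C f), act X f, obm X (Src C f)) = arm X f"
    and "fst (arm X f) = obm X (Tgt C f)" and "snd (snd (arm X f)) = obm X (Src C f)"
    and "act X f \<in> obm X (Tgt C f) \<rightarrow>\<^sub>E obm X (Src C f)"
  using functor_rules[OF assms(1)] assms(2) by (auto simp: prod_eq_iff)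

lemma presheaf_Ob: "presheaf C \<U> X \<Longrightarrow> S \<in> Ob C \<Longrightarrow> obm X S \<in> \<U>"
  using functor_Ob by fastforce

lemma act_closed:
  "presheaf C \<U> X \<Longrightarrow> f \<in> Ar C \<Longrightarrow> z \<in> obm X (Tgt C f) \<Longrightarrow> act X f z \<in> obm X (Src C f)"
  by (drule (1) presheaf_arm(4)) (erule PiE_mem)

lemma act_Idn: "presheaf C \<U> X \<Longrightarrow> S \<in> Ob C \<Longrightarrow> z \<in> obm X S \<Longrightarrow> act X (Idn C S) z = z"
  using functor_Idn[of "op_cat C" "set_cat \<U>" X S] by simp

lemma act_Cmp:
  assumes "presheaf C \<U> X" "f \<in> Ar C" "g \<in> Ar C" "Tgt C f = Src C g" "z \<in> obm X (Tgt C g)"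
  shows "act X (Cmp C g f) z = act X f (act X g z)"
  using functor_Cmp[OF assms(1), of g f] assms presheaf_arm(2)[OF assms(1,3)] by simp

lemma presheafI:
  assumes C: "category C" and "\<And>S. S \<in> Ob C \<Longrightarrow> O' S \<in> \<U>"
    and "\<And>f z. f \<in> Ar C \<Longrightarrow> z \<in> O' (Tgt C f) \<Longrightarrow> a f z \<in> O' (Src C f)"
    and "\<And>S z. S \<in> Ob C \<Longrightarrow> z \<in> O' S \<Longrightarrow> a (Idn C S) z = z"
    and "\<And>f g z. f \<in> Ar C \<Longrightarrow> g \<in> Ar C \<Longrightarrow> Tgt C f = Src C g \<Longrightarrow> z \<in> O' (Tgt C g) \<Longrightarrow>
           a (Cmp C g f) z = a f (a g z)"
  shows "presheaf C \<U> \<lparr>obm = restrict O' (Ob C),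
           arm = (\<lambda>f\<in>Ar C. (O' (Tgt C f), restrict (a f) (O' (Tgt C f)), O' (Src C f)))\<rparr>"
  unfolding is_functor_def
proof (intro conjI ballI impI)
  fix f g assume "f \<in> Ar (op_cat C)" "g \<in> Ar (op_cat C)" "Tgt (op_cat C) f = Src (op_cat C) g"
  then show "arm \<lparr>obm = restrict O' (Ob C), arm = (\<lambda>f\<in>Ar C. (O' (Tgt C f), restrict (a f) (O' (Tgt C f)), O' (Src C f)))\<rparr> (Cmp (op_cat C) g f)
    = Cmp (set_cat \<U>)
       (arm \<lparr>obm = restrict O' (Ob C), arm = (\<lambda>f\<in>Ar C. (O' (Tgt C f), restrict (a f) (O' (Tgt C f)), O' (Src C f)))\<rparr> g)
       (arm \<lparr>obm = restrict O' (Ob C), arm = (\<lambda>f\<in>Ar C. (O' (Tgt C f), restrict (a f) (O' (Tgt C f)), O' (Src C f)))\<rparr> f)"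
    using assms(3)[of f] assms(5)[of g f] by (auto simp: cat_rules[OF C] intro!: restrict_ext)
qed (use assms(2-4) in \<open>auto simp: cat_rules[OF C] intro!: restrict_ext\<close>)

lemma psh_trans_eq:
  assumes "psh_trans C \<U> X Y t" "S \<in> Ob C"
  shows "(obm X S, fn (t S), obm Y S) = t S" and "fst (t S) = obm X S" and "snd (snd (t S)) = obm Y S"
    and "fn (t S) \<in> obm X S \<rightarrow>\<^sub>E obm Y S"
  using nat_rules[OF assms(1)] assms(2) by (auto simp: prod_eq_iff)

lemma psh_trans_closed: "psh_trans C \<U> X Y t \<Longrightarrow> S \<in> Ob C \<Longrightarrow> z \<in> obm X S \<Longrightarrow> fn (t S) z \<in> obm Y S"
  by (drule (1) psh_trans_eq(4)) (erule PiE_mem)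

lemma psh_trans_natural:
  assumes C: "category C" and t: "psh_trans C \<U> X Y t" and f: "f \<in> Ar C" and z: "z \<in> obm X (Tgt C f)"
  shows "fn (t (Src C f)) (act X f z) = act Y f (fn (t (Tgt C f)) z)"
proof -
  have "fst (t (Tgt C f)) = obm X (Tgt C f)" "fst (arm X f) = obm X (Tgt C f)"
    using psh_trans_eq(2)[OF t] presheaf_arm(2)[OF nat_dom[OF t] f] cat_Tgt[OF C f] by auto
  then have "(\<lambda>x\<in>obm X (Tgt C f). fn (t (Src C f)) (act X f x)) = (\<lambda>x\<in>obm X (Tgt C f). act Y f (fn (t (Tgt C f)) x))"
    using nat_sq[OF t, of f] f by simp
  then show ?thesis by (rule restrict_eqD[OF _ z])
qed

lemma psh_transI:
  assumes C: "category C" and X: "presheaf C \<U> X" and Y: "presheaf C \<U> Y"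
    and cl: "\<And>S z. S \<in> Ob C \<Longrightarrow> z \<in> obm X S \<Longrightarrow> t S z \<in> obm Y S"
    and nt: "\<And>f z. f \<in> Ar C \<Longrightarrow> z \<in> obm X (Tgt C f) \<Longrightarrow> t (Src C f) (act X f z) = act Y f (t (Tgt C f) z)"
  shows "psh_trans C \<U> X Y (\<lambda>S\<in>Ob C. (obm X S, restrict (t S) (obm X S), obm Y S))"
proof (rule nat_transI)
  fix f assume f: "f \<in> Ar (op_cat C)"
  then show "Cmp (set_cat \<U>) (arm Y f) ((\<lambda>S\<in>Ob C. (obm X S, restrict (t S) (obm X S), obm Y S)) (Src (op_cat C) f)) =
         Cmp (set_cat \<U>) ((\<lambda>S\<in>Ob C. (obm X S, restrict (t S) (obm X S), obm Y S)) (Tgt (op_cat C) f)) (arm X f)"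
    by (auto simp: cat_rules[OF C] presheaf_arm(2-4)[OF X] presheaf_arm(2-4)[OF Y] act_closed[OF X] nt intro!: restrict_ext)
qed (use X Y cl in \<open>auto simp: presheaf_Ob\<close>)

lemma psh_trans_eqI:
  assumes "psh_trans C \<U> X Y t" "psh_trans C \<U> X Y s"
    and "\<And>S z. S \<in> Ob C \<Longrightarrow> z \<in> obm X S \<Longrightarrow> fn (t S) z = fn (s S) z"
  shows "t = s"
proof (rule extensionalityI)
  show "t \<in> extensional (Ob C)" "s \<in> extensional (Ob C)" using nat_ext assms by fastforce+
  fix S assume S: "S \<in> Ob C"
  have "fn (t S) = fn (s S)"
    using psh_trans_eq(4)[OF assms(1) S] psh_trans_eq(4)[OF assms(2) S] assms(3)[OF S] by (auto intro: PiE_ext)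
  then show "t S = s S" using psh_trans_eq(1)[OF assms(1) S] psh_trans_eq(1)[OF assms(2) S] by metis
qed

lemma psh_trans_iso:
  assumes C: "category C" and t: "psh_trans C \<U> X Y t"
    and bij: "\<And>S. S \<in> Ob C \<Longrightarrow> bij_betw (fn (t S)) (obm X S) (obm Y S)"
  shows "is_iso (presheaves C \<U>) (X, t, Y)"
proof -
  have X: "presheaf C \<U> X" and Y: "presheaf C \<U> Y" using t by (auto simp: nat_trans_def)
  define s where "s S = inv_into (obm X S) (fn (t S))" for S
  have s: "s S z \<in> obm X S \<and> fn (t S) (s S z) = z" if "S \<in> Ob C" "z \<in> obm Y S" for S z
    using bij[OF that(1)] that(2) unfolding s_def bij_betw_def by (auto intro: inv_into_into f_inv_into_f)
  have st: "s S (fn (t S) z) = z" if "S \<in> Ob C" "z \<in> obm X S" for S z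
    using bij[OF that(1)] that(2) unfolding s_def bij_betw_def by auto
  have nt: "psh_trans C \<U> Y X (\<lambda>S\<in>Ob C. (obm Y S, restrict (s S) (obm Y S), obm X S))"
  proof (rule psh_transI[OF C Y X])
    fix f z assume f: "f \<in> Ar C" and z: "z \<in> obm Y (Tgt C f)"
    have "s (Src C f) (act Y f (fn (t (Tgt C f)) (s (Tgt C f) z))) = act X f (s (Tgt C f) z)"
    proof -
      have sz: "s (Tgt C f) z \<in> obm X (Tgt C f)" using s[OF cat_Tgt[OF C f] z] by blast
      have "s (Src C f) (act Y f (fn (t (Tgt C f)) (s (Tgt C f) z)))
          = s (Src C f) (fn (t (Src C f)) (act X f (s (Tgt C f) z)))"
        by (simp only: psh_trans_natural[OF C t f sz])
      also have "\<dots> = act X f (s (Tgt C f) z)" by (rule st[OF cat_Src[OF C f] act_closed[OF X f sz]])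
      finally show ?thesis .
    qed
    then show "s (Src C f) (act Y f z) = act X f (s (Tgt C f) z)"
      using s z cat_Tgt[OF C f] by simp
  qed (use s in auto)
  show ?thesis
    unfolding is_iso_def presheaves_def
    using t nt by (intro conjI bexI[of _ "(Y, \<lambda>S\<in>Ob C. (obm Y S, restrict (s S) (obm Y S), obm X S), X)"])
      (auto simp: psh_trans_eq(2-4)[OF t] s st psh_trans_closed[OF t] intro!: restrict_ext)
qed

section \<open>Pullbacks of sets in terms of elements, and smallness\<close>

lemma is_pullback_setI:
  assumes "{f, g, p, q} \<subseteq> Ar (set_cat \<U>)" "Tgt (set_cat \<U>) f = Tgt (set_cat \<U>) g"
      "fst p = fst q" "snd (snd p) = fst f" "snd (snd q) = fst g"
    and comm: "\<And>z. z \<in> fst p \<Longrightarrow> fn f (fn p z) = fn g (fn q z)"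
    and ex1: "\<And>x y. x \<in> fst f \<Longrightarrow> y \<in> fst g \<Longrightarrow> fn f x = fn g y \<Longrightarrow> \<exists>z\<in>fst p. fn p z = x \<and> fn q z = y"
    and inj: "\<And>z w. z \<in> fst p \<Longrightarrow> w \<in> fst p \<Longrightarrow> fn p z = fn p w \<Longrightarrow> fn q z = fn q w \<Longrightarrow> z = w"
  shows "is_pullback (set_cat \<U>) f g p q"
  unfolding is_pullback_def
proof (intro conjI ballI impI)
  note d = assms(1-5)
  show "Cmp (set_cat \<U>) f p = Cmp (set_cat \<U>) g q"
  proof -
    have "(\<lambda>x\<in>fst p. fn f (fn p x)) = (\<lambda>x\<in>fst p. fn g (fn q x))" by (rule restrict_ext) (rule comm)
    then show ?thesis using d(2,3) by simp
  qed
  fix p' q' assume p': "p' \<in> Ar (set_cat \<U>)" and q': "q' \<in> Ar (set_cat \<U>)"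
    and e: "Src (set_cat \<U>) p' = Src (set_cat \<U>) q' \<and> Tgt (set_cat \<U>) p' = Src (set_cat \<U>) f \<and>
       Tgt (set_cat \<U>) q' = Src (set_cat \<U>) g \<and> Cmp (set_cat \<U>) f p' = Cmp (set_cat \<U>) g q'"
  have eq: "fn f (fn p' x) = fn g (fn q' x)" if "x \<in> fst p'" for x
  proof (rule restrict_eqD[OF _ that])
    show "(\<lambda>x\<in>fst p'. fn f (fn p' x)) = (\<lambda>x\<in>fst p'. fn g (fn q' x))" using e by (elim conjE) simp
  qed
  define u where "u x = (SOME z. z \<in> fst p \<and> fn p z = fn p' x \<and> fn q z = fn q' x)" for x
  have u: "u x \<in> fst p \<and> fn p (u x) = fn p' x \<and> fn q (u x) = fn q' x" if x: "x \<in> fst p'" for x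
  proof -
    have "fn p' x \<in> fst f" "fn q' x \<in> fst g" using p' q' e x by (auto simp: PiE_iff)
    then have "\<exists>z. z \<in> fst p \<and> fn p z = fn p' x \<and> fn q z = fn q' x" using ex1 eq[OF x] by metis
    then show ?thesis unfolding u_def by (rule someI_ex)
  qed
  show "\<exists>!u. u \<in> Ar (set_cat \<U>) \<and> Src (set_cat \<U>) u = Src (set_cat \<U>) p' \<and> Tgt (set_cat \<U>) u = Src (set_cat \<U>) p \<and>
              Cmp (set_cat \<U>) p u = p' \<and> Cmp (set_cat \<U>) q u = q'"
  proof (rule ex1I[of _ "(fst p', restrict u (fst p'), fst p)"])
    have "(\<lambda>x\<in>fst p'. fn p (restrict u (fst p') x)) = fn p'"
      using u p' by (auto simp: PiE_iff extensional_def fun_eq_iff)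
    moreover have "(\<lambda>x\<in>fst p'. fn q (restrict u (fst p') x)) = fn q'"
      using u q' e by (auto simp: PiE_iff extensional_def fun_eq_iff)
    ultimately show "(fst p', restrict u (fst p'), fst p) \<in> Ar (set_cat \<U>) \<and>
      Src (set_cat \<U>) (fst p', restrict u (fst p'), fst p) = Src (set_cat \<U>) p' \<and>
      Tgt (set_cat \<U>) (fst p', restrict u (fst p'), fst p) = Src (set_cat \<U>) p \<and>
      Cmp (set_cat \<U>) p (fst p', restrict u (fst p'), fst p) = p' \<and> Cmp (set_cat \<U>) q (fst p', restrict u (fst p'), fst p) = q'"
      using u p' q' d e by (auto simp: prod_eq_iff)
    fix v assume v: "v \<in> Ar (set_cat \<U>) \<and> Src (set_cat \<U>) v = Src (set_cat \<U>) p' \<and> Tgt (set_cat \<U>) v = Src (set_cat \<U>) p \<and>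
              Cmp (set_cat \<U>) p v = p' \<and> Cmp (set_cat \<U>) q v = q'"
    have v': "fn v \<in> fst p' \<rightarrow>\<^sub>E fst p" "fst v = fst p'" "snd (snd v) = fst p" using v by auto
    have "fn v x = u x" if x: "x \<in> fst p'" for x
    proof (rule inj)
      show "fn v x \<in> fst p" using v' x by auto
      have pq: "Cmp (set_cat \<U>) p v = p'" "Cmp (set_cat \<U>) q v = q'" using v by auto
      have "fn p' x = fn p (fn v x)" "fn q' x = fn q (fn v x)"
        unfolding pq(1)[symmetric] pq(2)[symmetric] using x v'(2) by auto
      then show "fn p (fn v x) = fn p (u x)" "fn q (fn v x) = fn q (u x)" using u[OF x] by auto
    qed (use u[OF x] in auto)
    then have "fn v = restrict u (fst p')" using v'(1) by (auto simp: PiE_iff extensional_def fun_eq_iff)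
    then show "v = (fst p', restrict u (fst p'), fst p)" using v' by (simp add: prod_eq_iff)
  qed
qed (use assms(1-5) in auto)

lemma small_subset:
  assumes U: "set_universe \<U>" and A: "A \<in> \<U>" and B: "B \<subseteq> A"
  shows "B \<in> \<U>"
proof -
  have "\<forall>B f. inj_on f B \<and> f ` B \<subseteq> A \<longrightarrow> B \<in> \<U>"
    using U A unfolding set_universe_def by (elim conjE bspec)
  from this[rule_format, of id B] show ?thesis using B by simp
qed

lemma singleton_small:
  assumes "set_universe \<U>" shows "\<exists>a. {a} \<in> \<U>"
proof -
  obtain x y where "{x, y} \<in> \<U>" using assms unfolding set_universe_def by blast
  then have "{x} \<in> \<U>" by (rule small_subset[OF assms]) simp
  then show ?thesis by blast
qed

text \<open>Elements of a set are the arrows from a one-point set, and the universe contains one;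
  the universal property is tested on that set alone.\<close>

lemma is_pullback_setD:
  assumes U: "set_universe \<U>" and pb: "is_pullback (set_cat \<U>) f g p q"
    and x: "x \<in> fst f" and y: "y \<in> fst g" and xy: "fn f x = fn g y"
  shows "\<exists>!z. z \<in> fst p \<and> fn p z = x \<and> fn q z = y"
proof -
  obtain a where a: "{a} \<in> \<U>" using singleton_small[OF U] by blast
  have d: "{f, g, p, q} \<subseteq> Ar (set_cat \<U>)" "snd (snd f) = snd (snd g)" "fst p = fst q"
      "snd (snd p) = fst f" "snd (snd q) = fst g" using pb unfolding is_pullback_def by auto
  let ?p = "({a}, \<lambda>_\<in>{a}. x, fst f)" and ?q = "({a}, \<lambda>_\<in>{a}. y, fst g)"
  have "\<exists>!u. u \<in> Ar (set_cat \<U>) \<and> Src (set_cat \<U>) u = {a} \<and> Tgt (set_cat \<U>) u = fst p \<and>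
              Cmp (set_cat \<U>) p u = ?p \<and> Cmp (set_cat \<U>) q u = ?q" (is "\<exists>!u. ?Q u")
  proof -
    have H: "\<forall>p'\<in>Ar (set_cat \<U>). \<forall>q'\<in>Ar (set_cat \<U>).
        Src (set_cat \<U>) p' = Src (set_cat \<U>) q' \<and> Tgt (set_cat \<U>) p' = Src (set_cat \<U>) f \<and> Tgt (set_cat \<U>) q' = Src (set_cat \<U>) g \<and>
        Cmp (set_cat \<U>) f p' = Cmp (set_cat \<U>) g q' \<longrightarrow>
        (\<exists>!u. u \<in> Ar (set_cat \<U>) \<and> Src (set_cat \<U>) u = Src (set_cat \<U>) p' \<and> Tgt (set_cat \<U>) u = Src (set_cat \<U>) p \<and>
              Cmp (set_cat \<U>) p u = p' \<and> Cmp (set_cat \<U>) q u = q')"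
      using pb unfolding is_pullback_def by (elim conjE)
    have 1: "?p \<in> Ar (set_cat \<U>)" "?q \<in> Ar (set_cat \<U>)" using a d x y by auto
    have "(\<lambda>u\<in>{a}. fn f x) = (\<lambda>u\<in>{a}. fn g y)" using xy by simp
    then have "Cmp (set_cat \<U>) f ?p = Cmp (set_cat \<U>) g ?q" using d xy by (auto intro!: restrict_ext)
    then show ?thesis using H[rule_format, OF 1] d by simp
  qed
  then obtain u where u: "?Q u" and un: "\<And>v. ?Q v \<Longrightarrow> v = u" by metis
  have eq: "?Q ({a}, \<lambda>_\<in>{a}. z, fst p) \<longleftrightarrow> z \<in> fst p \<and> fn p z = x \<and> fn q z = y" for z
    using a d by (auto simp: fun_eq_iff restrict_def PiE_iff extensional_def split: if_splits)
  show ?thesis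
  proof (rule ex1I[of _ "fn u a"])
    have "u = ({a}, \<lambda>_\<in>{a}. fn u a, fst p)"
      using u by (auto simp: prod_eq_iff PiE_iff extensional_def fun_eq_iff)
    then show "fn u a \<in> fst p \<and> fn p (fn u a) = x \<and> fn q (fn u a) = y" using u eq by metis
    fix z assume "z \<in> fst p \<and> fn p z = x \<and> fn q z = y"
    then have "({a}, \<lambda>_\<in>{a}. z, fst p) = u" using un eq by blast
    then show "z = fn u a" by auto
  qed
qed

text \<open>The universe has binary products only up to bijection, and dependent functions do not
  live in the type \<open>'u\<close>, so smallness means an injective code with small image. The
  induction splits off one coordinate.\<close>

lemma PiE_small:
  assumes U: "set_universe \<U>" and "finite I" "\<And>i. i \<in> I \<Longrightarrow> B i \<in> \<U>"
  shows "\<exists>c. inj_on c (PiE I B) \<and> c ` PiE I B \<in> \<U>"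
  using assms(2,3)
proof (induction I)
  case empty
  obtain a where "{a} \<in> \<U>" using singleton_small[OF U] by blast
  then show ?case by (intro exI[of _ "\<lambda>_. a"]) auto
next
  case (insert i I)
  then obtain c where c: "inj_on c (PiE I B)" "c ` PiE I B \<in> \<U>" by auto
  obtain C h where C: "C \<in> \<U>" "bij_betw h (B i \<times> c ` PiE I B) C"
    using U insert.prems[of i] c(2) unfolding set_universe_def by blast
  \<comment> \<open>\<open>h\<close> codes the pair formed by the new coordinate and the code of the
    remaining ones.\<close>
  let ?c = "\<lambda>\<phi>. h (\<phi> i, c (restrict \<phi> I))"
  have res: "restrict \<phi> I \<in> PiE I B" if "\<phi> \<in> PiE (insert i I) B" for \<phi> using that by auto
  have inj: "inj_on ?c (PiE (insert i I) B)"
  proof (rule inj_onI)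
    fix \<phi> \<psi> assume p: "\<phi> \<in> PiE (insert i I) B" "\<psi> \<in> PiE (insert i I) B" "?c \<phi> = ?c \<psi>"
    have "(\<phi> i, c (restrict \<phi> I)) = (\<psi> i, c (restrict \<psi> I))"
      by (rule inj_onD[OF bij_betw_imp_inj_on[OF C(2)] p(3)]) (use p res in auto)
    then have "\<phi> i = \<psi> i" "restrict \<phi> I = restrict \<psi> I" using inj_onD[OF c(1)] res p by auto
    then show "\<phi> = \<psi>" by (intro PiE_ext[OF p(1,2)]) (metis insertE restrict_apply')
  qed
  have "?c ` PiE (insert i I) B \<subseteq> C" using C(2) res by (auto simp: bij_betw_def)
  then have "?c ` PiE (insert i I) B \<in> \<U>" by (rule small_subset[OF U C(1)])
  then show ?case using inj by blast
qed

section \<open>Pointwise right Kan extensions along a full inclusion\<close>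

locale full_inclusion =
  fixes C :: "('o, 'm) cat" and P :: "'o \<Rightarrow> bool" and \<U> :: "'u set set"
  assumes C: "category C" and U: "set_universe \<U>"
begin

abbreviation A :: "('o, 'm) cat" where "A \<equiv> full_subcat C P"

definition incl :: "('o, 'm, 'o, 'm) func" where
  "incl = \<lparr>obm = (\<lambda>x\<in>Ob A. x), arm = (\<lambda>f\<in>Ar A. f)\<rparr>"

abbreviation rst :: "('o, 'm, 'u set, 'u set_arrow) func \<Rightarrow> ('o, 'm, 'u set, 'u set_arrow) func" where
  "rst Y \<equiv> comp_func (op_cat A) Y incl"

text \<open>These are the objects of the comma category over which the pointwise formula takes its
  limit.\<close>

definition over :: "'o \<Rightarrow> 'm set" where
  "over S = {f \<in> Ar C. P (Src C f) \<and> Tgt C f = S}"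

text \<open>The limit of \<open>X\<close> over this comma category. Restricting to
  \<open>extensional\<close> functions gives each matching family exactly one
  representative.\<close>

definition cones :: "('o, 'm, 'u set, 'u set_arrow) func \<Rightarrow> 'o \<Rightarrow> ('m \<Rightarrow> 'u) set" where
  "cones X S = {\<phi> \<in> extensional (over S). (\<forall>f\<in>over S. \<phi> f \<in> obm X (Src C f)) \<and>
     (\<forall>f\<in>over S. \<forall>g\<in>Ar C. P (Src C g) \<and> Tgt C g = Src C f \<longrightarrow> \<phi> (Cmp C f g) = act X g (\<phi> f))}"

text \<open>The comparison map from the value of \<open>R\<close> at \<open>S\<close> to the limit,
  induced by the candidate counit \<open>e\<close>.\<close>

definition ev :: "('o, 'm, 'u set, 'u set_arrow) func \<Rightarrow> ('o \<Rightarrow> 'u set_arrow) \<Rightarrow> 'o \<Rightarrow> 'u \<Rightarrow> 'm \<Rightarrow> 'u" where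
  "ev R e S z = (\<lambda>f\<in>over S. fn (e (Src C f)) (act R f z))"

definition pointwise :: "('o, 'm, 'u set, 'u set_arrow) func \<Rightarrow> ('o, 'm, 'u set, 'u set_arrow) func
    \<Rightarrow> ('o \<Rightarrow> 'u set_arrow) \<Rightarrow> bool" where
  "pointwise X R e \<longleftrightarrow> presheaf C \<U> R \<and> psh_trans A \<U> (rst R) X e \<and>
     (\<forall>S\<in>Ob C. bij_betw (ev R e S) (obm R S) (cones X S))"

lemmas Cr = cat_rules[OF C]

lemma A: "category A" by (rule category_full_subcat[OF C])

lemma functor_incl: "is_functor (op_cat A) (op_cat C) incl"
  unfolding is_functor_def incl_def by (auto simp: Cr)

lemma rst_simps [simp]:
  "S \<in> Ob C \<Longrightarrow> P S \<Longrightarrow> obm (rst Y) S = obm Y S"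
  "f \<in> Ar C \<Longrightarrow> P (Src C f) \<Longrightarrow> P (Tgt C f) \<Longrightarrow> arm (rst Y) f = arm Y f"
  "S \<in> Ob C \<Longrightarrow> P S \<Longrightarrow> obm incl S = S"
  by (auto simp: comp_func_def incl_def)

lemma presheaf_rst: "presheaf C \<U> Y \<Longrightarrow> presheaf A \<U> (rst Y)"
  by (rule functor_comp[OF category_op[OF A] functor_incl])

lemma over_Cmp: "f \<in> over S \<Longrightarrow> g \<in> Ar C \<Longrightarrow> P (Src C g) \<Longrightarrow> Tgt C g = Src C f \<Longrightarrow> Cmp C f g \<in> over S"
  by (auto simp: over_def Cr)

lemma over_push: "h \<in> over S \<Longrightarrow> f \<in> Ar C \<Longrightarrow> Src C f = S \<Longrightarrow> Cmp C f h \<in> over (Tgt C f)"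
  by (auto simp: over_def Cr)

lemma overD: "f \<in> over S \<Longrightarrow> f \<in> Ar C" "f \<in> over S \<Longrightarrow> P (Src C f)" "f \<in> over S \<Longrightarrow> Tgt C f = S"
  by (auto simp: over_def)

lemma conesI:
  assumes "\<phi> \<in> extensional (over S)" "\<And>f. f \<in> over S \<Longrightarrow> \<phi> f \<in> obm X (Src C f)"
    "\<And>f g. f \<in> over S \<Longrightarrow> g \<in> Ar C \<Longrightarrow> P (Src C g) \<Longrightarrow> Tgt C g = Src C f \<Longrightarrow> \<phi> (Cmp C f g) = act X g (\<phi> f)"
  shows "\<phi> \<in> cones X S"
  using assms by (auto simp: cones_def)

lemma conesD:
  assumes "\<phi> \<in> cones X S"
  shows "\<phi> \<in> extensional (over S)" "f \<in> over S \<Longrightarrow> \<phi> f \<in> obm X (Src C f)"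
    "f \<in> over S \<Longrightarrow> g \<in> Ar C \<Longrightarrow> P (Src C g) \<Longrightarrow> Tgt C g = Src C f \<Longrightarrow> \<phi> (Cmp C f g) = act X g (\<phi> f)"
  using assms by (auto simp: cones_def)

text \<open>The action of an arrow on matching families, by which the limits form a
  presheaf.\<close>

definition pull :: "'m \<Rightarrow> ('m \<Rightarrow> 'u) \<Rightarrow> 'm \<Rightarrow> 'u" where
  "pull f \<phi> = (\<lambda>h\<in>over (Src C f). \<phi> (Cmp C f h))"

lemma pull_cone:
  assumes "\<phi> \<in> cones X (Tgt C f)" "f \<in> Ar C"
  shows "pull f \<phi> \<in> cones X (Src C f)"
  unfolding pull_def
proof (rule conesI)
  fix h assume h: "h \<in> over (Src C f)"
  then have fh: "Cmp C f h \<in> over (Tgt C f)" using over_push assms by auto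
  then show "(\<lambda>h\<in>over (Src C f). \<phi> (Cmp C f h)) h \<in> obm X (Src C h)"
    using conesD(2)[OF assms(1) fh] h overD[OF h] assms(2) by (simp add: Cr)
  fix g assume g: "g \<in> Ar C" "P (Src C g)" "Tgt C g = Src C h"
  have "Cmp C f (Cmp C h g) = Cmp C (Cmp C f h) g"
    by (rule cat_assoc[OF C]) (use g h assms overD[OF h] in auto)
  then show "(\<lambda>h\<in>over (Src C f). \<phi> (Cmp C f h)) (Cmp C h g) = act X g ((\<lambda>h\<in>over (Src C f). \<phi> (Cmp C f h)) h)"
    using conesD(3)[OF assms(1) fh g(1,2)] g h overD[OF h] assms over_Cmp[OF h g] by (simp add: Cr)
qed auto

lemma pull_Cmp:
  assumes f: "f \<in> Ar C" and g: "g \<in> Ar C" and fg: "Tgt C f = Src C g"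
  shows "pull f (pull g \<phi>) = pull (Cmp C g f) \<phi>"
proof -
  have "pull g \<phi> (Cmp C f h) = \<phi> (Cmp C (Cmp C g f) h)" if h: "h \<in> over (Src C f)" for h
    using over_push[OF h f] cat_assoc[OF C, of h f g] h f g fg overD[OF h] by (simp add: pull_def)
  then show ?thesis using f g fg unfolding pull_def by (auto simp: Cr intro!: restrict_ext)
qed

context
  fixes X Y e
  assumes Y: "presheaf C \<U> Y" and e: "psh_trans A \<U> (rst Y) X e"
begin

lemma eps_closed: "S \<in> Ob C \<Longrightarrow> P S \<Longrightarrow> z \<in> obm Y S \<Longrightarrow> fn (e S) z \<in> obm X S"
  using psh_trans_closed[OF e, of S z] by simp

lemma eps_natural:
  assumes "f \<in> Ar C" "P (Src C f)" "P (Tgt C f)" "z \<in> obm Y (Tgt C f)"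
  shows "fn (e (Src C f)) (act Y f z) = act X f (fn (e (Tgt C f)) z)"
  using psh_trans_natural[OF A e, of f z] assms by (simp add: Cr)

lemma ev_cone:
  assumes "z \<in> obm Y S"
  shows "ev Y e S z \<in> cones X S"
proof (rule conesI)
  fix f assume f: "f \<in> over S"
  note o = overD[OF f]
  have yf: "act Y f z \<in> obm Y (Src C f)" using act_closed[OF Y o(1)] assms o by simp
  then show "ev Y e S z f \<in> obm X (Src C f)"
    using f o eps_closed by (auto simp: ev_def Cr)
  fix g assume g: "g \<in> Ar C" "P (Src C g)" "Tgt C g = Src C f"
  show "ev Y e S z (Cmp C f g) = act X g (ev Y e S z f)"
    using eps_natural[OF g(1,2), of "act Y f z"] act_Cmp[OF Y g(1) o(1) g(3)] yf assms f o g over_Cmp[OF f g]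
    by (simp add: ev_def Cr)
qed (auto simp: ev_def)

text \<open>This is naturality of the comparison map; where that map is injective, it lets equations
  in \<open>Y\<close> be checked on families.\<close>

lemma ev_act:
  assumes "f \<in> Ar C" "z \<in> obm Y (Tgt C f)"
  shows "ev Y e (Src C f) (act Y f z) = pull f (ev Y e (Tgt C f) z)"
  unfolding ev_def pull_def
proof (rule restrict_ext)
  fix h assume h: "h \<in> over (Src C f)"
  show "fn (e (Src C h)) (act Y h (act Y f z)) =
     (\<lambda>fa\<in>over (Tgt C f). fn (e (Src C fa)) (act Y fa z)) (Cmp C f h)"
    using over_push[OF h assms(1)] act_Cmp[OF Y overD(1)[OF h] assms(1) overD(3)[OF h] assms(2)] overD[OF h] assms
    by (simp add: Cr)
qed

lemma ev_Idn:
  assumes "S \<in> Ob C" "P S" "z \<in> obm Y S"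
  shows "ev Y e S z (Idn C S) = fn (e S) z"
  using assms act_Idn[OF Y] by (simp add: ev_def over_def Cr)

end

text \<open>Both \<open>R\<close> and any competitor \<open>Y\<close> map to the limits,
  \<open>R\<close> bijectively. The factorisation is forced to be the comparison map of
  \<open>Y\<close> followed by the inverse of that of \<open>R\<close>, and it is natural because
  the two comparison maps are.\<close>

lemma pointwise_Kan:
  assumes pw: "pointwise X R e"
  shows "right_Kan_extension (op_cat A) (op_cat C) (set_cat \<U>) incl X R e"
  unfolding right_Kan_extension_def
proof (intro conjI allI impI)
  have R: "presheaf C \<U> R" and e: "psh_trans A \<U> (rst R) X e"
    and bij: "\<And>S. S \<in> Ob C \<Longrightarrow> bij_betw (ev R e S) (obm R S) (cones X S)"
    using pw by (auto simp: pointwise_def)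
  show "presheaf C \<U> R" "psh_trans A \<U> (rst R) X e" by fact+
  fix Y a assume "presheaf C \<U> Y \<and> psh_trans A \<U> (rst Y) X a"
  then have Y: "presheaf C \<U> Y" and a: "psh_trans A \<U> (rst Y) X a" by auto
  define s where "s S y = inv_into (obm R S) (ev R e S) (ev Y a S y)" for S y
  have s: "s S y \<in> obm R S" "ev R e S (s S y) = ev Y a S y" if "S \<in> Ob C" "y \<in> obm Y S" for S y
    using ev_cone[OF Y a that(2)] bij[OF that(1)] unfolding s_def bij_betw_def
    by (auto intro: inv_into_into f_inv_into_f)
  have evinj: "z = w" if "S \<in> Ob C" "z \<in> obm R S" "w \<in> obm R S" "ev R e S z = ev R e S w" for S z w
    using bij[OF that(1)] that unfolding bij_betw_def inj_on_def by blast
  have st: "psh_trans C \<U> Y R (\<lambda>S\<in>Ob C. (obm Y S, restrict (s S) (obm Y S), obm R S))"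
  proof (rule psh_transI[OF C Y R])
    fix f y assume f: "f \<in> Ar C" and y: "y \<in> obm Y (Tgt C f)"
    have 1: "Src C f \<in> Ob C" "Tgt C f \<in> Ob C" "act Y f y \<in> obm Y (Src C f)" "s (Tgt C f) y \<in> obm R (Tgt C f)"
      using f y s act_closed[OF Y f y] by (auto simp: Cr)
    show "s (Src C f) (act Y f y) = act R f (s (Tgt C f) y)"
      by (rule evinj[OF 1(1)]) (use 1 s f y act_closed[OF R f 1(4)] ev_act[OF Y a f y] ev_act[OF R e f 1(4)] in auto)
  qed (use s in auto)
  show "\<exists>!\<sigma>. psh_trans C \<U> Y R \<sigma> \<and> (\<forall>S\<in>Ob (op_cat A). a S = Cmp (set_cat \<U>) (e S) (\<sigma> (obm incl S)))"
  proof (rule ex1I, intro conjI ballI)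
    show "psh_trans C \<U> Y R (\<lambda>S\<in>Ob C. (obm Y S, restrict (s S) (obm Y S), obm R S))" by (rule st)
    fix S assume S: "S \<in> Ob (op_cat A)"
    have "fn (a S) y = fn (e S) (s S y)" if y: "y \<in> obm Y S" for y
      using ev_Idn[OF Y a _ _ y] ev_Idn[OF R e _ _ s(1)[OF _ y]] s(2)[OF _ y] S by simp
    then have "fn (a S) = (\<lambda>y\<in>obm Y S. fn (e S) (s S y))"
      using psh_trans_eq(4)[OF a, of S] S by (intro extensionalityI[of _ "obm Y S"]) (auto simp: PiE_iff)
    moreover have "fst (a S) = obm Y S" "snd (snd (a S)) = obm X S" "snd (snd (e S)) = obm X S"
      using psh_trans_eq[OF a, of S] psh_trans_eq[OF e, of S] S by auto
    ultimately show "a S = Cmp (set_cat \<U>) (e S) ((\<lambda>S\<in>Ob C. (obm Y S, restrict (s S) (obm Y S), obm R S)) (obm incl S))"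
      using S by (auto simp: prod_eq_iff intro!: restrict_ext)
  next
    fix \<sigma> assume \<sigma>: "psh_trans C \<U> Y R \<sigma> \<and> (\<forall>S\<in>Ob (op_cat A). a S = Cmp (set_cat \<U>) (e S) (\<sigma> (obm incl S)))"
    then have n: "psh_trans C \<U> Y R \<sigma>" by blast
    have el: "fn (a S) y = fn (e S) (fn (\<sigma> S) y)" if "S \<in> Ob C" "P S" "y \<in> obm Y S" for S y
      using \<sigma> that psh_trans_eq(2)[OF n that(1)] by simp
    show "\<sigma> = (\<lambda>S\<in>Ob C. (obm Y S, restrict (s S) (obm Y S), obm R S))"
    proof (rule psh_trans_eqI[OF n st])
      fix S y assume S: "S \<in> Ob C" and y: "y \<in> obm Y S"
      have "fn (\<sigma> S) y = s S y"
      proof (rule evinj[OF S psh_trans_closed[OF n S y] s(1)[OF S y]])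
        \<comment> \<open>The equation with the counit concerns only \<open>P\<close>-objects;
          naturality of \<open>\<sigma>\<close> along all arrows in \<open>over S\<close> spreads it
          to an arbitrary \<open>S\<close>.\<close>
        have "ev R e S (fn (\<sigma> S) y) = ev Y a S y"
          unfolding ev_def
        proof (rule restrict_ext)
          fix f assume "f \<in> over S"
          note o = overD[OF this]
          have "act Y f y \<in> obm Y (Src C f)" using act_closed[OF Y o(1)] o y by simp
          then show "fn (e (Src C f)) (act R f (fn (\<sigma> S) y)) = fn (a (Src C f)) (act Y f y)"
            using psh_trans_natural[OF C n o(1)] y o el by (simp add: Cr)
        qed
        then show "ev R e S (fn (\<sigma> S) y) = ev R e S (s S y)" using s(2)[OF S y] by simp
      qed
      then show "fn (\<sigma> S) y = fn ((\<lambda>S\<in>Ob C. (obm Y S, restrict (s S) (obm Y S), obm R S)) S) y" using S y by simp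
    qed
  qed
qed

text \<open>Kan extensions of the same \<open>X\<close> are isomorphic over \<open>X\<close>, so one
  pointwise Kan extension makes all of them pointwise. This frees the later arguments from the
  choice that a given adjunction makes.\<close>

lemma Kan_pointwise:
  assumes pw: "pointwise X R e" and kan: "right_Kan_extension (op_cat A) (op_cat C) (set_cat \<U>) incl X R' e'"
  shows "pointwise X R' e'"
proof -
  have univ: "\<exists>\<sigma>. psh_trans C \<U> Y Q \<sigma> \<and> (\<forall>S\<in>Ob A. \<forall>y\<in>obm Y S. fn (a S) y = fn (d S) (fn (\<sigma> S) y))"
    if hyp: "right_Kan_extension (op_cat A) (op_cat C) (set_cat \<U>) incl X Q d" "presheaf C \<U> Y" "psh_trans A \<U> (rst Y) X a" for Q Y a d
  proof -
    obtain \<sigma> where s: "psh_trans C \<U> Y Q \<sigma>"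
        "\<forall>S\<in>Ob (op_cat A). a S = Cmp (set_cat \<U>) (d S) (\<sigma> (obm incl S))"
      using hyp unfolding right_Kan_extension_def by blast
    have "fn (a S) y = fn (d S) (fn (\<sigma> S) y)" if "S \<in> Ob A" "y \<in> obm Y S" for S y
      using s(2) that psh_trans_eq(2)[OF s(1), of S] by simp
    then show ?thesis using s(1) by blast
  qed
  \<comment> \<open>An endomorphism of a Kan extension that is compatible with the counit is
    determined. Applied to a round trip and the identity, this shows that \<open>s\<close> and
    \<open>t\<close> are mutually inverse.\<close>
  have uniq: "\<sigma> = \<tau>"
    if k: "right_Kan_extension (op_cat A) (op_cat C) (set_cat \<U>) incl X Q d" and "psh_trans C \<U> Q Q \<sigma>" "psh_trans C \<U> Q Q \<tau>"
      and "\<And>S y. S \<in> Ob A \<Longrightarrow> y \<in> obm Q S \<Longrightarrow> fn (d S) y = fn (d S) (fn (\<sigma> S) y)"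
      and "\<And>S y. S \<in> Ob A \<Longrightarrow> y \<in> obm Q S \<Longrightarrow> fn (d S) y = fn (d S) (fn (\<tau> S) y)" for Q d \<sigma> \<tau>
  proof -
    have Q: "presheaf C \<U> Q" and d: "psh_trans A \<U> (rst Q) X d" using k by (auto simp: right_Kan_extension_def)
    have "d S = Cmp (set_cat \<U>) (d S) (\<rho> (obm incl S))"
      if r: "psh_trans C \<U> Q Q \<rho>" "\<And>y. y \<in> obm Q S \<Longrightarrow> fn (d S) y = fn (d S) (fn (\<rho> S) y)" "S \<in> Ob (op_cat A)" for \<rho> S
    proof -
      have "fn (d S) = (\<lambda>y\<in>obm Q S. fn (d S) (fn (\<rho> S) y))"
        using psh_trans_eq(4)[OF d, of S] r by (intro extensionalityI[of _ "obm Q S"]) (auto simp: PiE_iff)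
      moreover have "fst (d S) = obm Q S" "snd (snd (d S)) = obm X S" "fst (\<rho> S) = obm Q S"
        using psh_trans_eq[OF d, of S] psh_trans_eq[OF r(1), of S] r(3) by auto
      ultimately show ?thesis using r(3) by (simp add: prod_eq_iff)
    qed
    note 1 = this
    have "\<exists>!\<rho>. psh_trans C \<U> Q Q \<rho> \<and> (\<forall>S\<in>Ob (op_cat A). d S = Cmp (set_cat \<U>) (d S) (\<rho> (obm incl S)))"
      using k Q d unfolding right_Kan_extension_def by blast
    moreover have "\<forall>S\<in>Ob (op_cat A). d S = Cmp (set_cat \<U>) (d S) (\<sigma> (obm incl S))"
      "\<forall>S\<in>Ob (op_cat A). d S = Cmp (set_cat \<U>) (d S) (\<tau> (obm incl S))"
      using 1[OF that(2)] 1[OF that(3)] that(4,5) by simp_all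
    ultimately show ?thesis using that(2,3) by blast
  qed
  have R: "presheaf C \<U> R" and e: "psh_trans A \<U> (rst R) X e" using pw by (auto simp: pointwise_def)
  have R': "presheaf C \<U> R'" and e': "psh_trans A \<U> (rst R') X e'" using kan by (auto simp: right_Kan_extension_def)
  note kan0 = pointwise_Kan[OF pw]
  obtain s where s: "psh_trans C \<U> R' R s" "\<And>S y. S \<in> Ob A \<Longrightarrow> y \<in> obm R' S \<Longrightarrow> fn (e' S) y = fn (e S) (fn (s S) y)"
    using univ[OF kan0 R' e'] by blast
  obtain t where t: "psh_trans C \<U> R R' t" "\<And>S y. S \<in> Ob A \<Longrightarrow> y \<in> obm R S \<Longrightarrow> fn (e S) y = fn (e' S) (fn (t S) y)"
    using univ[OF kan R e] by blast
  have inverse: "fn (v S) (fn (u S) z) = z"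
    if k: "right_Kan_extension (op_cat A) (op_cat C) (set_cat \<U>) incl X Q d"
      and u: "psh_trans C \<U> Q Q' u" "\<And>S y. S \<in> Ob A \<Longrightarrow> y \<in> obm Q S \<Longrightarrow> fn (d S) y = fn (d' S) (fn (u S) y)"
      and v: "psh_trans C \<U> Q' Q v" "\<And>S y. S \<in> Ob A \<Longrightarrow> y \<in> obm Q' S \<Longrightarrow> fn (d' S) y = fn (d S) (fn (v S) y)"
      and z: "S \<in> Ob C" "z \<in> obm Q S" for Q Q' d d' u v S z
  proof -
    have Q: "presheaf C \<U> Q" using k by (auto simp: right_Kan_extension_def)
    note cc = nat_trans_Cmp[OF category_op[OF C] category_set_cat u(1) v(1)]
    note ii = nat_trans_Idn[OF category_op[OF C] category_set_cat Q]
    have "(\<lambda>x\<in>Ob (op_cat C). Cmp (set_cat \<U>) (v x) (u x)) = (\<lambda>x\<in>Ob (op_cat C). Idn (set_cat \<U>) (obm Q x))"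
    proof (rule uniq[OF k cc ii])
      fix S y assume Sy: "S \<in> Ob A" "y \<in> obm Q S"
      have "fn (u S) y \<in> obm Q' S" using psh_trans_closed[OF u(1)] Sy by auto
      then show "fn (d S) y = fn (d S) (fn ((\<lambda>x\<in>Ob (op_cat C). Cmp (set_cat \<U>) (v x) (u x)) S) y)"
        using Sy u(2)[OF Sy] v(2)[OF Sy(1)] psh_trans_eq(2)[OF u(1), of S] by simp
    qed auto
    from fun_cong[OF this, of S] have "(\<lambda>x\<in>obm Q S. fn (v S) (fn (u S) x)) = (\<lambda>x\<in>obm Q S. x)"
      using z(1) psh_trans_eq(2)[OF u(1), of S] by simp
    then show ?thesis by (rule restrict_eqD[OF _ z(2)])
  qed
  have ev_s: "ev R' e' S z = ev R e S (fn (s S) z)" if "S \<in> Ob C" "z \<in> obm R' S" for S z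
    unfolding ev_def
  proof (rule restrict_ext)
    fix f assume "f \<in> over S"
    note o = overD[OF this]
    show "fn (e' (Src C f)) (act R' f z) = fn (e (Src C f)) (act R f (fn (s S) z))"
      using s(2)[of "Src C f" "act R' f z"] psh_trans_natural[OF C s(1) o(1)] act_closed[OF R' o(1)] o that
      by (simp add: Cr)
  qed
  have "bij_betw (ev R' e' S) (obm R' S) (cones X S)" if S: "S \<in> Ob C" for S
  proof -
    have "bij_betw (fn (s S)) (obm R' S) (obm R S)"
      by (rule bij_betw_byWitness[of _ "fn (t S)"])
        (use inverse[OF kan s t S] inverse[OF kan0 t s S] psh_trans_closed[OF s(1) S] psh_trans_closed[OF t(1) S] in auto)
    then have "bij_betw (ev R e S \<circ> fn (s S)) (obm R' S) (cones X S)"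
      using pw S by (auto simp: pointwise_def intro: bij_betw_trans)
    then show ?thesis by (rule iffD1[OF bij_betw_cong, rotated]) (simp add: ev_s[OF S])
  qed
  then show ?thesis using R' e' by (simp add: pointwise_def)
qed

text \<open>Matching families are functions on arrows, so the limit has to be coded inside the
  universe. A family is determined by its values on \<open>I\<close>, because every arrow over
  \<open>S\<close> factors through one in \<open>I\<close>; hence it is coded by an element of a
  finite product of small sets. The presheaf \<open>R\<close> is the limit presheaf transported
  along these codes.\<close>

lemma pointwise_exists:
  assumes X: "presheaf A \<U> X"
    and fin: "\<And>S. S \<in> Ob C \<Longrightarrow> \<exists>I. finite I \<and> I \<subseteq> over S \<and>
       (\<forall>f\<in>over S. \<exists>i\<in>I. \<exists>g\<in>Ar C. Src C g = Src C f \<and> Tgt C g = Src C i \<and> f = Cmp C i g)"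
  shows "\<exists>R e. pointwise X R e"
proof -
  have "\<exists>c. inj_on c (cones X S) \<and> c ` cones X S \<in> \<U>" if S: "S \<in> Ob C" for S
  proof -
    obtain I where I: "finite I" "I \<subseteq> over S"
      "\<And>f. f \<in> over S \<Longrightarrow> \<exists>i\<in>I. \<exists>g\<in>Ar C. Src C g = Src C f \<and> Tgt C g = Src C i \<and> f = Cmp C i g"
      using fin[OF S] by blast
    have "obm X (Src C i) \<in> \<U>" if "i \<in> I" for i
      using presheaf_Ob[OF X, of "Src C i"] overD[of i S] I(2) that by (auto simp: Cr)
    then obtain c where c: "inj_on c (PiE I (\<lambda>i. obm X (Src C i)))" "c ` PiE I (\<lambda>i. obm X (Src C i)) \<in> \<U>"
      using PiE_small[OF U I(1), of "\<lambda>i. obm X (Src C i)"] by blast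
    have res: "restrict \<phi> I \<in> PiE I (\<lambda>i. obm X (Src C i))" if "\<phi> \<in> cones X S" for \<phi>
      using conesD(2)[OF that] I(2) by auto
    have "inj_on (\<lambda>\<phi>. c (restrict \<phi> I)) (cones X S)"
    proof (rule inj_onI)
      fix \<phi> \<psi> assume p: "\<phi> \<in> cones X S" "\<psi> \<in> cones X S" "c (restrict \<phi> I) = c (restrict \<psi> I)"
      then have eq: "restrict \<phi> I = restrict \<psi> I" using inj_onD[OF c(1) p(3) res res] by blast
      show "\<phi> = \<psi>"
      proof (rule extensionalityI[OF conesD(1)[OF p(1)] conesD(1)[OF p(2)]])
        fix f assume f: "f \<in> over S"
        then obtain i g where g: "i \<in> I" "g \<in> Ar C" "Src C g = Src C f" "Tgt C g = Src C i" "f = Cmp C i g"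
          using I(3) by blast
        moreover have "i \<in> over S" "P (Src C g)" "\<phi> i = \<psi> i" using g I(2) overD(2)[OF f] fun_cong[OF eq, of i] by auto
        ultimately show "\<phi> f = \<psi> f" using conesD(3)[OF p(1), of i g] conesD(3)[OF p(2), of i g] by simp
      qed
    qed
    moreover have "(\<lambda>\<phi>. c (restrict \<phi> I)) ` cones X S \<in> \<U>"
    proof -
      have "(\<lambda>\<phi>. c (restrict \<phi> I)) ` cones X S \<subseteq> c ` PiE I (\<lambda>i. obm X (Src C i))" using res by auto
      then show ?thesis by (rule small_subset[OF U c(2)])
    qed
    ultimately show ?thesis by blast
  qed
  then obtain c where c: "\<And>S. S \<in> Ob C \<Longrightarrow> inj_on (c S) (cones X S)" "\<And>S. S \<in> Ob C \<Longrightarrow> c S ` cones X S \<in> \<U>"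
    by metis
  define dec where "dec S = inv_into (cones X S) (c S)" for S
  have dec: "dec S (c S \<phi>) = \<phi>" if "S \<in> Ob C" "\<phi> \<in> cones X S" for S \<phi>
    using c(1) that by (auto simp: dec_def)
  define O' where "O' S = c S ` cones X S" for S
  define a where "a f z = c (Src C f) (pull f (dec (Tgt C f) z))" for f z
  have O'E: "\<exists>\<phi>. \<phi> \<in> cones X S \<and> z = c S \<phi> \<and> dec S z = \<phi>" if "S \<in> Ob C" "z \<in> O' S" for S z
    using that dec by (auto simp: O'_def)
  have a: "a f (c (Tgt C f) \<phi>) = c (Src C f) (pull f \<phi>)" if "f \<in> Ar C" "\<phi> \<in> cones X (Tgt C f)" for f \<phi>
    using dec[of "Tgt C f"] that by (simp add: a_def Cr)
  define R where "R = \<lparr>obm = restrict O' (Ob C),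
       arm = (\<lambda>f\<in>Ar C. (O' (Tgt C f), restrict (a f) (O' (Tgt C f)), O' (Src C f)))\<rparr>"
  have R: "presheaf C \<U> R"
    unfolding R_def
  proof (rule presheafI[OF C])
    fix S z assume S: "S \<in> Ob C" and "z \<in> O' S"
    then obtain \<phi> where p: "\<phi> \<in> cones X S" "z = c S \<phi>" using O'E by blast
    have "pull (Idn C S) \<phi> = \<phi>"
      by (rule extensionalityI[of _ "over S"])
        (use S conesD(1)[OF p(1)] in \<open>auto simp: pull_def Cr over_def\<close>)
    then show "a (Idn C S) z = z" using a[of "Idn C S"] S p by (simp add: Cr)
  next
    fix f g z assume f: "f \<in> Ar C" and g: "g \<in> Ar C" and fg: "Tgt C f = Src C g" and "z \<in> O' (Tgt C g)"
    then obtain \<phi> where p: "\<phi> \<in> cones X (Tgt C g)" "z = c (Tgt C g) \<phi>" using O'E[OF cat_Tgt[OF C g]] by blast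
    have "pull (Cmp C g f) \<phi> = pull f (pull g \<phi>)" by (rule pull_Cmp[OF f g fg, symmetric])
    then show "a (Cmp C g f) z = a f (a g z)"
      using a[of "Cmp C g f" \<phi>] a[OF g p(1)] a[OF f, of "pull g \<phi>"] pull_cone[OF p(1) g] p f g fg by (simp add: Cr)
  next
    fix f z assume f: "f \<in> Ar C" and "z \<in> O' (Tgt C f)"
    then obtain \<phi> where p: "\<phi> \<in> cones X (Tgt C f)" "z = c (Tgt C f) \<phi>" using O'E[OF cat_Tgt[OF C f]] by blast
    then show "a f z \<in> O' (Src C f)" using a[OF f p(1)] pull_cone[OF p(1) f] by (auto simp: O'_def)
  qed (use c(2) in \<open>auto simp: O'_def\<close>)
  have Rs: "S \<in> Ob C \<Longrightarrow> obm R S = O' S" "f \<in> Ar C \<Longrightarrow> z \<in> O' (Tgt C f) \<Longrightarrow> act R f z = a f z" for S f z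
    by (simp_all add: R_def)
  \<comment> \<open>At a \<open>P\<close>-object the identity is terminal in the comma category, so
    the projection to that component is the counit.\<close>
  define e where "e = (\<lambda>S\<in>Ob A. (obm (rst R) S, restrict (\<lambda>z. dec S z (Idn C S)) (obm (rst R) S), obm X S))"
  have cone_Idn: "\<phi> f = act X f (\<phi> (Idn C (Tgt C f)))" if "f \<in> over (Tgt C f)" "P (Tgt C f)" "\<phi> \<in> cones X (Tgt C f)" for f \<phi>
    using conesD(3)[OF that(3), of "Idn C (Tgt C f)" f] that overD[OF that(1)] by (simp add: over_def Cr)
  have e: "psh_trans A \<U> (rst R) X e"
    unfolding e_def
  proof (rule psh_transI[OF A presheaf_rst[OF R] X])
    fix S z assume S: "S \<in> Ob A" and "z \<in> obm (rst R) S"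
    then obtain \<phi> where "\<phi> \<in> cones X S" "dec S z = \<phi>" using O'E[of S z] Rs by auto
    then show "dec S z (Idn C S) \<in> obm X S" using conesD(2)[of \<phi> X S "Idn C S"] S by (simp add: over_def Cr)
  next
    fix f z assume f: "f \<in> Ar A" and z: "z \<in> obm (rst R) (Tgt A f)"
    then have o: "Src C f \<in> Ob C" "Tgt C f \<in> Ob C" "z \<in> O' (Tgt C f)" using Rs by (auto simp: Cr)
    then obtain \<phi> where p: "\<phi> \<in> cones X (Tgt C f)" "z = c (Tgt C f) \<phi>" "dec (Tgt C f) z = \<phi>"
      using O'E by blast
    have "dec (Src C f) (act R f z) = pull f \<phi>"
      using a[of f \<phi>] pull_cone[of \<phi> X f] dec[OF o(1)] p o f Rs(2)[of f z] by auto
    then have "dec (Src C f) (act R f z) (Idn C (Src C f)) = \<phi> f"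
      using f o by (simp add: pull_def over_def Cr)
    also have "\<dots> = act X f (\<phi> (Idn C (Tgt C f)))" using cone_Idn[of f] f p by (auto simp: over_def)
    finally show "dec (Src A f) (act (rst R) f z) (Idn C (Src A f)) = act X f (dec (Tgt A f) z (Idn C (Tgt A f)))"
      using f p by simp
  qed
  have "bij_betw (ev R e S) (obm R S) (cones X S)" if S: "S \<in> Ob C" for S
  proof (rule bij_betw_byWitness[of _ "c S"])
    have main: "ev R e S (c S \<phi>) = \<phi>" if p: "\<phi> \<in> cones X S" for \<phi>
    proof (rule extensionalityI[OF _ conesD(1)[OF p]])
      fix f assume f: "f \<in> over S"
      note o = overD[OF f]
      have z: "c S \<phi> \<in> O' (Tgt C f)" using p o by (auto simp: O'_def)
      have "act R f (c S \<phi>) = c (Src C f) (pull f \<phi>)" using Rs(2)[OF o(1) z] a[OF o(1), of \<phi>] p o by simp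
      moreover have pl: "pull f \<phi> \<in> cones X (Src C f)" using pull_cone[of \<phi> X f] p o by simp
      then have "c (Src C f) (pull f \<phi>) \<in> O' (Src C f)" by (auto simp: O'_def)
      ultimately have "ev R e S (c S \<phi>) f = pull f \<phi> (Idn C (Src C f))"
        using f o dec[OF _ pl] Rs by (simp add: ev_def e_def Cr)
      then show "ev R e S (c S \<phi>) f = \<phi> f" using o by (simp add: pull_def over_def Cr)
    qed (auto simp: ev_def)
    show "\<forall>z\<in>obm R S. c S (ev R e S z) = z"
    proof
      fix z assume "z \<in> obm R S"
      then obtain \<phi> where "\<phi> \<in> cones X S" "z = c S \<phi>" using O'E[OF S] Rs(1)[OF S] by metis
      then show "c S (ev R e S z) = z" using main by simp
    qed
    show "\<forall>\<phi>\<in>cones X S. ev R e S (c S \<phi>) = \<phi>" using main by blast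
    show "ev R e S ` obm R S \<subseteq> cones X S" using ev_cone[OF R e] by auto
    show "c S ` cones X S \<subseteq> obm R S" using Rs(1)[OF S] by (auto simp: O'_def)
  qed
  then have "pointwise X R e" using R e by (simp add: pointwise_def)
  then show ?thesis by blast
qed

end


context full_inclusion begin

section \<open>The adjunction with the right Kan extension\<close>

abbreviation incl_pre where
  "incl_pre \<equiv> precomp (op_cat A) (op_cat C) (set_cat \<U>) incl"

lemma presheaves_simps:
  "Ob (presheaves B \<U>) = {X. presheaf B \<U> X}"
  "(X, t, Y) \<in> Ar (presheaves B \<U>) \<longleftrightarrow> psh_trans B \<U> X Y t"
  "Src (presheaves B \<U>) (X, t, Y) = X" "Tgt (presheaves B \<U>) (X, t, Y) = Y"
  "Idn (presheaves B \<U>) X = (X, \<lambda>S\<in>Ob B. Idn (set_cat \<U>) (obm X S), X)"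
  "Cmp (presheaves B \<U>) (Y, s, Z) (X, t, Y') = (X, \<lambda>S\<in>Ob B. Cmp (set_cat \<U>) (s S) (t S), Z)"
  unfolding presheaves_def by simp_all

lemma incl_pre_simps:
  "presheaf C \<U> Y \<Longrightarrow> obm incl_pre Y = rst Y"
  "psh_trans C \<U> X Y t \<Longrightarrow> arm incl_pre (X, t, Y) = (rst X, \<lambda>S\<in>Ob A. t S, rst Y)"
  by (auto simp: precomp_def intro!: restrict_ext)

lemma functor_incl_pre: "is_functor (presheaves C \<U>) (presheaves A \<U>) incl_pre"
  unfolding presheaves_def
  by (intro functor_precomp category_op A C category_set_cat functor_incl)

lemma presheaves_ArE:
  assumes "a \<in> Ar (presheaves B \<U>)"
  obtains t where "a = (Src (presheaves B \<U>) a, t, Tgt (presheaves B \<U>) a)"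
    "psh_trans B \<U> (Src (presheaves B \<U>) a) (Tgt (presheaves B \<U>) a) t"
  using assms unfolding presheaves_def by (rule functor_cat_ArE)

text \<open>The universal property of a Kan extension of \<open>X\<close> is that of a universal
  arrow from \<open>incl_pre\<close> to \<open>X\<close>, once equations between triples are unwound
  into equations between components.\<close>

lemma Kan_adjunction_exists:
  assumes ex: "\<And>X. presheaf A \<U> X \<Longrightarrow> \<exists>R e. pointwise X R e"
  shows "\<exists>G \<eta> \<epsilon>. adjunction (presheaves C \<U>) (presheaves A \<U>) incl_pre G \<eta> \<epsilon> \<and>
    (\<forall>X\<in>Ob (presheaves A \<U>). right_Kan_extension (op_cat A) (op_cat C) (set_cat \<U>) incl X (obm G X) (fst (snd (\<epsilon> X))))"
proof -
  obtain R e where Re: "\<And>X. presheaf A \<U> X \<Longrightarrow> pointwise X (R X) (e X)" using ex by metis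
  have R: "presheaf C \<U> (R X)" and e: "psh_trans A \<U> (rst (R X)) X (e X)"
    and kan: "right_Kan_extension (op_cat A) (op_cat C) (set_cat \<U>) incl X (R X) (e X)" if "presheaf A \<U> X" for X
    using Re[OF that] pointwise_Kan by (auto simp: pointwise_def)
  have "\<exists>G \<eta>. adjunction (presheaves C \<U>) (presheaves A \<U>) incl_pre G \<eta>
        (restrict (\<lambda>X. (rst (R X), e X, X)) (Ob (presheaves A \<U>))) \<and> (\<forall>X\<in>Ob (presheaves A \<U>). obm G X = R X)"
  proof (rule universal_arrows_adjunction[OF category_presheaves[OF C] category_presheaves[OF A] functor_incl_pre])
    fix X assume "X \<in> Ob (presheaves A \<U>)"
    then show "R X \<in> Ob (presheaves C \<U>) \<and> (rst (R X), e X, X) \<in> Ar (presheaves A \<U>) \<and>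
       Src (presheaves A \<U>) (rst (R X), e X, X) = obm incl_pre (R X) \<and> Tgt (presheaves A \<U>) (rst (R X), e X, X) = X"
      using R e by (simp add: presheaves_simps incl_pre_simps)
  next
    fix X Y f assume "X \<in> Ob (presheaves A \<U>)" "Y \<in> Ob (presheaves C \<U>)" and f: "f \<in> Ar (presheaves A \<U>)"
      and sf: "Src (presheaves A \<U>) f = obm incl_pre Y" and tf: "Tgt (presheaves A \<U>) f = X"
    then have X: "presheaf A \<U> X" and Y: "presheaf C \<U> Y" by (simp_all add: presheaves_simps)
    obtain a where a: "f = (rst Y, a, X)" "psh_trans A \<U> (rst Y) X a"
      using presheaves_ArE[OF f] unfolding sf tf incl_pre_simps(1)[OF Y] by metis
    have eq: "Cmp (presheaves A \<U>) (rst (R X), e X, X) (arm incl_pre (Y, s, R X)) = f \<longleftrightarrow>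
        (\<forall>S\<in>Ob (op_cat A). a S = Cmp (set_cat \<U>) (e X S) (s (obm incl S)))" if s: "psh_trans C \<U> Y (R X) s" for s
    proof -
      have "Cmp (presheaves A \<U>) (rst (R X), e X, X) (arm incl_pre (Y, s, R X)) = f \<longleftrightarrow>
         (\<lambda>S\<in>Ob A. Cmp (set_cat \<U>) (e X S) (s S)) = a"
        unfolding incl_pre_simps(2)[OF s] presheaves_simps a(1) by (auto intro!: restrict_ext simp: fun_eq_iff restrict_def)
      also have "\<dots> \<longleftrightarrow> (\<forall>S\<in>Ob (op_cat A). a S = Cmp (set_cat \<U>) (e X S) (s (obm incl S)))"
      proof
        assume "(\<lambda>S\<in>Ob A. Cmp (set_cat \<U>) (e X S) (s S)) = a"
        then show "\<forall>S\<in>Ob (op_cat A). a S = Cmp (set_cat \<U>) (e X S) (s (obm incl S))" by auto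
      next
        assume r: "\<forall>S\<in>Ob (op_cat A). a S = Cmp (set_cat \<U>) (e X S) (s (obm incl S))"
        show "(\<lambda>S\<in>Ob A. Cmp (set_cat \<U>) (e X S) (s S)) = a"
          by (rule extensionalityI[of _ "Ob A"]) (use r nat_ext[OF a(2)] in auto)
      qed
      finally show ?thesis .
    qed
    have "\<exists>!s. psh_trans C \<U> Y (R X) s \<and> (\<forall>S\<in>Ob (op_cat A). a S = Cmp (set_cat \<U>) (e X S) (s (obm incl S)))"
      using kan[OF X] Y a(2) unfolding right_Kan_extension_def by blast
    then obtain s where s: "psh_trans C \<U> Y (R X) s" "\<forall>S\<in>Ob (op_cat A). a S = Cmp (set_cat \<U>) (e X S) (s (obm incl S))"
      and un: "\<And>t. psh_trans C \<U> Y (R X) t \<Longrightarrow> \<forall>S\<in>Ob (op_cat A). a S = Cmp (set_cat \<U>) (e X S) (t (obm incl S)) \<Longrightarrow> t = s"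
      by (elim ex1E) blast
    show "\<exists>!h. h \<in> Ar (presheaves C \<U>) \<and> Src (presheaves C \<U>) h = Y \<and> Tgt (presheaves C \<U>) h = R X \<and>
        Cmp (presheaves A \<U>) (rst (R X), e X, X) (arm incl_pre h) = f"
    proof (rule ex1I[of _ "(Y, s, R X)"])
      show "(Y, s, R X) \<in> Ar (presheaves C \<U>) \<and> Src (presheaves C \<U>) (Y, s, R X) = Y \<and> Tgt (presheaves C \<U>) (Y, s, R X) = R X \<and>
        Cmp (presheaves A \<U>) (rst (R X), e X, X) (arm incl_pre (Y, s, R X)) = f"
        using s eq[OF s(1)] by (simp only: presheaves_simps)
      fix h assume h: "h \<in> Ar (presheaves C \<U>) \<and> Src (presheaves C \<U>) h = Y \<and> Tgt (presheaves C \<U>) h = R X \<and>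
        Cmp (presheaves A \<U>) (rst (R X), e X, X) (arm incl_pre h) = f"
      then obtain t where t: "h = (Y, t, R X)" "psh_trans C \<U> Y (R X) t" by (metis presheaves_ArE)
      then show "h = (Y, s, R X)" using un[OF t(2)] eq[OF t(2)] h by blast
    qed
  qed
  then obtain G \<eta> where G: "adjunction (presheaves C \<U>) (presheaves A \<U>) incl_pre G \<eta>
        (restrict (\<lambda>X. (rst (R X), e X, X)) (Ob (presheaves A \<U>)))" "\<forall>X\<in>Ob (presheaves A \<U>). obm G X = R X" by blast
  have "right_Kan_extension (op_cat A) (op_cat C) (set_cat \<U>) incl X (obm G X)
      (fst (snd (restrict (\<lambda>X. (rst (R X), e X, X)) (Ob (presheaves A \<U>)) X)))" if X: "X \<in> Ob (presheaves A \<U>)" for X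
  proof -
    have "presheaf A \<U> X" using X by (simp add: presheaves_simps)
    moreover have "restrict (\<lambda>X. (rst (R X), e X, X)) (Ob (presheaves A \<U>)) X = (rst (R X), e X, X)" using X by (rule restrict_apply')
    ultimately show ?thesis using kan G(2) X by (simp only: fst_conv snd_conv)
  qed
  then show ?thesis using G(1) by blast
qed

text \<open>The candidate counit that would present \<open>Y\<close> as a Kan extension of its own
  restriction.\<close>

definition idt :: "('o, 'm, 'u set, 'u set_arrow) func \<Rightarrow> 'o \<Rightarrow> 'u set_arrow" where
  "idt Y = (\<lambda>S\<in>Ob A. Idn (set_cat \<U>) (obm (rst Y) S))"

lemma idt_trans: "presheaf C \<U> Y \<Longrightarrow> psh_trans A \<U> (rst Y) (rst Y) (idt Y)"
  using nat_trans_Idn[OF category_op[OF A] category_set_cat presheaf_rst] by (simp add: idt_def)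

lemma ev_idt:
  assumes Y: "presheaf C \<U> Y" and f: "f \<in> over S" and z: "z \<in> obm Y S"
  shows "ev Y (idt Y) S z f = act Y f z"
  using f z act_closed[OF Y overD(1)[OF f], of z] overD[OF f] by (simp add: ev_def idt_def Cr)

text \<open>A Yoneda argument: the identity of \<open>S\<close> is terminal in the comma category,
  so a family is determined by its component there, and each value extends by the action.\<close>

lemma cones_Idn_bij:
  assumes X: "presheaf A \<U> X" and S: "S \<in> Ob C" "P S"
  shows "bij_betw (\<lambda>\<phi>. \<phi> (Idn C S)) (cones X S) (obm X S)"
proof (rule bij_betw_byWitness[of _ "\<lambda>x. \<lambda>f\<in>over S. act X f x"])
  have i: "Idn C S \<in> over S" using S by (simp add: over_def Cr)
  show "\<forall>\<phi>\<in>cones X S. (\<lambda>f\<in>over S. act X f (\<phi> (Idn C S))) = \<phi>"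
  proof
    fix \<phi> assume p: "\<phi> \<in> cones X S"
    show "(\<lambda>f\<in>over S. act X f (\<phi> (Idn C S))) = \<phi>"
    proof (rule extensionalityI[OF _ conesD(1)[OF p]])
      fix f assume f: "f \<in> over S"
      then show "(\<lambda>f\<in>over S. act X f (\<phi> (Idn C S))) f = \<phi> f"
        using conesD(3)[OF p i, of f] overD[OF f] S by (simp add: Cr)
    qed simp
  qed
  show "\<forall>x\<in>obm X S. (\<lambda>f\<in>over S. act X f x) (Idn C S) = x"
    using i act_Idn[OF X, of S] S by simp
  show "(\<lambda>\<phi>. \<phi> (Idn C S)) ` cones X S \<subseteq> obm X S"
    using conesD(2)[OF _ i] S by (auto simp: Cr)
  show "(\<lambda>x. \<lambda>f\<in>over S. act X f x) ` obm X S \<subseteq> cones X S"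
  proof (rule image_subsetI, rule conesI)
    fix x f assume x: "x \<in> obm X S" and f: "f \<in> over S"
    note o = overD[OF f]
    show "(\<lambda>f\<in>over S. act X f x) f \<in> obm X (Src C f)" using act_closed[OF X, of f x] f o x S by simp
    fix g assume g: "g \<in> Ar C" "P (Src C g)" "Tgt C g = Src C f"
    show "(\<lambda>f\<in>over S. act X f x) (Cmp C f g) = act X g ((\<lambda>f\<in>over S. act X f x) f)"
      using act_Cmp[OF X, of g f x] over_Cmp[OF f g] f o x S g by simp
  qed simp
qed

text \<open>On \<open>P\<close>-objects the comparison map is invertible for every presheaf; this
  starts the induction that reaches general \<open>S\<close>.\<close>

lemma ev_idt_bij:
  assumes Y: "presheaf C \<U> Y" and S: "S \<in> Ob C" "P S"
  shows "bij_betw (ev Y (idt Y) S) (obm Y S) (cones (rst Y) S)"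
proof -
  note e = idt_trans[OF Y]
  have ev: "ev Y (idt Y) S z (Idn C S) = z" if "z \<in> obm Y S" for z
    using ev_Idn[OF Y e S that] S that by (simp add: idt_def)
  have bij: "bij_betw (\<lambda>\<phi>. \<phi> (Idn C S)) (cones (rst Y) S) (obm Y S)"
    using cones_Idn_bij[OF presheaf_rst[OF Y] S] S by simp
  show ?thesis
  proof (rule bij_betw_byWitness[of _ "\<lambda>\<phi>. \<phi> (Idn C S)"])
    show "\<forall>z\<in>obm Y S. ev Y (idt Y) S z (Idn C S) = z" using ev by blast
    show "ev Y (idt Y) S ` obm Y S \<subseteq> cones (rst Y) S" using ev_cone[OF Y e] by blast
    show "(\<lambda>\<phi>. \<phi> (Idn C S)) ` cones (rst Y) S \<subseteq> obm Y S" using bij by (simp add: bij_betw_def)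
    show "\<forall>\<phi>\<in>cones (rst Y) S. ev Y (idt Y) S (\<phi> (Idn C S)) = \<phi>"
    proof
      fix \<phi> assume p: "\<phi> \<in> cones (rst Y) S"
      have z: "\<phi> (Idn C S) \<in> obm Y S" using bij_betwE[OF bij] p by blast
      show "ev Y (idt Y) S (\<phi> (Idn C S)) = \<phi>"
        by (rule inj_onD[OF bij_betw_imp_inj_on[OF bij] _ ev_cone[OF Y e z] p]) (rule ev[OF z])
    qed
  qed
qed

text \<open>The counit at a \<open>P\<close>-object is invertible because the comparison map is the
  inverse of evaluation at the identity up to it: composing the two bijections gives the counit. For
  the unit at \<open>Y\<close>, the triangle law shows that its composite with the comparison map of
  the Kan extension is the comparison map of \<open>Y\<close> with \<open>idt\<close>. The latter is
  bijective by \<open>Q2\<close>, so the unit is bijective as well.\<close>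

lemma Kan_adjoint_equivalence:
  assumes ex: "\<And>X. presheaf A \<U> X \<Longrightarrow> \<exists>R e. pointwise X R e"
    and adj: "adjunction (presheaves C \<U>) (presheaves A \<U>) incl_pre G \<eta> \<epsilon>"
    and kan: "\<And>X. presheaf A \<U> X \<Longrightarrow>
      right_Kan_extension (op_cat A) (op_cat C) (set_cat \<U>) incl X (obm G X) (fst (snd (\<epsilon> X)))"
    and Q1: "\<And>X R e. presheaf A \<U> X \<Longrightarrow> pointwise X R e \<Longrightarrow> Q R"
    and Q2: "\<And>Y. presheaf C \<U> Y \<Longrightarrow> Q Y \<Longrightarrow> pointwise (rst Y) Y (idt Y)"
  shows "adjoint_equivalence (full_subcat (presheaves C \<U>) Q) (presheaves A \<U>)
     (restrict_func incl_pre (full_subcat (presheaves C \<U>) Q)) G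
     (restrict \<eta> (Ob (full_subcat (presheaves C \<U>) Q))) \<epsilon>"
proof (rule adjoint_equivalence_full_subcat[OF adj])
  define e where "e X = fst (snd (\<epsilon> X))" for X
  have pw: "pointwise X (obm G X) (e X)" if "presheaf A \<U> X" for X
    using ex[OF that] kan[OF that] Kan_pointwise unfolding e_def by blast
  then have R: "presheaf C \<U> (obm G X)" and e: "psh_trans A \<U> (rst (obm G X)) X (e X)"
    and bij: "S \<in> Ob C \<Longrightarrow> bij_betw (ev (obm G X) (e X) S) (obm (obm G X) S) (cones X S)" if "presheaf A \<U> X" for X S
    using that by (auto simp: pointwise_def)
  have n1: "nat_trans (presheaves C \<U>) (presheaves C \<U>) (id_func (presheaves C \<U>)) (comp_func (presheaves C \<U>) G incl_pre) \<eta>"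
    and n2: "nat_trans (presheaves A \<U>) (presheaves A \<U>) (comp_func (presheaves A \<U>) incl_pre G) (id_func (presheaves A \<U>)) \<epsilon>"
    and tri: "\<And>Y. presheaf C \<U> Y \<Longrightarrow> Cmp (presheaves A \<U>) (\<epsilon> (obm incl_pre Y)) (arm incl_pre (\<eta> Y)) = Idn (presheaves A \<U>) (obm incl_pre Y)"
    using adj by (auto simp: adjunction_def presheaves_simps)
  have eps: "\<epsilon> X = (rst (obm G X), e X, X)" if X: "presheaf A \<U> X" for X
  proof -
    have X': "X \<in> Ob (presheaves A \<U>)" using X by (simp add: presheaves_simps)
    obtain t where t: "\<epsilon> X = (Src (presheaves A \<U>) (\<epsilon> X), t, Tgt (presheaves A \<U>) (\<epsilon> X))"
      using presheaves_ArE[OF nat_Ar[OF n2 X']] by metis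
    have "Src (presheaves A \<U>) (\<epsilon> X) = rst (obm G X)" "Tgt (presheaves A \<U>) (\<epsilon> X) = X"
      using nat_Src[OF n2 X'] nat_Tgt[OF n2 X'] X' incl_pre_simps(1)[OF R[OF X]] by (simp_all add: comp_func_def id_func_def)
    then have "\<epsilon> X = (rst (obm G X), t, X)" using t by simp
    then show ?thesis unfolding e_def by simp
  qed
  show "Q (obm G X)" if "X \<in> Ob (presheaves A \<U>)" for X
    using Q1[of X] pw[of X] that by (auto simp: presheaves_simps)
  show "is_iso (presheaves A \<U>) (\<epsilon> X)" if "X \<in> Ob (presheaves A \<U>)" for X
  proof -
    have X: "presheaf A \<U> X" using that by (simp add: presheaves_simps)
    show ?thesis
      unfolding eps[OF X]
    proof (rule psh_trans_iso[OF A e[OF X]])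
      fix S assume "S \<in> Ob A"
      then have S: "S \<in> Ob C" "P S" by auto
      have "bij_betw ((\<lambda>\<phi>. \<phi> (Idn C S)) \<circ> ev (obm G X) (e X) S) (obm (obm G X) S) (obm X S)"
        using bij[OF X S(1)] cones_Idn_bij[OF X S] by (rule bij_betw_trans)
      then have "bij_betw (fn (e X S)) (obm (obm G X) S) (obm X S)"
        by (rule iffD1[OF bij_betw_cong, rotated]) (simp add: ev_Idn[OF R[OF X] e[OF X] S])
      then show "bij_betw (fn (e X S)) (obm (rst (obm G X)) S) (obm X S)" using S by simp
    qed
  qed
  show "is_iso (presheaves C \<U>) (\<eta> Y)" if YO: "Y \<in> Ob (presheaves C \<U>)" and QY: "Q Y" for Y
  proof -
    have Y: "presheaf C \<U> Y" using YO by (simp add: presheaves_simps)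
    let ?X = "rst Y"
    let ?G = "obm G ?X"
    note X = presheaf_rst[OF Y]
    obtain h where h: "\<eta> Y = (Y, h, ?G)" "psh_trans C \<U> Y ?G h"
    proof -
      obtain t where t: "\<eta> Y = (Src (presheaves C \<U>) (\<eta> Y), t, Tgt (presheaves C \<U>) (\<eta> Y))"
         "psh_trans C \<U> (Src (presheaves C \<U>) (\<eta> Y)) (Tgt (presheaves C \<U>) (\<eta> Y)) t"
        using presheaves_ArE[OF nat_Ar[OF n1 YO]] by metis
      have "Src (presheaves C \<U>) (\<eta> Y) = Y" "Tgt (presheaves C \<U>) (\<eta> Y) = ?G"
        using nat_Src[OF n1 YO] nat_Tgt[OF n1 YO] YO incl_pre_simps(1)[OF Y]
        by (simp_all add: comp_func_def id_func_def)
      then show ?thesis using t that by metis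
    qed
    \<comment> \<open>The triangle law read at a single element: on \<open>P\<close>-objects the
      counit undoes the unit.\<close>
    have eh: "fn (e ?X S) (fn (h S) z) = z" if S: "S \<in> Ob C" "P S" "z \<in> obm Y S" for S z
    proof -
      have "(rst Y, \<lambda>S\<in>Ob A. Cmp (set_cat \<U>) (e ?X S) ((\<lambda>S\<in>Ob A. h S) S), ?X)
         = (?X, \<lambda>S\<in>Ob A. Idn (set_cat \<U>) (obm ?X S), ?X)"
        using tri[OF Y] unfolding incl_pre_simps(1)[OF Y] eps[OF X] h(1) incl_pre_simps(2)[OF h(2)] presheaves_simps .
      then have "(\<lambda>S\<in>Ob A. Cmp (set_cat \<U>) (e ?X S) ((\<lambda>S\<in>Ob A. h S) S)) = (\<lambda>S\<in>Ob A. Idn (set_cat \<U>) (obm ?X S))" by blast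
      from restrict_eqD[OF this, of S] S have "Cmp (set_cat \<U>) (e ?X S) (h S) = Idn (set_cat \<U>) (obm Y S)" by (simp del: set_cat_simps)
      then have "fn (Cmp (set_cat \<U>) (e ?X S) (h S)) = fn (Idn (set_cat \<U>) (obm Y S))" by (rule arg_cong)
      then have "(\<lambda>x\<in>obm Y S. fn (e ?X S) (fn (h S) x)) = (\<lambda>x\<in>obm Y S. x)" using psh_trans_eq(2)[OF h(2) S(1)] by simp
      then show ?thesis by (rule restrict_eqD[OF _ S(3)])
    qed
    have "bij_betw (fn (h S)) (obm Y S) (obm ?G S)" if S: "S \<in> Ob C" for S
    proof -
      have ev: "ev Y (idt Y) S z = ev ?G (e ?X) S (fn (h S) z)" if z: "z \<in> obm Y S" for z
      proof (rule extensionalityI[of _ "over S"])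
        fix f assume f: "f \<in> over S"
        note o = overD[OF f]
        have "fn (e ?X (Src C f)) (act ?G f (fn (h S) z)) = fn (e ?X (Src C f)) (fn (h (Src C f)) (act Y f z))"
          using psh_trans_natural[OF C h(2) o(1), of z] o z by simp
        also have "\<dots> = act Y f z" using eh[of "Src C f"] act_closed[OF Y o(1)] o z by (simp add: Cr)
        finally show "ev Y (idt Y) S z f = ev ?G (e ?X) S (fn (h S) z) f"
          using ev_idt[OF Y f z] f by (simp add: ev_def)
      qed (auto simp: ev_def)
      have b1: "bij_betw (ev Y (idt Y) S) (obm Y S) (cones ?X S)"
        using Q2[OF Y QY] S by (auto simp: pointwise_def)
      have b2: "bij_betw (ev ?G (e ?X) S) (obm ?G S) (cones ?X S)" using bij[OF X S] .
      have "inj_on (fn (h S)) (obm Y S)"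
        using b1 ev unfolding bij_betw_def inj_on_def by metis
      moreover have "fn (h S) ` obm Y S = obm ?G S"
      proof
        show "fn (h S) ` obm Y S \<subseteq> obm ?G S" using psh_trans_closed[OF h(2) S] by auto
        show "obm ?G S \<subseteq> fn (h S) ` obm Y S"
        proof
          fix w assume w: "w \<in> obm ?G S"
          have "ev ?G (e ?X) S w \<in> cones ?X S" using bij_betwE[OF b2] w by blast
          then have "ev ?G (e ?X) S w \<in> ev Y (idt Y) S ` obm Y S" by (simp only: bij_betw_imp_surj_on[OF b1])
          then obtain z where z: "ev ?G (e ?X) S w = ev Y (idt Y) S z" "z \<in> obm Y S" by (rule imageE)
          have "fn (h S) z = w"
            by (rule inj_onD[OF bij_betw_imp_inj_on[OF b2] _ psh_trans_closed[OF h(2) S z(2)] w]) (simp only: z(1) ev[OF z(2)])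
          then show "w \<in> fn (h S) ` obm Y S" using z by blast
        qed
      qed
      ultimately show ?thesis by (simp add: bij_betw_def)
    qed
    then show ?thesis unfolding h(1) using psh_trans_iso[OF C h(2)] by blast
  qed
qed

section \<open>Squares that are pushouts as seen from the subcategory\<close>

text \<open>The functor \<open>over\<close> carries the square to a union of two injective images
  that meet in the image of \<open>over (Src C iT)\<close>. Only arrows from
  \<open>P\<close>-objects are tested, since matching families see nothing else.\<close>

definition glued :: "'m \<Rightarrow> 'm \<Rightarrow> 'm \<Rightarrow> 'm \<Rightarrow> bool" where
  "glued iT iS jT jS \<longleftrightarrow> {iT, iS, jT, jS} \<subseteq> Ar C \<and> Src C iT = Src C iS \<and> Tgt C iT = Src C jT \<and>
     Tgt C iS = Src C jS \<and> Tgt C jT = Tgt C jS \<and> Cmp C jT iT = Cmp C jS iS \<and>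
     (\<forall>f\<in>over (Tgt C jT). (\<exists>g\<in>over (Src C jT). f = Cmp C jT g) \<or> (\<exists>h\<in>over (Src C jS). f = Cmp C jS h)) \<and>
     inj_on (Cmp C jT) (over (Src C jT)) \<and> inj_on (Cmp C jS) (over (Src C jS)) \<and>
     (\<forall>g\<in>over (Src C jT). \<forall>h\<in>over (Src C jS). Cmp C jT g = Cmp C jS h \<longrightarrow>
        (\<exists>r\<in>over (Src C iT). g = Cmp C iT r \<and> h = Cmp C iS r))"

lemma glued_cones_unique:
  assumes gl: "glued iT iS jT jS" and "\<chi> \<in> cones X (Tgt C jT)" "\<chi>' \<in> cones X (Tgt C jT)"
    and "pull jT \<chi> = pull jT \<chi>'" "pull jS \<chi> = pull jS \<chi>'"
  shows "\<chi> = \<chi>'"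
proof (rule extensionalityI[OF conesD(1)[OF assms(2)] conesD(1)[OF assms(3)]])
  fix f assume "f \<in> over (Tgt C jT)"
  then consider g where "g \<in> over (Src C jT)" "f = Cmp C jT g" | h where "h \<in> over (Src C jS)" "f = Cmp C jS h"
    using gl unfolding glued_def by blast
  then show "\<chi> f = \<chi>' f"
  proof cases
    case 1
    then show ?thesis using restrict_eqD[OF assms(4)[unfolded pull_def]] by simp
  next
    case 2
    then show ?thesis using restrict_eqD[OF assms(5)[unfolded pull_def]] by simp
  qed
qed

text \<open>A family on a union amounts to two families that agree on the intersection. The
  definition of \<open>\<chi>\<close> gives the \<open>T\<close> side precedence; on the overlap the
  common arrow \<open>r\<close> and \<open>pq\<close> show that the \<open>S\<close> side
  agrees.\<close>

lemma glued_cones_exists: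
  assumes gl: "glued iT iS jT jS" and p: "\<phi> \<in> cones X (Src C jT)" and q: "\<psi> \<in> cones X (Src C jS)"
    and pq: "pull iT \<phi> = pull iS \<psi>"
  shows "\<exists>\<chi>\<in>cones X (Tgt C jT). pull jT \<chi> = \<phi> \<and> pull jS \<chi> = \<psi>"
proof -
  have a: "iT \<in> Ar C" "iS \<in> Ar C" "jT \<in> Ar C" "jS \<in> Ar C" "Src C iT = Src C iS" "Tgt C iT = Src C jT"
    "Tgt C iS = Src C jS" "Tgt C jT = Tgt C jS"
    and injT: "inj_on (Cmp C jT) (over (Src C jT))" and injS: "inj_on (Cmp C jS) (over (Src C jS))"
    and cov: "\<And>f. f\<in>over (Tgt C jT) \<Longrightarrow> (\<exists>g\<in>over (Src C jT). f = Cmp C jT g) \<or> (\<exists>h\<in>over (Src C jS). f = Cmp C jS h)"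
    and ov: "\<And>g h. g\<in>over (Src C jT) \<Longrightarrow> h\<in>over (Src C jS) \<Longrightarrow> Cmp C jT g = Cmp C jS h \<Longrightarrow>
        \<exists>r\<in>over (Src C iT). g = Cmp C iT r \<and> h = Cmp C iS r"
    using gl unfolding glued_def by auto
  define \<chi> where "\<chi> = (\<lambda>f\<in>over (Tgt C jT). if \<exists>g\<in>over (Src C jT). f = Cmp C jT g
      then \<phi> (THE g. g \<in> over (Src C jT) \<and> f = Cmp C jT g) else \<psi> (THE h. h \<in> over (Src C jS) \<and> f = Cmp C jS h))"
  have T: "\<chi> (Cmp C jT g) = \<phi> g" if g: "g \<in> over (Src C jT)" for g
  proof -
    have "(THE g'. g' \<in> over (Src C jT) \<and> Cmp C jT g = Cmp C jT g') = g"
      by (rule the_equality) (use g injT in \<open>auto dest: inj_onD\<close>)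
    then show ?thesis using g over_push[OF g a(3)] by (auto simp: \<chi>_def)
  qed
  have S: "\<chi> (Cmp C jS h) = \<psi> h" if h: "h \<in> over (Src C jS)" for h
  proof (cases "\<exists>g\<in>over (Src C jT). Cmp C jS h = Cmp C jT g")
    case True
    then obtain g where g: "g \<in> over (Src C jT)" "Cmp C jS h = Cmp C jT g" by blast
    then obtain r where r: "r \<in> over (Src C iT)" "g = Cmp C iT r" "h = Cmp C iS r" using ov[of g h] h by auto
    have "\<phi> g = \<psi> h" using fun_cong[OF pq, of r] r a(5) by (simp add: pull_def)
    then show ?thesis using T[OF g(1)] g(2) by simp
  next
    case False
    have "(THE h'. h' \<in> over (Src C jS) \<and> Cmp C jS h = Cmp C jS h') = h"
      by (rule the_equality) (use h injS in \<open>auto dest: inj_onD\<close>)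
    then show ?thesis using False h over_push[OF h a(4)] a(8) by (auto simp: \<chi>_def)
  qed
  have "\<chi> \<in> cones X (Tgt C jT)"
  proof (rule conesI)
    fix f assume "f \<in> over (Tgt C jT)"
    then consider g where "g \<in> over (Src C jT)" "f = Cmp C jT g" | h where "h \<in> over (Src C jS)" "f = Cmp C jS h"
      using cov by blast
    then have "\<chi> f \<in> obm X (Src C f) \<and> (\<forall>k. k \<in> Ar C \<longrightarrow> P (Src C k) \<longrightarrow> Tgt C k = Src C f \<longrightarrow> \<chi> (Cmp C f k) = act X k (\<chi> f))"
    proof cases
      case 1
      note o = overD[OF 1(1)]
      have "\<chi> (Cmp C f k) = act X k (\<chi> f)" if k: "k \<in> Ar C" "P (Src C k)" "Tgt C k = Src C f" for k
      proof -
        have k': "Tgt C k = Src C g" using k 1 o a by (simp add: Cr)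
        have "Cmp C f k = Cmp C jT (Cmp C g k)" unfolding 1(2) by (rule cat_assoc[OF C, symmetric]) (use k k' o a in auto)
        then show ?thesis using T[OF over_Cmp[OF 1(1) k(1,2) k']] T[OF 1(1)] conesD(3)[OF p 1(1) k(1,2) k'] 1(2) by simp
      qed
      then show ?thesis using T[OF 1(1)] conesD(2)[OF p 1(1)] 1 o a by (simp add: Cr)
    next
      case 2
      note o = overD[OF 2(1)]
      have "\<chi> (Cmp C f k) = act X k (\<chi> f)" if k: "k \<in> Ar C" "P (Src C k)" "Tgt C k = Src C f" for k
      proof -
        have k': "Tgt C k = Src C h" using k 2 o a by (simp add: Cr)
        have "Cmp C f k = Cmp C jS (Cmp C h k)" unfolding 2(2) by (rule cat_assoc[OF C, symmetric]) (use k k' o a in auto)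
        then show ?thesis using S[OF over_Cmp[OF 2(1) k(1,2) k']] S[OF 2(1)] conesD(3)[OF q 2(1) k(1,2) k'] 2(2) by simp
      qed
      then show ?thesis using S[OF 2(1)] conesD(2)[OF q 2(1)] 2 o a by (simp add: Cr)
    qed
    then show "\<chi> f \<in> obm X (Src C f)"
      "\<And>k. k \<in> Ar C \<Longrightarrow> P (Src C k) \<Longrightarrow> Tgt C k = Src C f \<Longrightarrow> \<chi> (Cmp C f k) = act X k (\<chi> f)" by auto
  qed (simp add: \<chi>_def)
  moreover have "pull jT \<chi> = \<phi>"
    by (rule extensionalityI[OF _ conesD(1)[OF p]]) (use T in \<open>auto simp: pull_def\<close>)
  moreover have "pull jS \<chi> = \<psi>"
    by (rule extensionalityI[OF _ conesD(1)[OF q]]) (use S in \<open>auto simp: pull_def\<close>)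
  ultimately show ?thesis by blast
qed

context
  fixes X Y e iT iS jT jS
  assumes Y: "presheaf C \<U> Y" and e: "psh_trans A \<U> (rst Y) X e" and gl: "glued iT iS jT jS"
begin

private lemma arrs: "iT \<in> Ar C" "iS \<in> Ar C" "jT \<in> Ar C" "jS \<in> Ar C" "Src C iT = Src C iS" "Tgt C iT = Src C jT"
    "Tgt C iS = Src C jS" "Tgt C jT = Tgt C jS" "Cmp C jT iT = Cmp C jS iS"
  using gl unfolding glued_def by auto

private lemmas ev_pull = ev_act[OF Y e]

text \<open>Families over a union form a pullback of the families over the two pieces, and the
  comparison maps carry this to \<open>Y\<close>.\<close>

lemma glued_pullback:
  assumes bij: "\<And>S. S \<in> Ob C \<Longrightarrow> bij_betw (ev Y e S) (obm Y S) (cones X S)"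
  shows "is_pullback (set_cat \<U>) (arm Y iT) (arm Y iS) (arm Y jT) (arm Y jS)"
proof (rule is_pullback_setI)
  have evinj: "z = w" if "S \<in> Ob C" "z \<in> obm Y S" "w \<in> obm Y S" "ev Y e S z = ev Y e S w" for S z w
    using bij[OF that(1)] that unfolding bij_betw_def inj_on_def by blast
  have evsurj: "\<exists>z\<in>obm Y S. ev Y e S z = \<phi>" if "S \<in> Ob C" "\<phi> \<in> cones X S" for S \<phi>
    using bij[OF that(1)] that unfolding bij_betw_def by (metis imageE)
  have ar: "f \<in> Ar C \<Longrightarrow> arm Y f \<in> Ar (set_cat \<U>)" for f using functor_Ar[OF Y] by simp
  show "{arm Y iT, arm Y iS, arm Y jT, arm Y jS} \<subseteq> Ar (set_cat \<U>)" using arrs ar by blast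
  show "Tgt (set_cat \<U>) (arm Y iT) = Tgt (set_cat \<U>) (arm Y iS)" "fst (arm Y jT) = fst (arm Y jS)"
    "snd (snd (arm Y jT)) = fst (arm Y iT)" "snd (snd (arm Y jS)) = fst (arm Y iS)"
    using arrs by (simp_all add: presheaf_arm(2-3)[OF Y])
  show "act Y iT (act Y jT z) = act Y iS (act Y jS z)" if "z \<in> fst (arm Y jT)" for z
    using act_Cmp[OF Y, of iT jT z] act_Cmp[OF Y, of iS jS z] that arrs by (simp add: presheaf_arm(2-3)[OF Y])
  show "\<exists>z\<in>fst (arm Y jT). act Y jT z = x \<and> act Y jS z = y"
    if xy: "x \<in> fst (arm Y iT)" "y \<in> fst (arm Y iS)" "act Y iT x = act Y iS y" for x y
  proof -
    have x: "x \<in> obm Y (Src C jT)" and y: "y \<in> obm Y (Src C jS)"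
      using xy arrs by (simp_all add: presheaf_arm(2-3)[OF Y])
    have "pull iT (ev Y e (Src C jT) x) = pull iS (ev Y e (Src C jS) y)"
      using ev_pull[of iT x] ev_pull[of iS y] x y xy(3) arrs by simp
    from glued_cones_exists[OF gl ev_cone[OF Y e x] ev_cone[OF Y e y] this]
    obtain \<chi> where c: "\<chi> \<in> cones X (Tgt C jT)" "pull jT \<chi> = ev Y e (Src C jT) x" "pull jS \<chi> = ev Y e (Src C jS) y" by blast
    obtain z where z: "z \<in> obm Y (Tgt C jT)" "ev Y e (Tgt C jT) z = \<chi>" using evsurj[OF _ c(1)] arrs by (auto simp: Cr)
    have "act Y jT z = x"
      by (rule evinj[of "Src C jT"]) (use x z c arrs act_closed[OF Y, of jT z] ev_pull[of jT z] in \<open>auto simp: Cr\<close>)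
    moreover have "act Y jS z = y"
      by (rule evinj[of "Src C jS"]) (use y z c arrs act_closed[OF Y, of jS z] ev_pull[of jS z] in \<open>auto simp: Cr\<close>)
    ultimately show ?thesis using z arrs by (auto simp: presheaf_arm(2-3)[OF Y])
  qed
  show "z = w" if "z \<in> fst (arm Y jT)" "w \<in> fst (arm Y jT)" "act Y jT z = act Y jT w" "act Y jS z = act Y jS w" for z w
  proof -
    have zw: "z \<in> obm Y (Tgt C jT)" "w \<in> obm Y (Tgt C jT)" using that arrs by (simp_all add: presheaf_arm(2-3)[OF Y])
    have "ev Y e (Tgt C jT) z = ev Y e (Tgt C jT) w"
      by (rule glued_cones_unique[OF gl ev_cone[OF Y e zw(1)] ev_cone[OF Y e zw(2)]])
        (use that zw arrs ev_pull[of jT z] ev_pull[of jT w] ev_pull[of jS z] ev_pull[of jS w] in simp_all)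
    then show "z = w" using evinj[of "Tgt C jT"] zw arrs by (simp add: Cr)
  qed
qed

text \<open>At the fourth corner both the value of \<open>Y\<close> and the set of families are
  pullbacks, and the comparison maps at the other corners identify the two cospans. This is the
  induction step along decompositions.\<close>

lemma glued_ev_bij:
  assumes pb: "is_pullback (set_cat \<U>) (arm Y iT) (arm Y iS) (arm Y jT) (arm Y jS)"
    and bT: "bij_betw (ev Y e (Src C jT)) (obm Y (Src C jT)) (cones X (Src C jT))"
    and bS: "bij_betw (ev Y e (Src C jS)) (obm Y (Src C jS)) (cones X (Src C jS))"
    and bR: "bij_betw (ev Y e (Src C iT)) (obm Y (Src C iT)) (cones X (Src C iT))"
  shows "bij_betw (ev Y e (Tgt C jT)) (obm Y (Tgt C jT)) (cones X (Tgt C jT))"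
  unfolding bij_betw_def
proof
  have pb': "\<exists>!z. z \<in> obm Y (Tgt C jT) \<and> act Y jT z = x \<and> act Y jS z = y"
    if "x \<in> obm Y (Src C jT)" "y \<in> obm Y (Src C jS)" "act Y iT x = act Y iS y" for x y
    using is_pullback_setD[OF U pb, of x y] that arrs by (simp add: presheaf_arm(2-3)[OF Y])
  have evinj: "z = w" if "bij_betw (ev Y e S) (obm Y S) (cones X S)" "z \<in> obm Y S" "w \<in> obm Y S" "ev Y e S z = ev Y e S w" for S z w
    using that unfolding bij_betw_def inj_on_def by blast
  have evsurj: "\<exists>z\<in>obm Y S. ev Y e S z = \<phi>" if "bij_betw (ev Y e S) (obm Y S) (cones X S)" "\<phi> \<in> cones X S" for S \<phi>
    using that unfolding bij_betw_def by (metis imageE)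
  have cl: "act Y jT z \<in> obm Y (Src C jT)" "act Y jS z \<in> obm Y (Src C jS)" if "z \<in> obm Y (Tgt C jT)" for z
    using act_closed[OF Y arrs(3), of z] act_closed[OF Y arrs(4), of z] that arrs(8) by auto
  show "inj_on (ev Y e (Tgt C jT)) (obm Y (Tgt C jT))"
  proof (rule inj_onI)
    fix z w assume zw: "z \<in> obm Y (Tgt C jT)" "w \<in> obm Y (Tgt C jT)" "ev Y e (Tgt C jT) z = ev Y e (Tgt C jT) w"
    have T: "act Y jT z = act Y jT w"
      by (rule evinj[OF bT]) (use zw cl arrs ev_pull[of jT z] ev_pull[of jT w] in simp_all)
    have S: "act Y jS z = act Y jS w"
      by (rule evinj[OF bS]) (use zw cl arrs ev_pull[of jS z] ev_pull[of jS w] in simp_all)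
    have "act Y iT (act Y jT z) = act Y iS (act Y jS z)"
      using act_Cmp[OF Y, of iT jT z] act_Cmp[OF Y, of iS jS z] zw arrs by simp
    from pb'[OF cl[OF zw(1)] this] T S zw show "z = w" by metis
  qed
  show "ev Y e (Tgt C jT) ` obm Y (Tgt C jT) = cones X (Tgt C jT)"
  proof
    show "ev Y e (Tgt C jT) ` obm Y (Tgt C jT) \<subseteq> cones X (Tgt C jT)" using ev_cone[OF Y e] by auto
    show "cones X (Tgt C jT) \<subseteq> ev Y e (Tgt C jT) ` obm Y (Tgt C jT)"
    proof
      fix \<chi> assume c: "\<chi> \<in> cones X (Tgt C jT)"
      obtain x where x: "x \<in> obm Y (Src C jT)" "ev Y e (Src C jT) x = pull jT \<chi>"
        using evsurj[OF bT pull_cone[OF c arrs(3)]] by blast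
      obtain y where y: "y \<in> obm Y (Src C jS)" "ev Y e (Src C jS) y = pull jS \<chi>"
        using evsurj[OF bS pull_cone[OF _ arrs(4)]] c arrs(8) by metis
      have "act Y iT x = act Y iS y"
      proof (rule evinj[OF bR])
        show "act Y iT x \<in> obm Y (Src C iT)" "act Y iS y \<in> obm Y (Src C iT)"
          using act_closed[OF Y arrs(1), of x] act_closed[OF Y arrs(2), of y] x y arrs by auto
        have "pull iT (pull jT \<chi>) = pull iS (pull jS \<chi>)" using pull_Cmp arrs by simp
        then show "ev Y e (Src C iT) (act Y iT x) = ev Y e (Src C iT) (act Y iS y)"
          using ev_pull[of iT x] ev_pull[of iS y] x y arrs by simp
      qed
      from pb'[OF x(1) y(1) this] obtain z where z: "z \<in> obm Y (Tgt C jT)" "act Y jT z = x" "act Y jS z = y" by blast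
      have "ev Y e (Tgt C jT) z = \<chi>"
        by (rule glued_cones_unique[OF gl ev_cone[OF Y e z(1)] c])
          (use z x y arrs ev_pull[of jT z] ev_pull[of jS z] in simp_all)
      then show "\<chi> \<in> ev Y e (Tgt C jT) ` obm Y (Tgt C jT)" using z by blast
    qed
  qed
qed

end

end


section \<open>Positive hypergraphs and their morphisms\<close>

abbreviation le_plus :: "'f hypergraph \<Rightarrow> nat \<Rightarrow> 'f \<Rightarrow> 'f \<Rightarrow> bool" where
  "le_plus S j a b \<equiv> a = b \<or> (a, b) \<in> lt_plus S j"

lemma ph_finite: "positive_hypergraph S \<Longrightarrow> finite (faces S k)"
  and ph_finite_dims: "positive_hypergraph S \<Longrightarrow> finite {k. faces S k \<noteq> {}}"
  and ph_dim: "positive_hypergraph S \<Longrightarrow> a \<in> faces S k \<Longrightarrow> a \<in> faces S l \<Longrightarrow> k = l"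
  and ph_gam: "positive_hypergraph S \<Longrightarrow> a \<in> faces S (Suc k) \<Longrightarrow> gam S a \<in> faces S k"
  and ph_del: "positive_hypergraph S \<Longrightarrow> a \<in> faces S (Suc k) \<Longrightarrow> x \<in> del S a \<Longrightarrow> x \<in> faces S k"
  and ph_del_ne: "positive_hypergraph S \<Longrightarrow> a \<in> faces S (Suc k) \<Longrightarrow> del S a \<noteq> {}"
  and ph_del1: "positive_hypergraph S \<Longrightarrow> a \<in> faces S 1 \<Longrightarrow> is_singleton (del S a)"
  unfolding positive_hypergraph_def by blast+

lemma pos_facesI: "a \<in> faces S (Suc k) \<Longrightarrow> a \<in> pos_faces S"
  and all_facesI: "a \<in> faces S k \<Longrightarrow> a \<in> all_faces S"
  by (auto simp: pos_faces_def all_faces_def)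

lemma pos_facesE: assumes "a \<in> pos_faces S" obtains k where "a \<in> faces S (Suc k)"
  using assms by (auto simp: pos_faces_def)

lemma all_facesE: assumes "a \<in> all_faces S" obtains k where "a \<in> faces S k"
  using assms by (auto simp: all_faces_def)

lemma pos_faces_all: "a \<in> pos_faces S \<Longrightarrow> a \<in> all_faces S"
  by (auto simp: pos_faces_def all_faces_def)

lemma finite_all_faces:
  assumes "positive_hypergraph S" shows "finite (all_faces S)"
proof -
  have "all_faces S = (\<Union>k\<in>{k. faces S k \<noteq> {}}. faces S k)" by (auto simp: all_faces_def)
  then show ?thesis using ph_finite[OF assms] ph_finite_dims[OF assms] by auto
qed

lemma lt_plusI:
  "positive_hypergraph S \<Longrightarrow> c \<in> faces S (Suc j) \<Longrightarrow> a \<in> del S c \<Longrightarrow> (a, gam S c) \<in> lt_plus S j"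
  unfolding lt_plus_def by (rule r_into_trancl) (auto intro: ph_gam ph_del)

lemma lt_plus_trans: "(a, b) \<in> lt_plus S j \<Longrightarrow> (b, c) \<in> lt_plus S j \<Longrightarrow> (a, c) \<in> lt_plus S j"
  unfolding lt_plus_def by (rule trancl_trans)

lemma le_plus_lt: "le_plus S j a b \<Longrightarrow> (b, c) \<in> lt_plus S j \<Longrightarrow> (a, c) \<in> lt_plus S j"
  and lt_le_plus: "(a, b) \<in> lt_plus S j \<Longrightarrow> le_plus S j b c \<Longrightarrow> (a, c) \<in> lt_plus S j"
  and le_plus_trans: "le_plus S j a b \<Longrightarrow> le_plus S j b c \<Longrightarrow> le_plus S j a c"
  by (auto intro: lt_plus_trans)

lemma lt_plus_faces: "(a, b) \<in> lt_plus S j \<Longrightarrow> a \<in> faces S j \<and> b \<in> faces S j"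
  unfolding lt_plus_def by (induction rule: trancl_induct) auto

lemma lt_plus_first:
  assumes "(a, b) \<in> lt_plus S j"
  obtains c where "c \<in> faces S (Suc j)" "a \<in> del S c" "le_plus S j (gam S c) b"
  using tranclD[OF assms[unfolded lt_plus_def]] unfolding lt_plus_def by (auto simp: rtrancl_eq_or_trancl)

lemma lt_plus_last:
  assumes "(a, b) \<in> lt_plus S j"
  obtains c x where "c \<in> faces S (Suc j)" "gam S c = b" "x \<in> del S c" "x \<in> faces S j" "le_plus S j a x"
  using tranclD2[OF assms[unfolded lt_plus_def]] unfolding lt_plus_def by (auto simp: rtrancl_eq_or_trancl)

lemma lt_plus_induct [consumes 1, case_names step trans]:
  assumes "(a, b) \<in> lt_plus S j"
    and "\<And>c a. c \<in> faces S (Suc j) \<Longrightarrow> a \<in> faces S j \<Longrightarrow> gam S c \<in> faces S j \<Longrightarrow> a \<in> del S c \<Longrightarrow> Q a (gam S c)"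
    and "\<And>a b c. (a, b) \<in> lt_plus S j \<Longrightarrow> Q a b \<Longrightarrow> (b, c) \<in> lt_plus S j \<Longrightarrow> Q b c \<Longrightarrow> Q a c"
  shows "Q a b"
  using assms(1) unfolding lt_plus_def
  by (rule trancl_trans_induct) (use assms(2,3) in \<open>auto simp: lt_plus_def\<close>)

lemma lt_minusI:
  "a \<in> faces S (Suc j) \<Longrightarrow> b \<in> faces S (Suc j) \<Longrightarrow> gam S a \<in> del S b \<Longrightarrow> (a, b) \<in> lt_minus S (Suc j)"
  unfolding lt_minus_def by (rule r_into_trancl) auto

lemma hm_face: "hypergraph_morphism S T f \<Longrightarrow> a \<in> faces S k \<Longrightarrow> f a \<in> faces T k"
  and hm_ext: "hypergraph_morphism S T f \<Longrightarrow> f \<in> extensional (all_faces S)"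
  and hm_gam: "hypergraph_morphism S T f \<Longrightarrow> a \<in> faces S (Suc k) \<Longrightarrow> f (gam S a) = gam T (f a)"
  and hm_bij: "hypergraph_morphism S T f \<Longrightarrow> a \<in> faces S (Suc k) \<Longrightarrow> bij_betw f (del S a) (del T (f a))"
  and hm_del: "hypergraph_morphism S T f \<Longrightarrow> a \<in> faces S (Suc k) \<Longrightarrow> del T (f a) = f ` del S a"
  unfolding hypergraph_morphism_def by (auto intro: pos_facesI simp: bij_betw_def) (metis pos_facesI imageI image_eqI)+

lemma hm_all: "hypergraph_morphism S T f \<Longrightarrow> a \<in> all_faces S \<Longrightarrow> f a \<in> all_faces T"
  by (meson all_facesE all_facesI hm_face)

lemma hm_lt_plus:
  assumes f: "hypergraph_morphism S T f" and ab: "(a, b) \<in> lt_plus S k"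
  shows "(f a, f b) \<in> lt_plus T k"
  using ab
proof (induction rule: lt_plus_induct)
  case (step c a)
  then have "f c \<in> faces T (Suc k)" "f a \<in> del T (f c)" "gam T (f c) = f (gam S c)" "f a \<in> faces T k" "f (gam S c) \<in> faces T k"
    using f by (auto simp: hm_face hm_del[OF f] hm_gam[OF f, symmetric])
  then show ?case unfolding lt_plus_def by (intro r_into_trancl) auto
qed (rule lt_plus_trans)

lemma hm_lt_minus:
  assumes f: "hypergraph_morphism S T f" and ab: "(a, b) \<in> lt_minus S k"
  shows "(f a, f b) \<in> lt_minus T k"
proof (cases k)
  case 0
  then show ?thesis using ab by (simp add: lt_minus_def)
next
  case (Suc j)
  show ?thesis
    using ab unfolding lt_minus_def Suc
  proof (rule trancl_trans_induct)
    fix a b assume "(a, b) \<in> {(a, b). 0 < Suc j \<and> a \<in> faces S (Suc j) \<and> b \<in> faces S (Suc j) \<and> gam S a \<in> del S b}"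
    then show "(f a, f b) \<in> {(a, b). 0 < Suc j \<and> a \<in> faces T (Suc j) \<and> b \<in> faces T (Suc j) \<and> gam T a \<in> del T b}\<^sup>+"
      using f by (intro r_into_trancl) (auto simp: hm_face hm_del[OF f] hm_gam[OF f, symmetric])
  qed (rule trancl_trans)
qed

text \<open>Globularity is isolated at a single face so that it can be moved along the legs of a
  gluing face by face.\<close>

definition globular_at :: "'f hypergraph \<Rightarrow> 'f \<Rightarrow> bool" where
  "globular_at S a \<longleftrightarrow> {gam S (gam S a)} = gams S (del S a) - dels S (del S a) \<and>
     del S (gam S a) = dels S (del S a) - gams S (del S a)"

lemma globularity_iff: "globularity S \<longleftrightarrow> (\<forall>k. \<forall>a\<in>faces S (Suc (Suc k)). globular_at S a)"
proof -
  have "(\<forall>k\<ge>2. Q k) \<longleftrightarrow> (\<forall>k. Q (Suc (Suc k)))" for Q :: "nat \<Rightarrow> bool"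
    by (metis Suc_le_D Suc_le_mono numeral_2_eq_2 le0)
  from this[of "\<lambda>k. \<forall>a\<in>faces S k. globular_at S a"] show ?thesis
    unfolding globularity_def globular_at_def .
qed

text \<open>Images commute with set differences when the map is injective, hence \<open>inj\<close>;
  the rest is preservation of \<open>gam\<close> and \<open>del\<close>.\<close>

lemma globular_at_image:
  assumes S: "positive_hypergraph S" and f: "hypergraph_morphism S T f" and inj: "inj_on f (all_faces S)"
    and a: "a \<in> faces S (Suc (Suc k))"
  shows "globular_at T (f a) \<longleftrightarrow> globular_at S a"
proof -
  have ga: "gam S a \<in> faces S (Suc k)" "gam S (gam S a) \<in> faces S k" using S a by (auto intro: ph_gam)
  have d: "x \<in> faces S (Suc k)" if "x \<in> del S a" for x using ph_del[OF S a that] .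
  have g: "gams T (del T (f a)) = f ` gams S (del S a)"
    unfolding hm_del[OF f a] gams_def image_image by (rule image_cong[OF refl]) (simp add: hm_gam[OF f d])
  have dd: "dels T (del T (f a)) = f ` dels S (del S a)"
    unfolding hm_del[OF f a] dels_def image_UN UN_simps(10)[symmetric] by (auto simp: hm_del[OF f d])
  have gg: "gam T (gam T (f a)) = f (gam S (gam S a))" by (simp add: hm_gam[OF f a, symmetric] hm_gam[OF f ga(1), symmetric])
  have dg: "del T (gam T (f a)) = f ` del S (gam S a)" by (simp add: hm_gam[OF f a, symmetric] hm_del[OF f ga(1)])
  have "gams S (del S a) \<subseteq> faces S k" "dels S (del S a) \<subseteq> faces S k" "del S (gam S a) \<subseteq> faces S k" "{gam S (gam S a)} \<subseteq> faces S k"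
    using ph_gam[OF S d] ph_del[OF S d] ph_del[OF S ga(1)] ga(2) by (auto simp: gams_def dels_def)
  moreover have "faces S k \<subseteq> all_faces S" by (auto simp: all_faces_def)
  ultimately have sub: "gams S (del S a) \<subseteq> all_faces S" "dels S (del S a) \<subseteq> all_faces S" "del S (gam S a) \<subseteq> all_faces S" "{gam S (gam S a)} \<subseteq> all_faces S"
    by (meson subset_trans)+
  have diff: "f ` A - f ` B = f ` (A - B)" if "A \<subseteq> all_faces S" "B \<subseteq> all_faces S" for A B
    using inj_on_image_set_diff[OF inj] that by (metis Diff_subset dual_order.trans)
  have eq: "f ` A = f ` B \<longleftrightarrow> A = B" if "A \<subseteq> all_faces S" "B \<subseteq> all_faces S" for A B
    using inj_on_image_eq_iff[OF inj that] .
  have sub': "gams S (del S a) - dels S (del S a) \<subseteq> all_faces S" "dels S (del S a) - gams S (del S a) \<subseteq> all_faces S"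
    using sub by blast+
  have "{f (gam S (gam S a))} = f ` {gam S (gam S a)}" by simp
  then show ?thesis
    unfolding globular_at_def g dd gg dg diff[OF sub(1,2)] diff[OF sub(2,1)]
    using eq[OF sub(4) sub'(1)] eq[OF sub(3) sub'(2)] by simp
qed

section \<open>Positive opetopic cardinals\<close>

text \<open>Morphisms preserve \<open>lt_plus\<close> and \<open>lt_minus\<close>, so a cycle or a
  pair related in both ways in \<open>U\<close> would produce one in \<open>S\<close>. The axioms
  left as assumptions are those that a map out of \<open>U\<close> does not control.\<close>

lemma opetopic_cardinal_of_morphism:
  assumes U: "positive_hypergraph U" and f: "hypergraph_morphism U S f" and S: "positive_opetopic_cardinal S"
    and "faces U 0 \<noteq> {}" "globularity U" "total_on (faces U 0) (lt_plus U 0)" "pencil_linearity U"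
  shows "positive_opetopic_cardinal U"
proof -
  have "irrefl (lt_plus U k)" for k
    using S hm_lt_plus[OF f] by (fastforce simp: positive_opetopic_cardinal_def strictness_def irrefl_def)
  moreover have "disjointness U"
  proof -
    have "disjointness S" using S by (simp add: positive_opetopic_cardinal_def)
    then show ?thesis
      unfolding disjointness_def perp_def using hm_lt_plus[OF f] hm_lt_minus[OF f] hm_face[OF f] by meson
  qed
  ultimately show ?thesis using assms by (simp add: positive_opetopic_cardinal_def strictness_def)
qed

section \<open>The order structure of a single opetopic cardinal\<close>

locale opetopic_cardinal =
  fixes S :: "'f hypergraph"
  assumes poc: "positive_opetopic_cardinal S"
begin

lemma ph: "positive_hypergraph S"
  using poc by (simp add: positive_opetopic_cardinal_def)

lemmas gamF = ph_gam[OF ph] and delF = ph_del[OF ph] and ltI = lt_plusI[OF ph]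

lemma ne0: "faces S 0 \<noteq> {}"
  and irr: "(a, a) \<notin> lt_plus S k"
  and tot0: "a \<in> faces S 0 \<Longrightarrow> b \<in> faces S 0 \<Longrightarrow> le_plus S 0 a b \<or> (b, a) \<in> lt_plus S 0"
  using poc unfolding positive_opetopic_cardinal_def strictness_def irrefl_def total_on_def by auto

lemma pencil_gam:
  assumes "a \<in> faces S (Suc k)" "b \<in> faces S (Suc k)" "gam S a = gam S b"
  shows "le_plus S (Suc k) a b \<or> (b, a) \<in> lt_plus S (Suc k)"
  using poc assms gamF[OF assms(1)] unfolding positive_opetopic_cardinal_def pencil_linearity_def total_on_def by fastforce

lemma pencil_del:
  assumes "a \<in> faces S (Suc k)" "b \<in> faces S (Suc k)" "x \<in> del S a" "x \<in> del S b"
  shows "le_plus S (Suc k) a b \<or> (b, a) \<in> lt_plus S (Suc k)"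
  using poc assms delF[OF assms(1,3)] unfolding positive_opetopic_cardinal_def pencil_linearity_def total_on_def by fastforce

lemma disj:
  assumes "(a, b) \<in> lt_plus S (Suc k)" shows "gam S a \<notin> del S b" "gam S b \<notin> del S a"
proof -
  have ab: "a \<in> faces S (Suc k)" "b \<in> faces S (Suc k)" using lt_plus_faces[OF assms] by auto
  then have "\<not> perp (lt_minus S (Suc k)) a b"
    using poc assms unfolding positive_opetopic_cardinal_def disjointness_def perp_def by blast
  then show "gam S a \<notin> del S b" "gam S b \<notin> del S a" using ab by (auto simp: perp_def intro: lt_minusI)
qed

lemma fin_lt: "finite (lt_plus S k)"
proof (rule finite_subset)
  show "lt_plus S k \<subseteq> faces S k \<times> faces S k" by (auto dest: lt_plus_faces)
  show "finite (faces S k \<times> faces S k)" using ph_finite[OF ph] by simp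
qed

lemma acyclic_lt: "acyclic (lt_plus S k)"
proof -
  have "(lt_plus S k)\<^sup>+ = lt_plus S k" unfolding lt_plus_def by (simp add: trancl_id)
  then show ?thesis using irr by (simp add: acyclic_def)
qed

lemma wf_lt: "wf (lt_plus S k)" by (rule finite_acyclic_wf[OF fin_lt acyclic_lt])
lemma wf_gt: "wf ((lt_plus S k)\<inverse>)" by (rule finite_acyclic_wf_converse[OF fin_lt acyclic_lt])

lemma globular: "a \<in> faces S (Suc (Suc k)) \<Longrightarrow> globular_at S a"
  using poc by (auto simp: positive_opetopic_cardinal_def globularity_iff)

lemma gam_gam:
  assumes "a \<in> faces S (Suc (Suc k))"
  shows "\<exists>b\<in>del S a. gam S b = gam S (gam S a)"
    and "b \<in> del S a \<Longrightarrow> gam S (gam S a) \<notin> del S b"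
    and "b \<in> del S a \<Longrightarrow> gam S b = gam S (gam S a) \<or> (\<exists>c\<in>del S a. gam S b \<in> del S c)"
proof -
  have "{gam S (gam S a)} = gams S (del S a) - dels S (del S a)" using globular[OF assms] by (simp add: globular_at_def)
  then have "gam S (gam S a) \<in> gams S (del S a)" "gam S (gam S a) \<notin> dels S (del S a)"
    "\<And>x. x \<in> gams S (del S a) \<Longrightarrow> x = gam S (gam S a) \<or> x \<in> dels S (del S a)" by blast+
  then show "\<exists>b\<in>del S a. gam S b = gam S (gam S a)" "b \<in> del S a \<Longrightarrow> gam S (gam S a) \<notin> del S b"
    "b \<in> del S a \<Longrightarrow> gam S b = gam S (gam S a) \<or> (\<exists>c\<in>del S a. gam S b \<in> del S c)"
    by (auto simp: gams_def dels_def)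
qed

lemma del_gam:
  assumes "a \<in> faces S (Suc (Suc k))"
  shows "x \<in> del S (gam S a) \<Longrightarrow> \<exists>b\<in>del S a. x \<in> del S b"
    and "b \<in> del S a \<Longrightarrow> x \<in> del S b \<Longrightarrow> x \<in> del S (gam S a) \<or> (\<exists>c\<in>del S a. gam S c = x)"
    and "x \<in> del S (gam S a) \<Longrightarrow> b \<in> del S a \<Longrightarrow> gam S b \<noteq> x"
  using globular[OF assms] unfolding globular_at_def by (auto simp: gams_def dels_def)

text \<open>If \<open>gam S b\<close> is not yet \<open>gam S (gam S a)\<close>, globularity puts it
  into \<open>del S c\<close> for some \<open>c\<close> in \<open>del S a\<close>, and
  \<open>gam S c\<close> is strictly larger; finiteness ends the climb.\<close>

lemma gam_le_gam_gam:
  assumes a: "a \<in> faces S (Suc (Suc k))" and b: "b \<in> del S a"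
  shows "le_plus S k (gam S b) (gam S (gam S a))"
proof -
  have "x = gam S b \<Longrightarrow> b \<in> del S a \<Longrightarrow> le_plus S k x (gam S (gam S a))" for x b
  proof (induction x arbitrary: b rule: wf_induct_rule[OF wf_gt[of k]])
    case (1 x)
    then consider "x = gam S (gam S a)" | c where "c \<in> del S a" "x \<in> del S c" using gam_gam(3)[OF a] by metis
    then show ?case
    proof cases
      case 2
      have xc: "(x, gam S c) \<in> lt_plus S k" using ltI[OF delF[OF a 2(1)] 2(2)] .
      then show ?thesis using 1(1)[of "gam S c" c] 2(1) lt_le_plus by (metis converse_iff)
    qed simp
  qed
  then show ?thesis using b by blast
qed

lemma gam_mono:
  assumes "(e, c) \<in> lt_plus S (Suc k)" shows "le_plus S k (gam S e) (gam S c)"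
  using assms
proof (induction rule: lt_plus_induct)
  case (step c a)
  then show ?case using gam_le_gam_gam[of c k a] by simp
next
  case (trans a b c)
  then show ?case using le_plus_trans by metis
qed

lemma gam_mono': "le_plus S (Suc k) e c \<Longrightarrow> le_plus S k (gam S e) (gam S c)"
  using gam_mono by blast

text \<open>The first steps out of \<open>e\<close> are faces with \<open>e\<close> in their domain,
  hence comparable by pencil linearity. The codomain of the smaller one lies weakly below both
  targets by \<open>gam_mono\<close>, and the induction continues from there.\<close>

lemma above_linear:
  assumes "(e, b) \<in> lt_plus S k" "(e, c) \<in> lt_plus S k"
  shows "le_plus S k b c \<or> (c, b) \<in> lt_plus S k"
  using assms
proof (induction e arbitrary: b c rule: wf_induct_rule[OF wf_gt[of k]])
  case (1 e)
  have main: "le_plus S k b c \<or> (c, b) \<in> lt_plus S k"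
    if w: "w \<in> faces S (Suc k)" "e \<in> del S w" "le_plus S k (gam S w) b"
      and d: "le_plus S k (gam S d) c" and wd: "le_plus S (Suc k) w d" for w d b c
  proof -
    have "le_plus S k (gam S w) c" using gam_mono'[OF wd] d le_plus_trans by metis
    then show ?thesis using 1(1)[of "gam S w" b c] ltI[OF w(1,2)] w(3) by auto
  qed
  obtain w where w: "w \<in> faces S (Suc k)" "e \<in> del S w" "le_plus S k (gam S w) b" using 1(2) by (rule lt_plus_first)
  obtain d where d: "d \<in> faces S (Suc k)" "e \<in> del S d" "le_plus S k (gam S d) c" using 1(3) by (rule lt_plus_first)
  from pencil_del[OF w(1) d(1) w(2) d(2)] show ?case
  proof
    assume "le_plus S (Suc k) w d" then show ?thesis using main[OF w d(3)] by blast
  next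
    assume "(d, w) \<in> lt_plus S (Suc k)" then show ?thesis using main[OF d w(3)] by blast
  qed
qed

text \<open>Each single step is globularity: what disappears from the domain when passing to
  \<open>gam S c\<close> is the codomain of some face of \<open>del S c\<close>, hence of a face
  further below.\<close>

lemma del_below:
  assumes "(e, c) \<in> lt_plus S (Suc k)" "x \<in> del S e"
  shows "x \<in> del S c \<or> (\<exists>e'. (e', c) \<in> lt_plus S (Suc k) \<and> gam S e' = x)"
  using assms
proof (induction arbitrary: x rule: lt_plus_induct)
  case (step c a)
  then show ?case using del_gam(2)[of c k a x] ltI[OF step(1)] by blast
next
  case (trans a b c)
  then show ?case by (meson lt_plus_trans)
qed

lemma gam_below:
  assumes "(e, c) \<in> lt_plus S (Suc k)"
  shows "gam S e = gam S c \<or> (\<exists>e'. (e', c) \<in> lt_plus S (Suc k) \<and> gam S e \<in> del S e')"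
  using assms
proof (induction rule: lt_plus_induct)
  case (step c a)
  then show ?case using gam_gam(3)[of c k a] ltI[OF step(1)] by blast
next
  case (trans a b c)
  then show ?case by (metis lt_plus_trans)
qed

text \<open>Descends through faces that produce the current one, choosing at each step a domain face
  that keeps \<open>Q\<close>. The typical \<open>Q\<close> is incidence with a fixed face one
  dimension lower.\<close>

lemma minimal_below:
  assumes "a \<in> faces S k" and Q: "Q a" and "\<And>c. c \<in> faces S (Suc k) \<Longrightarrow> Q (gam S c) \<Longrightarrow> \<exists>x\<in>del S c. Q x"
  shows "\<exists>b\<in>faces S k - gams S (faces S (Suc k)). Q b \<and> le_plus S k b a"
  using assms(1,2)
proof (induction a rule: wf_induct_rule[OF wf_lt[of k]])
  case (1 a)
  show ?case
  proof (cases "a \<in> gams S (faces S (Suc k))")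
    case False
    then show ?thesis using 1 by blast
  next
    case True
    then obtain c where c: "c \<in> faces S (Suc k)" "a = gam S c" by (auto simp: gams_def)
    then obtain x where x: "x \<in> del S c" "Q x" using assms(3) 1(3) by blast
    have "(x, a) \<in> lt_plus S k" using ltI[OF c(1) x(1)] c(2) by simp
    then show ?thesis using 1(1)[of x] delF[OF c(1) x(1)] x(2) le_plus_lt by metis
  qed
qed

lemma maximal_above:
  assumes "a \<in> faces S k" and Q: "Q a" and "\<And>c x. c \<in> faces S (Suc k) \<Longrightarrow> x \<in> del S c \<Longrightarrow> Q x \<Longrightarrow> Q (gam S c)"
  shows "\<exists>b\<in>faces S k - dels S (faces S (Suc k)). Q b \<and> le_plus S k a b"
  using assms(1,2)
proof (induction a rule: wf_induct_rule[OF wf_gt[of k]])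
  case (1 a)
  show ?case
  proof (cases "a \<in> dels S (faces S (Suc k))")
    case False
    then show ?thesis using 1 by blast
  next
    case True
    then obtain c where c: "c \<in> faces S (Suc k)" "a \<in> del S c" by (auto simp: dels_def)
    have "(a, gam S c) \<in> lt_plus S k" using ltI[OF c] .
    then show ?thesis using 1(1)[of "gam S c"] gamF[OF c(1)] assms(3)[OF c 1(3)] lt_le_plus by (metis converse_iff)
  qed
qed

lemma lt_imp_dels: "(a, b) \<in> lt_plus S k \<Longrightarrow> a \<in> dels S (faces S (Suc k))"
  by (erule lt_plus_first) (auto simp: dels_def)

lemma lt_imp_gams: "(a, b) \<in> lt_plus S k \<Longrightarrow> b \<in> gams S (faces S (Suc k))"
  by (erule lt_plus_last) (auto simp: gams_def)

end


section \<open>Gluing opetopic cardinals\<close>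

text \<open>The flag selects between the two pencils of \<open>x\<close>, so that both halves of
  pencil linearity are proved at once.\<close>

definition incident :: "bool \<Rightarrow> 'f hypergraph \<Rightarrow> 'f \<Rightarrow> 'f \<Rightarrow> bool" where
  "incident i S a x \<longleftrightarrow> (if i then x = gam S a else x \<in> del S a)"

lemma incident_face: "positive_hypergraph S \<Longrightarrow> a \<in> faces S (Suc j) \<Longrightarrow> incident i S a x \<Longrightarrow> x \<in> faces S j"
  by (auto simp: incident_def ph_gam ph_del split: if_splits)

lemma incident_morphism:
  assumes "hypergraph_morphism S T f" "a \<in> faces S (Suc j)" "incident i T (f a) y"
  obtains x where "incident i S a x" "y = f x"
  using assms(3) hm_gam[OF assms(1,2)] hm_del[OF assms(1,2)] by (auto simp: incident_def split: if_splits)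

lemma pencil_linearityI:
  assumes "\<And>j i a b x. a \<in> faces S (Suc j) \<Longrightarrow> b \<in> faces S (Suc j) \<Longrightarrow> incident i S a x \<Longrightarrow> incident i S b x \<Longrightarrow>
     le_plus S (Suc j) a b \<or> (b, a) \<in> lt_plus S (Suc j)"
  shows "pencil_linearity S"
  unfolding pencil_linearity_def total_on_def
proof (intro allI ballI conjI impI)
  fix k x a b
  show "a \<in> {a \<in> faces S (Suc k). x = gam S a} \<Longrightarrow> b \<in> {a \<in> faces S (Suc k). x = gam S a} \<Longrightarrow> a \<noteq> b \<Longrightarrow>
     (a, b) \<in> lt_plus S (Suc k) \<or> (b, a) \<in> lt_plus S (Suc k)"
    using assms[of a k b True x] by (auto simp: incident_def)
  show "a \<in> {a \<in> faces S (Suc k). x \<in> del S a} \<Longrightarrow> b \<in> {a \<in> faces S (Suc k). x \<in> del S a} \<Longrightarrow> a \<noteq> b \<Longrightarrow>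
     (a, b) \<in> lt_plus S (Suc k) \<or> (b, a) \<in> lt_plus S (Suc k)"
    using assms[of a k b False x] by (auto simp: incident_def)
qed

context opetopic_cardinal begin

lemma pencil:
  assumes "a \<in> faces S (Suc j)" "b \<in> faces S (Suc j)" "incident i S a x" "incident i S b x"
  shows "le_plus S (Suc j) a b \<or> (b, a) \<in> lt_plus S (Suc j)"
  using assms pencil_gam[of a j b] pencil_del[of a j b x] by (auto simp: incident_def split: if_splits)

lemma incident_gam:
  assumes "c \<in> faces S (Suc (Suc j))" "incident i S (gam S c) x"
  shows "\<exists>y\<in>del S c. incident i S y x"
proof (cases i)
  case True
  obtain b where "b \<in> del S c" "gam S b = gam S (gam S c)" using gam_gam(1)[OF assms(1)] by blast
  then show ?thesis using True assms(2) by (intro bexI[of _ b]) (simp_all add: incident_def)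
next
  case False
  then show ?thesis using assms del_gam(1)[OF assms(1), of x] by (simp add: incident_def)
qed

text \<open>Together with \<open>incident_gam\<close> this lets incidence with \<open>x\<close>
  travel along \<open>lt_plus\<close>: downwards to some domain face, and upwards as long as
  \<open>x\<close> is not internal to the face passed. Removing \<open>iota\<close> in
  \<open>cod_part\<close> secures the latter.\<close>

lemma incident_del:
  assumes "c \<in> faces S (Suc (Suc j))" "y \<in> del S c" "incident i S y x" "x \<notin> iota S c"
  shows "incident i S (gam S c) x"
  using assms gam_gam(3)[OF assms(1,2)] del_gam(2)[OF assms(1,2), of x]
  by (auto simp: incident_def iota_def dels_def gams_def split: if_splits)

end

section \<open>Domain and codomain parts, and gluings along them\<close>

lemma faces_dom_part:
  "faces (dom_part k S) l = (if l < k then faces S l else if l = k then faces S k - gams S (faces S (Suc k)) else {})"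
  by (simp add: dom_part_def sub_hypergraph_def)

lemma faces_cod_part:
  "faces (cod_part k S) l = (if Suc l < k then faces S l
     else if Suc l = k then faces S l - iotas S (faces S (Suc k))
     else if l = k then faces S k - dels S (faces S (Suc k)) else {})"
  by (simp add: cod_part_def sub_hypergraph_def)

lemma faces_sub_hypergraph [simp]: "faces (sub_hypergraph S G) = G"
  by (simp add: sub_hypergraph_def)

lemma sub_hypergraph_pos:
  assumes "a \<in> G (Suc l)"
  shows "gam (sub_hypergraph S G) a = gam S a" "del (sub_hypergraph S G) a = del S a"
  using assms by (auto simp: sub_hypergraph_def)

lemma dom_part_pos:
  "a \<in> faces (dom_part k S) (Suc l) \<Longrightarrow> gam (dom_part k S) a = gam S a \<and> del (dom_part k S) a = del S a"
  unfolding dom_part_def faces_sub_hypergraph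
  by (intro conjI; (erule sub_hypergraph_pos(1) | erule sub_hypergraph_pos(2)))

lemma cod_part_pos:
  "a \<in> faces (cod_part k S) (Suc l) \<Longrightarrow> gam (cod_part k S) a = gam S a \<and> del (cod_part k S) a = del S a"
  unfolding cod_part_def faces_sub_hypergraph
  by (intro conjI; (erule sub_hypergraph_pos(1) | erule sub_hypergraph_pos(2)))

text \<open>\<open>P\<close> is the union of copies of \<open>T\<close> and \<open>S\<close> that
  share exactly \<open>R\<close>. Since \<open>R\<close> is meant to be literally contained in both,
  the overlap clause asks for \<open>a = b\<close> and not merely for a common preimage.\<close>

definition glue :: "'f hypergraph \<Rightarrow> 'f hypergraph \<Rightarrow> 'f hypergraph \<Rightarrow> 'f hypergraph \<Rightarrow> ('f \<Rightarrow> 'f) \<Rightarrow> ('f \<Rightarrow> 'f) \<Rightarrow> bool" where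
  "glue R T S P g s \<longleftrightarrow> hypergraph_morphism T P g \<and> hypergraph_morphism S P s \<and>
     inj_on g (all_faces T) \<and> inj_on s (all_faces S) \<and>
     (\<forall>l. faces P l = g ` faces T l \<union> s ` faces S l) \<and>
     (\<forall>a\<in>all_faces R. g a = s a) \<and>
     (\<forall>a\<in>all_faces T. \<forall>b\<in>all_faces S. g a = s b \<longrightarrow> a = b \<and> a \<in> all_faces R)"

lemma glue_morphisms: "glue R T S P g s \<Longrightarrow> hypergraph_morphism T P g" "glue R T S P g s \<Longrightarrow> hypergraph_morphism S P s"
  and glue_inj: "glue R T S P g s \<Longrightarrow> inj_on g (all_faces T)" "glue R T S P g s \<Longrightarrow> inj_on s (all_faces S)"
  and glue_faces: "glue R T S P g s \<Longrightarrow> faces P l = g ` faces T l \<union> s ` faces S l"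
  and glue_agree: "glue R T S P g s \<Longrightarrow> a \<in> all_faces R \<Longrightarrow> g a = s a"
  by (simp_all add: glue_def)

lemma glue_overlap:
  assumes gl: "glue R T S P g s" and ab: "a \<in> all_faces T" "b \<in> all_faces S" "g a = s b"
  shows "a = b \<and> a \<in> all_faces R"
proof -
  have "\<forall>a\<in>all_faces T. \<forall>b\<in>all_faces S. g a = s b \<longrightarrow> a = b \<and> a \<in> all_faces R"
    using gl unfolding glue_def by (elim conjE)
  then show ?thesis using ab by simp
qed

text \<open>\<open>T\<close> sits on top of \<open>S\<close>. Descending from \<open>a\<close> in
  \<open>T\<close> and climbing from \<open>b\<close> in \<open>S\<close> end in shared
  \<open>k\<close>-faces \<open>r\<close> and \<open>r'\<close> that both satisfy \<open>Q\<close>.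
  Totality makes them comparable, yet neither is a codomain in \<open>T\<close>, so they are equal
  and link \<open>b\<close> to \<open>a\<close>.\<close>

lemma glue_compare:
  assumes T: "positive_opetopic_cardinal T" and S: "positive_opetopic_cardinal S"
    and R: "faces T k - gams T (faces T (Suc k)) = faces S k - dels S (faces S (Suc k))"
    and QT: "\<And>c. c \<in> faces T (Suc k) \<Longrightarrow> Q (gam T c) \<Longrightarrow> \<exists>x\<in>del T c. Q x"
    and QS: "\<And>c x. c \<in> faces S (Suc k) \<Longrightarrow> x \<in> del S c \<Longrightarrow> Q' x \<Longrightarrow> Q' (gam S c)"
    and QQ: "\<And>r. r \<in> faces T k - gams T (faces T (Suc k)) \<Longrightarrow> Q' r \<Longrightarrow> Q r"
    and tot: "\<And>a b. a \<in> faces T k \<Longrightarrow> b \<in> faces T k \<Longrightarrow> Q a \<Longrightarrow> Q b \<Longrightarrow> le_plus T k a b \<or> (b, a) \<in> lt_plus T k"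
    and a: "a \<in> faces T k" "Q a" and b: "b \<in> faces S k" "Q' b"
  shows "\<exists>r\<in>faces T k - gams T (faces T (Suc k)). le_plus S k b r \<and> le_plus T k r a"
proof -
  interpret T: opetopic_cardinal T by unfold_locales fact
  interpret S: opetopic_cardinal S by unfold_locales fact
  have "\<exists>r\<in>faces T k - gams T (faces T (Suc k)). Q r \<and> le_plus T k r a"
    by (rule T.minimal_below[where Q = Q, OF a]) (rule QT)
  then obtain r where r: "r \<in> faces T k - gams T (faces T (Suc k))" "Q r" "le_plus T k r a" by blast
  have "\<exists>r\<in>faces S k - dels S (faces S (Suc k)). Q' r \<and> le_plus S k b r"
    by (rule S.maximal_above[where Q = Q', OF b]) (rule QS)
  then obtain r' where r': "r' \<in> faces T k - gams T (faces T (Suc k))" "Q' r'" "le_plus S k b r'"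
    unfolding R by blast
  have "r = r'"
    using tot[of r r'] r(1,2) r'(1) QQ[OF r'(1,2)] T.lt_imp_gams[of r r' k] T.lt_imp_gams[of r' r k] by blast
  then show ?thesis using r r' by blast
qed

context
  fixes k and T S P :: "'f hypergraph" and g s
  assumes T: "positive_opetopic_cardinal T" and S: "positive_opetopic_cardinal S"
    and eq: "cod_part k S = dom_part k T" and gl: "glue (dom_part k T) T S P g s"
begin

interpretation T: opetopic_cardinal T by unfold_locales (rule T)
interpretation S: opetopic_cardinal S by unfold_locales (rule S)

private lemma g: "hypergraph_morphism T P g" and s: "hypergraph_morphism S P s"
  and ing: "inj_on g (all_faces T)" and ins: "inj_on s (all_faces S)"
  and P: "faces P l = g ` faces T l \<union> s ` faces S l"
  and gs: "a \<in> all_faces (dom_part k T) \<Longrightarrow> g a = s a"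
  and ov: "a \<in> all_faces T \<Longrightarrow> b \<in> all_faces S \<Longrightarrow> g a = s b \<Longrightarrow> a = b \<and> a \<in> all_faces (dom_part k T)"
  by (rule glue_morphisms[OF gl] glue_inj[OF gl] glue_faces[OF gl] glue_agree[OF gl] glue_overlap[OF gl]; assumption?)+

private lemma RT: "a \<in> faces T l \<Longrightarrow> a \<in> all_faces (dom_part k T) \<Longrightarrow> a \<in> faces (dom_part k T) l"
  using ph_dim[OF T.ph] by (force simp: all_faces_def faces_dom_part split: if_splits)

private lemma feq: "faces (dom_part k T) l = faces (cod_part k S) l"
  using eq by simp

text \<open>The dimension of the shared face \<open>y\<close> decides. Above \<open>k\<close> there
  is none. In dimension \<open>k\<close> a shared face is neither a codomain in \<open>T\<close> nor
  in a domain of \<open>S\<close>, so one of the two incidences is impossible. For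
  \<open>Suc j < k\<close> the face \<open>a\<close> already lies in \<open>S\<close>. Only
  \<open>Suc j = k\<close> needs both sides, and there the comparison passes through a common
  \<open>k\<close>-face.\<close>

lemma glue_pencil:
  assumes a: "a \<in> faces T (Suc j)" and b: "b \<in> faces S (Suc j)" and x: "incident i P (g a) x" "incident i P (s b) x"
  shows "le_plus P (Suc j) (g a) (s b) \<or> (s b, g a) \<in> lt_plus P (Suc j)"
proof -
  obtain y where y: "incident i T a y" "x = g y" using incident_morphism[OF g a x(1)] .
  obtain z where z: "incident i S b z" "x = s z" using incident_morphism[OF s b x(2)] .
  have yz: "y \<in> faces T j" "z \<in> faces S j" using incident_face[OF T.ph a y(1)] incident_face[OF S.ph b z(1)] by auto
  then have "y = z" and yR: "y \<in> faces (dom_part k T) j"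
    using ov[of y z] y(2) z(2) RT by (auto dest: all_facesI)
  consider "k < j" | "j = k" | "Suc j < k" | "Suc j = k" by linarith
  then show ?thesis
  proof cases
    case 1
    then show ?thesis using yR by (simp add: faces_dom_part)
  next
    case 2
    then have "y \<notin> gams T (faces T (Suc k))" using yR by (simp add: faces_dom_part)
    moreover have "y \<notin> dels S (faces S (Suc k))" using yR 2 unfolding feq by (simp add: faces_cod_part)
    moreover have "y \<in> gams T (faces T (Suc k))" if i using y(1) a 2 that by (simp add: incident_def gams_def)
    moreover have "y \<in> dels S (faces S (Suc k))" if "\<not> i" using z(1) \<open>y = z\<close> b 2 that by (auto simp: incident_def dels_def)
    ultimately show ?thesis by blast
  next
    case 3
    then have aR: "a \<in> faces (dom_part k T) (Suc j)" using a by (simp add: faces_dom_part)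
    then have ga: "g a = s a" using gs by (auto dest: all_facesI)
    have aS: "a \<in> faces S (Suc j)" using aR unfolding feq by (auto simp: faces_cod_part split: if_splits)
    have "incident i P (s a) x" using x(1) ga by simp
    then obtain y' where y': "incident i S a y'" "x = s y'" using incident_morphism[OF s aS] by blast
    have "y' = z" using inj_onD[OF ins, of y' z] y'(2) z(2) incident_face[OF S.ph aS y'(1)] yz by (auto dest: all_facesI)
    then have "le_plus S (Suc j) a b \<or> (b, a) \<in> lt_plus S (Suc j)" using S.pencil[OF aS b y'(1)] z(1) by simp
    then show ?thesis unfolding ga using hm_lt_plus[OF s] by blast
  next
    case 4
    \<comment> \<open>\<open>y\<close> survives in \<open>cod_part k S\<close>, so it is internal to
      no face of dimension \<open>Suc k\<close>; this allows incidence with \<open>y\<close> to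
      climb in \<open>S\<close>.\<close>
    have yi: "y \<notin> iotas S (faces S (Suc k))" using yR 4 unfolding feq by (auto simp: faces_cod_part)
    have "\<exists>r\<in>faces T k - gams T (faces T (Suc k)). le_plus S k b r \<and> le_plus T k r a"
    proof (rule glue_compare[OF T S, where Q = "\<lambda>a. incident i T a y" and Q' = "\<lambda>b. incident i S b y"])
      show "faces T k - gams T (faces T (Suc k)) = faces S k - dels S (faces S (Suc k))"
        using feq[of k] by (simp add: faces_dom_part faces_cod_part)
      show "\<exists>x\<in>del T c. incident i T x y" if "c \<in> faces T (Suc k)" "incident i T (gam T c) y" for c
        using T.incident_gam[of c j i y] that 4 by simp
      show "incident i S (gam S c) y" if "c \<in> faces S (Suc k)" "x \<in> del S c" "incident i S x y" for c x
        using S.incident_del[of c j x i y] that 4 yi by (auto simp: iotas_def)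
      show "incident i T r y" if r: "r \<in> faces T k - gams T (faces T (Suc k))" "incident i S r y" for r
      proof -
        have rR: "r \<in> faces (dom_part k T) (Suc j)" using r 4 by (simp add: faces_dom_part)
        then show ?thesis
          using r(2) eq dom_part_pos[OF rR] cod_part_pos[OF rR[unfolded feq]] by (simp add: incident_def)
      qed
      show "le_plus T k a b \<or> (b, a) \<in> lt_plus T k"
        if "a \<in> faces T k" "b \<in> faces T k" "incident i T a y" "incident i T b y" for a b
        using T.pencil[of a j b i y] that 4 by simp
    qed (use a b y(1) z(1) \<open>y = z\<close> 4 in auto)
    then obtain r where r: "r \<in> faces T k - gams T (faces T (Suc k))" "le_plus S k b r" "le_plus T k r a" by blast
    then have "g r = s r" by (intro gs all_facesI[of _ _ k]) (simp add: faces_dom_part)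
    moreover have "le_plus P k (s b) (s r)" "le_plus P k (g r) (g a)" using r hm_lt_plus[OF s] hm_lt_plus[OF g] by blast+
    ultimately have "le_plus P k (s b) (g a)" using le_plus_trans by metis
    then show ?thesis using 4 by auto
  qed
qed

lemma glue_opetopic_cardinal:
  assumes phP: "positive_hypergraph P" and w: "hypergraph_morphism P V w" and V: "positive_opetopic_cardinal V"
  shows "positive_opetopic_cardinal P"
proof (rule opetopic_cardinal_of_morphism[OF phP w V])
  show "faces P 0 \<noteq> {}" using P T.ne0 by blast
  show "globularity P"
    unfolding globularity_iff
  proof (intro allI ballI)
    fix l a assume "a \<in> faces P (Suc (Suc l))"
    then consider b where "b \<in> faces T (Suc (Suc l))" "a = g b" | b where "b \<in> faces S (Suc (Suc l))" "a = s b"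
      unfolding P by blast
    then show "globular_at P a"
    proof cases
      case 1
      then show ?thesis using globular_at_image[OF T.ph g ing] T.globular by blast
    next
      case 2
      then show ?thesis using globular_at_image[OF S.ph s ins] S.globular by blast
    qed
  qed
  show "pencil_linearity P"
  proof (rule pencil_linearityI)
    fix j i a b x assume ab: "a \<in> faces P (Suc j)" "b \<in> faces P (Suc j)" and x: "incident i P a x" "incident i P b x"
    consider a' b' where "a' \<in> faces T (Suc j)" "b' \<in> faces T (Suc j)" "a = g a'" "b = g b'"
      | a' b' where "a' \<in> faces S (Suc j)" "b' \<in> faces S (Suc j)" "a = s a'" "b = s b'"
      | a' b' where "a' \<in> faces T (Suc j)" "b' \<in> faces S (Suc j)" "a = g a'" "b = s b'"
      | a' b' where "a' \<in> faces S (Suc j)" "b' \<in> faces T (Suc j)" "a = s a'" "b = g b'"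
      using ab unfolding P by blast
    then show "le_plus P (Suc j) a b \<or> (b, a) \<in> lt_plus P (Suc j)"
    proof cases
      case 1
      obtain y where y: "incident i T a' y" "x = g y" using incident_morphism[OF g 1(1)] x 1 by metis
      obtain z where z: "incident i T b' z" "x = g z" using incident_morphism[OF g 1(2)] x 1 by metis
      have "y = z" using inj_onD[OF ing, of y z] y z incident_face[OF T.ph 1(1) y(1)] incident_face[OF T.ph 1(2) z(1)]
        by (auto dest: all_facesI)
      then show ?thesis using T.pencil[OF 1(1,2) y(1)] z(1) hm_lt_plus[OF g] 1 by blast
    next
      case 2
      obtain y where y: "incident i S a' y" "x = s y" using incident_morphism[OF s 2(1)] x 2 by metis
      obtain z where z: "incident i S b' z" "x = s z" using incident_morphism[OF s 2(2)] x 2 by metis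
      have "y = z" using inj_onD[OF ins, of y z] y z incident_face[OF S.ph 2(1) y(1)] incident_face[OF S.ph 2(2) z(1)]
        by (auto dest: all_facesI)
      then show ?thesis using S.pencil[OF 2(1,2) y(1)] z(1) hm_lt_plus[OF s] 2 by blast
    next
      case 3
      have "le_plus P (Suc j) (g a') (s b') \<or> (s b', g a') \<in> lt_plus P (Suc j)"
        by (rule glue_pencil[OF 3(1,2)]) (use x 3 in auto)
      then show ?thesis using 3 by simp
    next
      case 4
      have "le_plus P (Suc j) (g b') (s a') \<or> (s a', g b') \<in> lt_plus P (Suc j)"
        by (rule glue_pencil[OF 4(2,1)]) (use x 4 in auto)
      then show ?thesis using 4 by auto
    qed
  qed
  \<comment> \<open>For \<open>k = 0\<close> this is \<open>glue_compare\<close> with the trivial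
    property, as any two vertices of \<open>T\<close> are comparable; for \<open>k > 0\<close> all
    vertices of \<open>T\<close> are shared.\<close>
  have mixed: "le_plus P 0 (s b) (g a) \<or> (g a, s b) \<in> lt_plus P 0" if a: "a \<in> faces T 0" and b: "b \<in> faces S 0" for a b
  proof (cases "k = 0")
    case True
    have "\<exists>r\<in>faces T k - gams T (faces T (Suc k)). le_plus S k b r \<and> le_plus T k r a"
    proof (rule glue_compare[OF T S, where Q = "\<lambda>_. True" and Q' = "\<lambda>_. True"])
      show "faces T k - gams T (faces T (Suc k)) = faces S k - dels S (faces S (Suc k))"
        using feq[of k] by (simp add: faces_dom_part faces_cod_part)
      show "\<exists>x\<in>del T c. True" if "c \<in> faces T (Suc k)" for c using ph_del_ne[OF T.ph that] by auto
    qed (use a b T.tot0 True in auto)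
    then obtain r where r: "r \<in> faces T k - gams T (faces T (Suc k))" "le_plus S k b r" "le_plus T k r a" by blast
    then have "g r = s r" by (intro gs all_facesI[of _ _ k]) (simp add: faces_dom_part)
    moreover have "le_plus P k (s b) (s r)" "le_plus P k (g r) (g a)" using r hm_lt_plus[OF s] hm_lt_plus[OF g] by blast+
    ultimately have "le_plus P k (s b) (g a)" using le_plus_trans by metis
    then show ?thesis using True by auto
  next
    case False
    then have aR: "a \<in> faces (dom_part k T) 0" using a by (simp add: faces_dom_part)
    then have ga: "g a = s a" using gs by (auto dest: all_facesI)
    have aS: "a \<in> faces S 0" using aR False unfolding feq by (auto simp: faces_cod_part split: if_splits)
    show ?thesis unfolding ga using S.tot0[OF b aS] hm_lt_plus[OF s] by blast
  qed
  show "total_on (faces P 0) (lt_plus P 0)"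
    unfolding total_on_def
  proof (intro ballI impI)
    fix a b assume ab: "a \<in> faces P 0" "b \<in> faces P 0" "a \<noteq> b"
    consider a' b' where "a' \<in> faces T 0" "b' \<in> faces T 0" "a = g a'" "b = g b'"
      | a' b' where "a' \<in> faces S 0" "b' \<in> faces S 0" "a = s a'" "b = s b'"
      | a' b' where "a' \<in> faces T 0" "b' \<in> faces S 0" "a = g a'" "b = s b'"
      | a' b' where "a' \<in> faces S 0" "b' \<in> faces T 0" "a = s a'" "b = g b'"
      using ab unfolding P by blast
    then show "(a, b) \<in> lt_plus P 0 \<or> (b, a) \<in> lt_plus P 0"
    proof cases
      case 1
      then show ?thesis using T.tot0[OF 1(1,2)] hm_lt_plus[OF g] ab(3) by blast
    next
      case 2
      then show ?thesis using S.tot0[OF 2(1,2)] hm_lt_plus[OF s] ab(3) by blast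
    next
      case 3
      then show ?thesis using mixed[OF 3(1,2)] ab(3) by auto
    next
      case 4
      then show ?thesis using mixed[OF 4(2,1)] ab(3) by auto
    qed
  qed
qed

end

section \<open>Universal property and construction of gluings\<close>

lemma glue_universal:
  assumes T: "positive_hypergraph T" and S: "positive_hypergraph S" and P: "positive_hypergraph P"
    and gl: "glue R T S P g s"
    and u: "hypergraph_morphism T V u" and v: "hypergraph_morphism S V v" and uv: "\<And>a. a \<in> all_faces R \<Longrightarrow> u a = v a"
  shows "\<exists>!w. hypergraph_morphism P V w \<and> (\<forall>a\<in>all_faces T. w (g a) = u a) \<and> (\<forall>a\<in>all_faces S. w (s a) = v a)"
proof -
  have g: "hypergraph_morphism T P g" and s: "hypergraph_morphism S P s"
    and ing: "inj_on g (all_faces T)" and ins: "inj_on s (all_faces S)"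
    and Pf: "\<And>l. faces P l = g ` faces T l \<union> s ` faces S l"
    and ov: "\<And>a b. a \<in> all_faces T \<Longrightarrow> b \<in> all_faces S \<Longrightarrow> g a = s b \<Longrightarrow> a = b \<and> a \<in> all_faces R"
    by (rule glue_morphisms[OF gl] glue_inj[OF gl] glue_faces[OF gl] glue_overlap[OF gl]; assumption?)+
  have Pall: "all_faces P = g ` all_faces T \<union> s ` all_faces S" unfolding all_faces_def Pf by blast
  \<comment> \<open>On shared faces both branches give the same value by \<open>uv\<close>, so the
    preference for \<open>T\<close> is harmless.\<close>
  define w where "w = (\<lambda>p\<in>all_faces P. if p \<in> g ` all_faces T then u (inv_into (all_faces T) g p) else v (inv_into (all_faces S) s p))"
  have wg: "w (g a) = u a" if "a \<in> all_faces T" for a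
    using that ing Pall by (auto simp: w_def)
  have ws: "w (s a) = v a" if a: "a \<in> all_faces S" for a
  proof (cases "s a \<in> g ` all_faces T")
    case True
    then obtain b where b: "b \<in> all_faces T" "s a = g b" by blast
    then have "b = a" "b \<in> all_faces R" using ov[of b a] a by auto
    then show ?thesis using b wg uv by auto
  next
    case False
    then show ?thesis using a ins Pall by (auto simp: w_def)
  qed
  have hw: "hypergraph_morphism P V w"
    unfolding hypergraph_morphism_def
  proof (intro conjI allI ballI)
    show "w \<in> extensional (all_faces P)" by (simp add: w_def)
    fix l
    show "w ` faces P l \<subseteq> faces V l"
      unfolding Pf using wg[OF all_facesI[of _ T l]] ws[OF all_facesI[of _ S l]] hm_face[OF u] hm_face[OF v] by auto
  next
    have part: "w (gam P (f b)) = gam V (w (f b)) \<and> bij_betw w (del P (f b)) (del V (w (f b)))"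
      if Q: "positive_hypergraph Q" and f: "hypergraph_morphism Q P f" and h: "hypergraph_morphism Q V h"
        and wf: "\<And>a. a \<in> all_faces Q \<Longrightarrow> w (f a) = h a" and b: "b \<in> faces Q (Suc l)" for Q f h b l
    proof
      have fb: "w (f b) = h b" using wf b by (auto dest: all_facesI)
      have "w (gam P (f b)) = w (f (gam Q b))" by (simp add: hm_gam[OF f b])
      also have "\<dots> = h (gam Q b)" using wf ph_gam[OF Q b] by (auto dest: all_facesI)
      finally show "w (gam P (f b)) = gam V (w (f b))" unfolding fb by (simp add: hm_gam[OF h b])
      have "bij_betw (w \<circ> f) (del Q b) (del V (h b))"
        using hm_bij[OF h b] by (rule iffD1[OF bij_betw_cong, rotated]) (simp add: wf all_facesI[OF ph_del[OF Q b]])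
      then show "bij_betw w (del P (f b)) (del V (w (f b)))"
        unfolding fb using bij_betw_comp_iff[OF hm_bij[OF f b]] by blast
    qed
    fix p assume "p \<in> pos_faces P"
    then obtain l where "p \<in> faces P (Suc l)" by (rule pos_facesE)
    then consider b where "b \<in> faces T (Suc l)" "p = g b" | b where "b \<in> faces S (Suc l)" "p = s b" unfolding Pf by blast
    then have "w (gam P p) = gam V (w p) \<and> bij_betw w (del P p) (del V (w p))"
    proof cases
      case 1
      then show ?thesis using part[OF T g u wg 1(1)] by blast
    next
      case 2
      then show ?thesis using part[OF S s v ws 2(1)] by blast
    qed
    then show "w (gam P p) = gam V (w p)" "bij_betw w (del P p) (del V (w p))" by auto
  qed
  show ?thesis
  proof (rule ex1I[of _ w])
    show "hypergraph_morphism P V w \<and> (\<forall>a\<in>all_faces T. w (g a) = u a) \<and> (\<forall>a\<in>all_faces S. w (s a) = v a)"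
      using hw wg ws by blast
    fix w' assume w': "hypergraph_morphism P V w' \<and> (\<forall>a\<in>all_faces T. w' (g a) = u a) \<and> (\<forall>a\<in>all_faces S. w' (s a) = v a)"
    show "w' = w"
    proof (rule extensionalityI[of _ "all_faces P"])
      show "w' \<in> extensional (all_faces P)" "w \<in> extensional (all_faces P)" using w' hw by (auto intro: hm_ext)
      fix p assume "p \<in> all_faces P"
      then show "w' p = w p" unfolding Pall using w' wg ws by auto
    qed
  qed
qed

text \<open>\<open>S\<close> is kept and \<open>T\<close> is renamed outside \<open>R\<close>, since
  a face of \<open>T\<close> and one of \<open>S\<close> may be the same element of the type without
  being identified in the gluing.\<close>

lemma glue_exists:
  assumes inf: "infinite (UNIV :: 'f set)"
    and T: "positive_hypergraph (T :: 'f hypergraph)" and S: "positive_hypergraph S" and R: "positive_hypergraph R"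
    and RT: "hypergraph_morphism R T (\<lambda>a\<in>all_faces R. a)" and RS: "hypergraph_morphism R S (\<lambda>a\<in>all_faces R. a)"
  shows "\<exists>P g s. positive_hypergraph P \<and> glue R T S P g s"
proof -
  have RTf: "a \<in> faces T l" and RSf: "a \<in> faces S l" if "a \<in> faces R l" for a l
    using hm_face[OF RT that] hm_face[OF RS that] all_facesI[OF that] by auto
  have Rdim: "a \<in> faces R l" if "a \<in> all_faces R" "a \<in> faces T l \<or> a \<in> faces S l" for a l
    using that ph_dim[OF T] ph_dim[OF S] RTf RSf by (metis all_facesE)
  have RTS: "gam T a = gam S a" "gam T a \<in> all_faces R" "del T a = del S a" "del T a \<subseteq> all_faces R" if a: "a \<in> faces R (Suc l)" for a l
  proof -
    have i: "(\<lambda>a\<in>all_faces R. a) a = a" "(\<lambda>a\<in>all_faces R. a) (gam R a) = gam R a" "gam R a \<in> all_faces R"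
      using a ph_gam[OF R a] by (auto dest: all_facesI)
    have sub: "del R a \<subseteq> all_faces R" using ph_del[OF R a] by (auto intro: all_facesI)
    then have d: "(\<lambda>a\<in>all_faces R. a) ` del R a = del R a" by auto
    show "gam T a = gam S a" "gam T a \<in> all_faces R" "del T a = del S a" "del T a \<subseteq> all_faces R"
      using hm_gam[OF RT a] hm_gam[OF RS a] hm_del[OF RT a] hm_del[OF RS a] i sub d by auto
  qed
  let ?X = "all_faces T - all_faces R"
  have fX: "finite ?X" using finite_all_faces[OF T] by simp
  \<comment> \<open>Fresh names, one for each face of \<open>T\<close> outside
    \<open>R\<close>.\<close>
  obtain N where N: "finite N" "card N = card ?X" "N \<subseteq> UNIV - (all_faces T \<union> all_faces S)"
    using infinite_arbitrarily_large[of "UNIV - (all_faces T \<union> all_faces S)" "card ?X"] inf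
      finite_all_faces[OF T] finite_all_faces[OF S] by (metis Diff_infinite_finite finite_UnI)
  obtain h where h: "bij_betw h ?X N" using finite_same_card_bij[OF fX N(1)] N(2) by auto
  define g where "g = (\<lambda>a\<in>all_faces T. if a \<in> all_faces R then a else h a)"
  have RTa: "a \<in> all_faces R \<Longrightarrow> a \<in> all_faces T" and RSa: "a \<in> all_faces R \<Longrightarrow> a \<in> all_faces S" for a
    by (metis RTf RSf all_facesE all_facesI)+
  have gR: "g a = a" if "a \<in> all_faces R" for a using that RTa by (simp add: g_def)
  have gN: "g a \<in> N" if "a \<in> all_faces T" "a \<notin> all_faces R" for a
    using that bij_betwE[OF h] by (auto simp: g_def)
  have NS: "a \<in> N \<Longrightarrow> a \<notin> all_faces S" "a \<in> N \<Longrightarrow> a \<notin> all_faces R" for a using N(3) RSa by auto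
  have ing: "inj_on g (all_faces T)"
  proof (rule inj_onI)
    fix a b assume ab: "a \<in> all_faces T" "b \<in> all_faces T" "g a = g b"
    show "a = b"
    proof (cases "a \<in> all_faces R \<or> b \<in> all_faces R")
      case True
      then show ?thesis using ab gR gN NS(2) by metis
    next
      case False
      then show ?thesis using ab inj_onD[OF bij_betw_imp_inj_on[OF h], of a b] by (auto simp: g_def)
    qed
  qed
  have ov: "a = b \<and> a \<in> all_faces R" if "a \<in> all_faces T" "b \<in> all_faces S" "g a = b" for a b
    using that gR gN NS(1) by metis
  let ?i = "inv_into (all_faces T) g"
  have ig: "?i (g a) = a" if "a \<in> all_faces T" for a using that ing by simp
  define Pf where "Pf l = g ` faces T l \<union> faces S l" for l
  \<comment> \<open>Shared faces take their structure from \<open>S\<close>; by \<open>RTS\<close>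
    it agrees with that from \<open>T\<close>.\<close>
  define P where "P = \<lparr>faces = Pf,
      gam = (\<lambda>p. if p \<in> pos_faces S then gam S p else if p \<in> g ` pos_faces T then g (gam T (?i p)) else undefined),
      del = (\<lambda>p. if p \<in> pos_faces S then del S p else if p \<in> g ` pos_faces T then g ` del T (?i p) else {})\<rparr>"
  have P: "faces P l = g ` faces T l \<union> faces S l" for l by (simp add: P_def Pf_def)
  have PS: "gam P a = gam S a" "del P a = del S a" if "a \<in> faces S (Suc l)" for a l
    using pos_facesI[OF that] by (auto simp: P_def)
  have PT: "gam P (g a) = g (gam T a)" "del P (g a) = g ` del T a" if a: "a \<in> faces T (Suc l)" for a l
  proof -
    have aa: "a \<in> all_faces T" using a by (rule all_facesI)
    have *: "gam P (g a) = g (gam T a) \<and> del P (g a) = g ` del T a"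
    proof (cases "g a \<in> pos_faces S")
      case True
      then have "g a = a" "a \<in> all_faces R" using ov[of a "g a"] aa by (auto dest: pos_faces_all)
      then have "a \<in> faces R (Suc l)" using Rdim a by blast
      note r = RTS[OF this]
      have "g ` del T a = del T a" using r(4) gR by (auto simp: image_iff subset_iff)
      then show ?thesis using True \<open>g a = a\<close> r gR[of "gam T a"] by (simp add: P_def)
    next
      case False
      then show ?thesis using a ig[OF aa] pos_facesI[OF a] by (simp add: P_def)
    qed
    then show "gam P (g a) = g (gam T a)" "del P (g a) = g ` del T a" by auto
  qed
  have phP: "positive_hypergraph P"
    unfolding positive_hypergraph_def
  proof (intro conjI allI ballI impI)
    show "finite (faces P k)" for k unfolding P using ph_finite[OF T] ph_finite[OF S] by simp
    have "{k. faces P k \<noteq> {}} \<subseteq> {k. faces T k \<noteq> {}} \<union> {k. faces S k \<noteq> {}}" unfolding P by auto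
    then show "finite {k. faces P k \<noteq> {}}" using ph_finite_dims[OF T] ph_finite_dims[OF S] finite_subset by (metis finite_UnI)
  next
    fix k l :: nat assume kl: "k \<noteq> l"
    show "faces P k \<inter> faces P l = {}"
    proof (rule ccontr)
      assume "faces P k \<inter> faces P l \<noteq> {}"
      then obtain p where p: "p \<in> faces P k" "p \<in> faces P l" by blast
      have "False" if a: "a \<in> faces T k'" and b: "g a \<in> faces S l'" and n: "k' \<noteq> l'" for a k' l'
      proof -
        have "g a = a" "a \<in> all_faces R" using ov[OF all_facesI[OF a] all_facesI[OF b] refl] by simp_all
        then have "a \<in> faces R k'" "a \<in> faces R l'" using Rdim a b by auto
        then show False using ph_dim[OF R] n by blast
      qed
      moreover have False if "a \<in> faces T k" "b \<in> faces T l" "g a = g b" for a b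
        using inj_onD[OF ing that(3)] that ph_dim[OF T] kl by (metis all_facesI)
      ultimately show False using p kl ph_dim[OF S, of p k l] unfolding P by (metis UnE imageE)
    qed
  next
    fix k p assume "p \<in> faces P (Suc k)"
    then consider a where "a \<in> faces T (Suc k)" "p = g a" | "p \<in> faces S (Suc k)" unfolding P by blast
    then have "gam P p \<in> faces P k \<and> del P p \<subseteq> faces P k \<and> del P p \<noteq> {}"
    proof cases
      case 1
      then show ?thesis using PT[OF 1(1)] ph_gam[OF T 1(1)] ph_del[OF T 1(1)] ph_del_ne[OF T 1(1)] unfolding P by auto
    next
      case 2
      then show ?thesis using PS[OF 2] ph_gam[OF S 2] ph_del[OF S 2] ph_del_ne[OF S 2] unfolding P by auto
    qed
    then show "gam P p \<in> faces P k" "del P p \<subseteq> faces P k" "del P p \<noteq> {}" by auto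
  next
    fix p assume "p \<in> faces P 1"
    then consider a where "a \<in> faces T 1" "p = g a" | "p \<in> faces S 1" unfolding P by blast
    then show "is_singleton (del P p)"
    proof cases
      case 1
      obtain x where "del T a = {x}" using ph_del1[OF T 1(1)] by (auto simp: is_singleton_def)
      then show ?thesis using PT(2)[of a 0] 1 by (simp add: is_singleton_def)
    next
      case 2
      then show ?thesis using PS(2)[of p 0] ph_del1[OF S 2] by simp
    qed
  next
    fix p assume p: "p \<notin> pos_faces P"
    have "p \<notin> pos_faces S" "p \<notin> g ` pos_faces T" using p unfolding pos_faces_def P by auto
    then show "gam P p = undefined" "del P p = {}" by (simp_all add: P_def)
  qed
  have hg: "hypergraph_morphism T P g"
    unfolding hypergraph_morphism_def
  proof (intro conjI allI ballI)
    show "g \<in> extensional (all_faces T)" by (simp add: g_def)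
    show "g ` faces T k \<subseteq> faces P k" for k unfolding P by simp
    fix a assume "a \<in> pos_faces T"
    then obtain l where a: "a \<in> faces T (Suc l)" by (rule pos_facesE)
    show "g (gam T a) = gam P (g a)" by (simp add: PT[OF a])
    have "del T a \<subseteq> all_faces T" using ph_del[OF T a] by (auto intro: all_facesI)
    then show "bij_betw g (del T a) (del P (g a))" unfolding PT(2)[OF a] using inj_on_subset[OF ing] by (auto simp: bij_betw_def)
  qed
  define s where "s = (\<lambda>a\<in>all_faces S. a)"
  have sS: "s a = a" if "a \<in> faces S l" for a l using all_facesI[OF that] by (simp add: s_def)
  have hs: "hypergraph_morphism S P s"
    unfolding hypergraph_morphism_def
  proof (intro conjI allI ballI)
    show "s \<in> extensional (all_faces S)" by (simp add: s_def)
    show "s ` faces S k \<subseteq> faces P k" for k unfolding P using sS by auto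
    fix a assume "a \<in> pos_faces S"
    then obtain l where a: "a \<in> faces S (Suc l)" by (rule pos_facesE)
    show "s (gam S a) = gam P (s a)" using PS[OF a] sS[OF a] sS[OF ph_gam[OF S a]] by simp
    have "s x = x" if "x \<in> del S a" for x using sS[OF ph_del[OF S a that]] .
    then show "bij_betw s (del S a) (del P (s a))" unfolding sS[OF a] PS(2)[OF a] by (auto simp: bij_betw_def inj_on_def)
  qed
  have "glue R T S P g s"
    unfolding glue_def
  proof (intro conjI allI ballI impI)
    show "inj_on s (all_faces S)" by (auto simp: s_def inj_on_def)
    show "faces P l = g ` faces T l \<union> s ` faces S l" for l unfolding P using sS by force
    show "g a = s a" if "a \<in> all_faces R" for a using gR[OF that] RSa[OF that] by (simp add: s_def)
    show "a = b" "a \<in> all_faces R" if "a \<in> all_faces T" "b \<in> all_faces S" "g a = s b" for a b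
      using ov[OF that(1,2)] that by (auto simp: s_def)
  qed (fact hg hs ing)+
  then show ?thesis using phP by blast
qed


section \<open>Sub-hypergraphs of opetopic cardinals\<close>

definition subclosed :: "'f hypergraph \<Rightarrow> (nat \<Rightarrow> 'f set) \<Rightarrow> bool" where
  "subclosed S G \<longleftrightarrow> (\<forall>j. G j \<subseteq> faces S j) \<and> (\<forall>j. \<forall>a\<in>G (Suc j). gam S a \<in> G j \<and> del S a \<subseteq> G j)"

lemma incl_morphismI:
  assumes "\<And>l. faces R l \<subseteq> faces S l"
    and "\<And>a l. a \<in> faces R (Suc l) \<Longrightarrow> gam R a = gam S a \<and> del R a = del S a \<and> gam R a \<in> faces R l \<and> del R a \<subseteq> faces R l"
  shows "hypergraph_morphism R S (\<lambda>a\<in>all_faces R. a)"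
  unfolding hypergraph_morphism_def
proof (intro conjI allI ballI)
  show "(\<lambda>a\<in>all_faces R. a) ` faces R k \<subseteq> faces S k" for k using assms(1) by (auto simp: all_facesI)
  fix a assume "a \<in> pos_faces R"
  then obtain l where a: "a \<in> faces R (Suc l)" by (rule pos_facesE)
  have all: "a \<in> all_faces R" "gam R a \<in> all_faces R" "del R a \<subseteq> all_faces R"
    using a assms(2)[OF a] by (auto intro: all_facesI)
  then show "(\<lambda>a\<in>all_faces R. a) (gam R a) = gam S ((\<lambda>a\<in>all_faces R. a) a)" using assms(2)[OF a] by simp
  have "\<And>x. x \<in> del R a \<Longrightarrow> (\<lambda>a\<in>all_faces R. a) x = x" using all by auto
  then show "bij_betw (\<lambda>a\<in>all_faces R. a) (del R a) (del S ((\<lambda>a\<in>all_faces R. a) a))"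
    using assms(2)[OF a] all(1) by (simp add: bij_betw_def inj_on_def)
qed simp

lemma sub_hypergraph_morphism:
  assumes S: "positive_hypergraph S" and G: "subclosed S G"
  shows "positive_hypergraph (sub_hypergraph S G)"
    and "hypergraph_morphism (sub_hypergraph S G) S (\<lambda>a\<in>all_faces (sub_hypergraph S G). a)"
proof -
  let ?R = "sub_hypergraph S G"
  have GS: "G l \<subseteq> faces S l" for l using G by (auto simp: subclosed_def)
  have cl: "gam S a \<in> G l" "del S a \<subseteq> G l" if "a \<in> G (Suc l)" for a l using G that by (auto simp: subclosed_def)
  show "hypergraph_morphism ?R S (\<lambda>a\<in>all_faces ?R. a)"
    by (rule incl_morphismI) (use GS cl sub_hypergraph_pos in \<open>auto simp: sub_hypergraph_pos\<close>)
  show "positive_hypergraph ?R"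
    unfolding positive_hypergraph_def
  proof (intro conjI allI ballI impI)
    show "finite (faces ?R k)" for k using finite_subset[OF GS ph_finite[OF S]] by simp
    have "{k. faces ?R k \<noteq> {}} \<subseteq> {k. faces S k \<noteq> {}}" using GS by auto
    then show "finite {k. faces ?R k \<noteq> {}}" using ph_finite_dims[OF S] by (rule finite_subset)
    show "k \<noteq> l \<Longrightarrow> faces ?R k \<inter> faces ?R l = {}" for k l using GS[of k] GS[of l] ph_dim[OF S] by fastforce
    fix k a assume "a \<in> faces ?R (Suc k)"
    then have a: "a \<in> G (Suc k)" by simp
    then show "gam ?R a \<in> faces ?R k" "del ?R a \<subseteq> faces ?R k" "del ?R a \<noteq> {}"
      using cl[OF a] ph_del_ne[OF S, of a k] GS[of "Suc k"] by (auto simp: sub_hypergraph_pos[where G = G, OF a])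
  next
    fix a assume "a \<in> faces ?R 1"
    then have a: "a \<in> G (Suc 0)" by simp
    then show "is_singleton (del ?R a)" using ph_del1[OF S, of a] GS[of "Suc 0"] by (auto simp: sub_hypergraph_pos[where G = G, OF a])
  next
    fix a assume "a \<notin> pos_faces ?R"
    then show "gam ?R a = undefined" "del ?R a = {}" by (auto simp: sub_hypergraph_def pos_faces_def)
  qed
qed

lemma sub_lt_plusI:
  assumes "subclosed S G" "c \<in> G (Suc j)" "a \<in> del S c"
  shows "(a, gam S c) \<in> lt_plus (sub_hypergraph S G) j"
proof -
  have "gam S c \<in> G j" "del S c \<subseteq> G j" using assms(1,2) unfolding subclosed_def by blast+
  then show ?thesis
    unfolding lt_plus_def using assms(2,3) sub_hypergraph_pos[where G = G, OF assms(2)]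
    by (intro r_into_trancl) (auto intro!: bexI[of _ c])
qed

context opetopic_cardinal begin

text \<open>The inclusion into \<open>S\<close> supplies irreflexivity and disjointness. Pencil
  linearity and linearity on vertices are inherited once relations between faces of \<open>G\<close>
  are witnessed inside \<open>G\<close>, which is the last assumption.\<close>

lemma sub_opetopic_cardinal:
  assumes G: "subclosed S G" and ne: "G j0 \<noteq> {}"
    and refl: "\<And>j a b. a \<in> G j \<Longrightarrow> b \<in> G j \<Longrightarrow> (a, b) \<in> lt_plus S j \<Longrightarrow> (a, b) \<in> lt_plus (sub_hypergraph S G) j"
  shows "positive_opetopic_cardinal (sub_hypergraph S G)"
proof (rule opetopic_cardinal_of_morphism[OF sub_hypergraph_morphism[OF ph G] poc])
  let ?R = "sub_hypergraph S G"
  have GS: "G l \<subseteq> faces S l" for l using G by (auto simp: subclosed_def)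
  have "G j \<noteq> {} \<Longrightarrow> G 0 \<noteq> {}" for j
  proof (induction j)
    case (Suc j)
    then show ?case using G unfolding subclosed_def by blast
  qed
  then show "faces ?R 0 \<noteq> {}" using ne by simp
  have i: "(\<lambda>a\<in>all_faces ?R. a) a = a" if "a \<in> G l" for a l using that all_facesI[of a ?R l] by simp
  have inj: "inj_on (\<lambda>a\<in>all_faces ?R. a) (all_faces ?R)" by (auto simp: inj_on_def)
  show "globularity ?R"
    unfolding globularity_iff
  proof (intro allI ballI)
    fix k a assume a: "a \<in> faces ?R (Suc (Suc k))"
    then show "globular_at ?R a"
      using globular_at_image[OF sub_hypergraph_morphism[OF ph G] inj a] i[of a "Suc (Suc k)"] globular[of a k] GS by auto
  qed
  show "total_on (faces ?R 0) (lt_plus ?R 0)"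
    unfolding total_on_def
  proof (intro ballI impI)
    fix a b assume "a \<in> faces ?R 0" "b \<in> faces ?R 0" "a \<noteq> b"
    then show "(a, b) \<in> lt_plus ?R 0 \<or> (b, a) \<in> lt_plus ?R 0" using tot0[of a b] refl[of a 0 b] refl[of b 0 a] GS[of 0] by auto
  qed
  show "pencil_linearity ?R"
  proof (rule pencil_linearityI)
    fix j i a b x assume ab: "a \<in> faces ?R (Suc j)" "b \<in> faces ?R (Suc j)" and x: "incident i ?R a x" "incident i ?R b x"
    then have ab': "a \<in> G (Suc j)" "b \<in> G (Suc j)" by simp_all
    have "incident i S a x" "incident i S b x"
      using x unfolding incident_def sub_hypergraph_pos[where G = G, OF ab'(1)] sub_hypergraph_pos[where G = G, OF ab'(2)] .
    then show "le_plus ?R (Suc j) a b \<or> (b, a) \<in> lt_plus ?R (Suc j)"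
      using pencil[of a j b i x] ab' GS[of "Suc j"] refl[OF ab'] refl[OF ab'(2,1)] by blast
  qed
qed

text \<open>A step through \<open>gam S u\<close> is replaced by a chain of steps through \<open>del S u\<close>.\<close>

lemma lt_plus_without_gams:
  assumes G: "subclosed S G" and j: "faces S (Suc j) - gams S (faces S (Suc (Suc j))) \<subseteq> G (Suc j)"
    and ab: "(a, b) \<in> lt_plus S j"
  shows "(a, b) \<in> lt_plus (sub_hypergraph S G) j"
proof -
  let ?R = "sub_hypergraph S G"
  have step: "\<And>a. a \<in> del S c \<Longrightarrow> (a, gam S c) \<in> lt_plus ?R j" if "c \<in> faces S (Suc j)" for c
    using that
  proof (induction c rule: wf_induct_rule[OF wf_lt[of "Suc j"]])
    case (1 c)
    show ?case
    proof (cases "c \<in> gams S (faces S (Suc (Suc j)))")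
      case False
      then show ?thesis using j 1 sub_lt_plusI[OF G] by blast
    next
      case True
      then obtain u where u: "u \<in> faces S (Suc (Suc j))" "c = gam S u" by (auto simp: gams_def)
      have IH: "(x, gam S d) \<in> lt_plus ?R j" if "d \<in> del S u" "x \<in> del S d" for d x
        using 1(1)[of d] that delF[OF u(1)] ltI[OF u(1)] u(2) by blast
      \<comment> \<open>Within \<open>del S u\<close> the codomains climb to
        \<open>gam S (gam S u)\<close>, and the induction hypothesis provides each step of the climb
        in the sub-hypergraph.\<close>
      have up: "x = gam S e \<Longrightarrow> e \<in> del S u \<Longrightarrow> le_plus ?R j x (gam S c)" for x e
      proof (induction x arbitrary: e rule: wf_induct_rule[OF wf_gt[of j]])
        case (1 x)
        then consider "x = gam S c" | d where "d \<in> del S u" "x \<in> del S d" using gam_gam(3)[OF u(1)] u(2) by metis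
        then show ?case
        proof cases
          case 2
          have "(x, gam S d) \<in> lt_plus S j" using ltI[OF delF[OF u(1) 2(1)] 2(2)] .
          then have "le_plus ?R j (gam S d) (gam S c)" using 1(1)[of "gam S d" d] 2(1) by blast
          then show ?thesis using IH[OF 2] lt_le_plus by metis
        qed simp
      qed
      obtain d where d: "d \<in> del S u" "a \<in> del S d" using del_gam(1)[OF u(1), of a] 1(2) u(2) by blast
      show ?thesis using IH[OF d] up[OF refl d(1)] lt_le_plus by metis
    qed
  qed
  from ab show ?thesis
    by (induction rule: lt_plus_induct) (use step in \<open>auto intro: lt_plus_trans\<close>)
qed

end

section \<open>Cutting an opetopic cardinal\<close>

text \<open>The faces of dimension greater than \<open>k\<close> are divided into those in \<open>D\<close>, which end up in the
  part \<open>lower\<close>, and the others, which end up in \<open>upper\<close>.\<close>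

locale cut = opetopic_cardinal +
  fixes k :: nat and D :: "nat \<Rightarrow> 'a set"
  assumes DS: "D j \<subseteq> faces S j"
    and Dgam: "k < j \<Longrightarrow> a \<in> faces S (Suc j) \<Longrightarrow> gam S a \<in> D j \<longleftrightarrow> a \<in> D (Suc j)"
    and Ddel: "k < j \<Longrightarrow> a \<in> faces S (Suc j) \<Longrightarrow> b \<in> del S a \<Longrightarrow> b \<in> D j \<longleftrightarrow> a \<in> D (Suc j)"
    and Dfirst: "u \<in> faces S (Suc k) - D (Suc k) \<Longrightarrow> d \<in> D (Suc k) \<Longrightarrow> gam S u \<notin> del S d"
begin

text \<open>In dimension \<open>k\<close> the codomains of faces outside \<open>D\<close> are
  removed: they arise only when the upper part is attached.\<close>

definition lower :: "nat \<Rightarrow> 'a set" where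
  "lower j = (if j < k then faces S j else if j = k then faces S k - gams S (faces S (Suc k) - D (Suc k)) else D j)"

text \<open>Mirrors \<open>cod_part\<close>: the faces consumed by \<open>D\<close> disappear in
  dimension \<open>k\<close>, and those internal to \<open>D\<close> one dimension below. These
  choices aim at \<open>cod_part k\<close> of the lower part being \<open>dom_part k\<close> of the
  upper part.\<close>

definition upper :: "nat \<Rightarrow> 'a set" where
  "upper j = (if Suc j < k then faces S j else if Suc j = k then faces S j - iotas S (D (Suc k))
     else if j = k then faces S k - dels S (D (Suc k)) else faces S j - D j)"

lemma D_lt: "k < j \<Longrightarrow> (a, b) \<in> lt_plus S j \<Longrightarrow> a \<in> D j \<longleftrightarrow> b \<in> D j"
  by (rotate_tac 1, induction rule: lt_plus_induct) (simp_all add: Dgam Ddel)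

text \<open>Faces of one pencil are comparable and \<open>D\<close> is saturated under
  \<open>lt_plus\<close> in dimension \<open>Suc k\<close>, so a pencil lies in \<open>D\<close>
  entirely or not at all.\<close>

lemma D_gam_eq: "u \<in> faces S (Suc k) \<Longrightarrow> d \<in> D (Suc k) \<Longrightarrow> gam S u = gam S d \<Longrightarrow> u \<in> D (Suc k)"
  using pencil_gam[of u k d] D_lt[of "Suc k" u d] D_lt[of "Suc k" d u] DS[of "Suc k"] by blast

lemma D_del_meet: "u \<in> faces S (Suc k) \<Longrightarrow> d \<in> D (Suc k) \<Longrightarrow> x \<in> del S u \<Longrightarrow> x \<in> del S d \<Longrightarrow> u \<in> D (Suc k)"
  using pencil_del[of u k d x] D_lt[of "Suc k" u d] D_lt[of "Suc k" d u] DS[of "Suc k"] by blast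

lemma lower_closed: "subclosed S lower"
  unfolding subclosed_def
proof (intro conjI allI ballI)
  show "lower j \<subseteq> faces S j" for j using DS by (auto simp: lower_def)
  fix j a assume a: "a \<in> lower (Suc j)"
  have aS: "a \<in> faces S (Suc j)" using a DS by (auto simp: lower_def split: if_splits)
  consider "j < k" | "j = k" | "k < j" by linarith
  then have "gam S a \<in> lower j \<and> del S a \<subseteq> lower j"
  proof cases
    case 1
    then show ?thesis using gamF[OF aS] delF[OF aS] by (auto simp: lower_def)
  next
    case 2
    then have aD: "a \<in> D (Suc k)" using a by (simp add: lower_def)
    have "gam S a \<notin> gams S (faces S (Suc k) - D (Suc k))" using D_gam_eq aD by (auto simp: gams_def)
    moreover have "x \<notin> gams S (faces S (Suc k) - D (Suc k))" if "x \<in> del S a" for x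
      using Dfirst aD that by (auto simp: gams_def)
    ultimately show ?thesis using gamF[OF aS] delF[OF aS] 2 by (auto simp: lower_def)
  next
    case 3
    then show ?thesis using a Dgam[OF 3 aS] Ddel[OF 3 aS] by (auto simp: lower_def)
  qed
  then show "gam S a \<in> lower j" "del S a \<subseteq> lower j" by auto
qed

text \<open>For \<open>j < k\<close> the only steps that were removed are codomains and can be
  bypassed. For \<open>j = k\<close> a chain ending in \<open>lower\<close> stays there when
  followed backwards, since every face producing an element of \<open>lower k\<close> lies in
  \<open>D\<close>. Above \<open>k\<close> the set \<open>D\<close> is saturated.\<close>

lemma lower_lt_plus:
  assumes "b \<in> lower j" "(a, b) \<in> lt_plus S j"
  shows "(a, b) \<in> lt_plus (sub_hypergraph S lower) j"
proof -
  consider "j < k" | "j = k" | "k < j" by linarith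
  then show ?thesis
  proof cases
    case 1
    then have "faces S (Suc j) - gams S (faces S (Suc (Suc j))) \<subseteq> lower (Suc j)"
      by (cases "Suc j = k") (auto simp: lower_def gams_def)
    then show ?thesis using lt_plus_without_gams[OF lower_closed _ assms(2)] by blast
  next
    case 2
    have "a \<in> lower k \<and> (a, b) \<in> lt_plus (sub_hypergraph S lower) k" if "(a, b) \<in> lt_plus S k" "b \<in> lower k" for a b
      using that
    proof (induction rule: lt_plus_induct)
      case (step c a)
      then have "c \<in> D (Suc k)" by (auto simp: lower_def gams_def)
      then have "c \<in> lower (Suc k)" by (simp add: lower_def)
      then show ?case using sub_lt_plusI[OF lower_closed _ step(4)] lower_closed step(4) unfolding subclosed_def by blast
    next
      case (trans a b c)
      then show ?case using lt_plus_trans by metis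
    qed
    then show ?thesis using assms 2 by blast
  next
    case 3
    have "b \<in> D j \<longrightarrow> (a, b) \<in> lt_plus (sub_hypergraph S lower) j" if "(a, b) \<in> lt_plus S j" for a b
      using that
    proof (induction rule: lt_plus_induct)
      case (step c a)
      then have "gam S c \<in> D j \<longrightarrow> c \<in> lower (Suc j)" using Dgam[OF 3] 3 by (simp add: lower_def)
      then show ?case using sub_lt_plusI[OF lower_closed _ step(4)] by blast
    next
      case (trans a b c)
      then show ?case using lt_plus_trans D_lt[OF 3] by metis
    qed
    then show ?thesis using assms 3 by (simp add: lower_def)
  qed
qed

lemma lower_opetopic_cardinal: "lower j \<noteq> {} \<Longrightarrow> positive_opetopic_cardinal (sub_hypergraph S lower)"
  by (rule sub_opetopic_cardinal[OF lower_closed]) (auto intro: lower_lt_plus)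

end

context opetopic_cardinal begin

text \<open>This is the lower part of the cut with empty \<open>D\<close>. For \<open>k = 0\<close>
  a vertex survives because a minimal one is not a codomain.\<close>

lemma dom_part_opetopic_cardinal: "positive_opetopic_cardinal (dom_part k S)"
proof -
  interpret cut S k "\<lambda>_. {}" by unfold_locales auto
  have eq: "dom_part k S = sub_hypergraph S lower"
    unfolding dom_part_def by (rule arg_cong[where f = "sub_hypergraph S"]) (auto simp: lower_def fun_eq_iff)
  have "lower 0 \<noteq> {}"
  proof (cases k)
    case 0
    obtain a where "a \<in> faces S 0" using ne0 by blast
    then have "\<exists>b\<in>faces S 0 - gams S (faces S (Suc 0)). True \<and> le_plus S 0 b a"
      by (rule minimal_below) (use ph_del_ne[OF ph] in auto)
    then show ?thesis unfolding lower_def using 0 by auto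
  next
    case (Suc j)
    then show ?thesis unfolding lower_def using ne0 by simp
  qed
  then show ?thesis unfolding eq by (rule lower_opetopic_cardinal)
qed

end

text \<open>The model is \<open>c0 = gam S m\<close> with \<open>D\<close> the region below
  \<open>m\<close>. The last two conditions make the \<open>k\<close>-faces consumed by
  \<open>D\<close> the strict down-set of \<open>c0\<close>, so membership in \<open>upper k\<close>
  becomes a statement about the order.\<close>

locale principal_cut = cut +
  fixes c0
  assumes c0: "c0 \<in> faces S k"
    and Dc0: "d \<in> D (Suc k) \<Longrightarrow> le_plus S k (gam S d) c0"
    and below_c0: "(e, c0) \<in> lt_plus S k \<Longrightarrow> e \<in> dels S (D (Suc k))"
begin

lemma dels_D: "e \<in> dels S (D (Suc k)) \<longleftrightarrow> (e, c0) \<in> lt_plus S k"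
proof
  assume "e \<in> dels S (D (Suc k))"
  then obtain d where d: "d \<in> D (Suc k)" "e \<in> del S d" by (auto simp: dels_def)
  then have "(e, gam S d) \<in> lt_plus S k" using ltI[of d k e] DS[of "Suc k"] by blast
  then show "(e, c0) \<in> lt_plus S k" using Dc0[OF d(1)] by (rule lt_le_plus)
qed (rule below_c0)

lemma upper_k: "upper k = {e \<in> faces S k. (e, c0) \<notin> lt_plus S k}"
  by (auto simp: upper_def dels_D)

lemma iota_below_c0:
  assumes "d \<in> D (Suc k)" "x \<in> iota S d"
  obtains e e' where "(e, c0) \<in> lt_plus S k" "gam S e = x" "(e', c0) \<in> lt_plus S k" "x \<in> del S e'"
proof -
  obtain e e' where "e \<in> del S d" "gam S e = x" "e' \<in> del S d" "x \<in> del S e'"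
    using assms(2) by (auto simp: iota_def gams_def dels_def)
  then show ?thesis using that assms(1) by (auto simp: dels_D[symmetric] dels_def)
qed

text \<open>Let \<open>e\<close> and \<open>e'\<close> below \<open>c0\<close> have \<open>x\<close>
  as codomain and as domain face. If \<open>b\<close> also met \<open>x\<close>, it would share a
  pencil with one of them and lie above it, as \<open>b\<close> is not below \<open>c0\<close>. By
  \<open>above_linear\<close> then \<open>c0\<close> is weakly below \<open>b\<close>, so the other
  one lies below \<open>b\<close> too, and this violates disjointness.\<close>

lemma upper_avoids_iota:
  assumes k: "k = Suc j" and b: "b \<in> upper k" and d: "d \<in> D (Suc k)" and x: "x \<in> iota S d"
  shows "x \<noteq> gam S b" "x \<notin> del S b"
proof -
  have bS: "b \<in> faces S (Suc j)" and bc: "(b, c0) \<notin> lt_plus S (Suc j)" using b[unfolded upper_k] k by auto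
  obtain e e' where e: "(e, c0) \<in> lt_plus S (Suc j)" "gam S e = x" and e': "(e', c0) \<in> lt_plus S (Suc j)" "x \<in> del S e'"
    using iota_below_c0[OF d x] k by metis
  have above: "(f, b) \<in> lt_plus S (Suc j) \<Longrightarrow> (f, c0) \<in> lt_plus S (Suc j) \<Longrightarrow> le_plus S (Suc j) c0 b" for f
    using above_linear[of f b "Suc j" c0] bc by blast
  show "x \<noteq> gam S b"
  proof
    assume xb: "x = gam S b"
    then have "(e, b) \<in> lt_plus S (Suc j)"
      using pencil_gam[of e j b] lt_plus_faces[OF e(1)] bS e bc lt_plus_trans by metis
    then have "(e', b) \<in> lt_plus S (Suc j)" using above e lt_le_plus[OF e'(1)] by blast
    then show False using disj(2) e'(2) xb by blast
  qed
  show "x \<notin> del S b"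
  proof
    assume xb: "x \<in> del S b"
    then have "(e', b) \<in> lt_plus S (Suc j)"
      using pencil_del[of e' j b x] lt_plus_faces[OF e'(1)] bS e' bc lt_plus_trans by metis
    then have "(e, b) \<in> lt_plus S (Suc j)" using above e' lt_le_plus[OF e(1)] by blast
    then show False using disj(1) e(2) xb by blast
  qed
qed

lemma upper_closed: "subclosed S upper"
  unfolding subclosed_def
proof (intro conjI allI ballI)
  show "upper j \<subseteq> faces S j" for j by (auto simp: upper_def)
  fix j a assume a: "a \<in> upper (Suc j)"
  have aS: "a \<in> faces S (Suc j)" using a by (auto simp: upper_def split: if_splits)
  consider "Suc j < k" | "Suc j = k" | "j = k" | "k < j" by linarith
  then have "gam S a \<in> upper j \<and> del S a \<subseteq> upper j"
  proof cases
    case 1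
    then show ?thesis using gamF[OF aS] delF[OF aS] by (auto simp: upper_def)
  next
    case 2
    then show ?thesis
      using gamF[OF aS] delF[OF aS] upper_avoids_iota[of j a] a by (auto simp: upper_def[of j] iotas_def)
  next
    case 3
    then have aD: "a \<notin> D (Suc k)" using a by (simp add: upper_def)
    have "gam S a \<notin> dels S (D (Suc k))" using Dfirst[of a] aS aD 3 by (auto simp: dels_def)
    moreover have "x \<notin> dels S (D (Suc k))" if "x \<in> del S a" for x
      using D_del_meet[of a _ x] aS aD 3 that by (auto simp: dels_def)
    ultimately show ?thesis using gamF[OF aS] delF[OF aS] 3 by (auto simp: upper_def)
  next
    case 4
    then show ?thesis using a Dgam[OF 4 aS] Ddel[OF 4 aS] gamF[OF aS] delF[OF aS] by (auto simp: upper_def)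
  qed
  then show "gam S a \<in> upper j" "del S a \<subseteq> upper j" by auto
qed

text \<open>On the way from \<open>e\<close> up to \<open>c0\<close> through faces of
  \<open>D\<close>, globularity passes on unchanged a codomain that is not internal.\<close>

lemma gam_constant:
  assumes "k = Suc j" "(e, c0) \<in> lt_plus S k" "gam S e \<notin> iotas S (D (Suc k))"
  shows "gam S e = gam S c0"
  using assms(2,3)
proof (induction e rule: wf_induct_rule[OF wf_gt[of k]])
  case (1 e)
  then obtain d where d: "d \<in> D (Suc k)" "e \<in> del S d" using below_c0 by (auto simp: dels_def)
  have dS: "d \<in> faces S (Suc k)" using d DS by blast
  have "gam S e = gam S (gam S d)"
    using gam_gam(3)[of d j e] d dS 1(3) assms(1) by (auto simp: iotas_def iota_def gams_def dels_def)
  then show ?case using Dc0[OF d(1)] 1(1)[of "gam S d"] 1(3) ltI[OF dS d(2)] by auto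
qed

text \<open>
  Follow a \<open><\<^sup>+\<close>-path to \<open>b\<close> backwards.  A face \<open>x\<close> on it is either in \<open>upper\<close> or equal to
  \<open>gam S e\<close> for some \<open>e\<close> below \<open>c0\<close>; in the second case the path can be rerouted through
  \<open>gam S c0\<close>.  This is the invariant \<open>Q\<close>.
\<close>

lemma upper_lt_plus_pred:
  assumes k: "k = Suc j" and a: "a \<in> upper j" and b: "b \<in> upper j" and ab: "(a, b) \<in> lt_plus S j"
  shows "(a, b) \<in> lt_plus (sub_hypergraph S upper) j"
proof -
  let ?R = "sub_hypergraph S upper"
  define Q where "Q x \<longleftrightarrow> x \<in> upper j \<and> le_plus ?R j x b \<or>
     le_plus ?R j (gam S c0) b \<and> (\<exists>e. (e, c0) \<in> lt_plus S k \<and> gam S e = x)" for x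
  have upj: "x \<in> upper j \<longleftrightarrow> x \<in> faces S j \<and> x \<notin> iotas S (D (Suc k))" for x
    unfolding upper_def using k by simp
  have c0up: "c0 \<in> upper (Suc j)" using c0 irr unfolding k[symmetric] upper_k by blast
  \<comment> \<open>Going back through a face below \<open>c0\<close> leads to a domain face of
    \<open>c0\<close>, which is in the upper part, or to the codomain of another face below
    \<open>c0\<close>. These are the two alternatives of \<open>Q\<close>.\<close>
  have under: "Q x" if "x \<in> del S e" "(e, c0) \<in> lt_plus S k" "le_plus ?R j (gam S c0) b" for x e
  proof -
    from del_below[of e c0 j x] that k consider "x \<in> del S c0" | e' where "(e', c0) \<in> lt_plus S k" "gam S e' = x" by blast
    then show ?thesis
    proof cases
      case 1
      then have "x \<in> upper j" "(x, gam S c0) \<in> lt_plus ?R j"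
        using upper_closed c0up sub_lt_plusI[OF upper_closed c0up] unfolding subclosed_def by blast+
      then show ?thesis using that(3) lt_le_plus unfolding Q_def by metis
    qed (use that(3) Q_def in blast)
  qed
  have step: "Q x" if e: "e \<in> faces S (Suc j)" "x \<in> del S e" and Qe: "Q (gam S e)" for x e
  proof -
    have direct: "Q x" if ge: "gam S e \<in> upper j" "le_plus ?R j (gam S e) b"
    proof (cases "e \<in> upper (Suc j)")
      case True
      then have "x \<in> upper j" "(x, gam S e) \<in> lt_plus ?R j"
        using upper_closed e(2) sub_lt_plusI[OF upper_closed True] unfolding subclosed_def by blast+
      then show ?thesis using ge(2) lt_le_plus unfolding Q_def by metis
    next
      case False
      then have ec: "(e, c0) \<in> lt_plus S k" using e(1) upper_k k by auto
      have "gam S e = gam S c0" using gam_constant[OF k ec] ge(1) upj by blast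
      then show ?thesis using under[OF e(2) ec] ge(2) by simp
    qed
    from Qe consider "gam S e \<in> upper j" "le_plus ?R j (gam S e) b"
      | e' where "le_plus ?R j (gam S c0) b" "(e', c0) \<in> lt_plus S k" "gam S e' = gam S e" unfolding Q_def by blast
    then show ?thesis
    proof cases
      case 1
      then show ?thesis by (rule direct)
    next
      case 2
      have e'S: "e' \<in> faces S (Suc j)" using lt_plus_faces[OF 2(2)] k by blast
      have "(e, c0) \<in> lt_plus S k \<or> e = c0 \<or> (c0, e) \<in> lt_plus S k"
        using pencil_gam[OF e(1) e'S 2(3)[symmetric]] 2(2) above_linear[of e' e k c0] lt_plus_trans unfolding k by metis
      then consider "(e, c0) \<in> lt_plus S k" | "le_plus S k c0 e" by blast
      then show ?thesis
      proof cases
        case 1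
        then show ?thesis using under[OF e(2) 1 2(1)] by blast
      next
        case c: 2
        \<comment> \<open>The codomain of \<open>c0\<close> is squeezed between those of
          \<open>e'\<close> and \<open>e\<close>, which coincide.\<close>
        have "le_plus S j (gam S e) (gam S c0)" "le_plus S j (gam S c0) (gam S e)"
          using gam_mono'[of e' c0 j] gam_mono'[of c0 e j] 2 c k by auto
        then have "gam S e = gam S c0" using irr lt_plus_trans by metis
        moreover have "gam S c0 \<in> upper j" using upper_closed c0up unfolding subclosed_def by blast
        ultimately show ?thesis using direct 2(1) by simp
      qed
    qed
  qed
  have "Q y \<longrightarrow> Q x" if "(x, y) \<in> lt_plus S j" for x y
    using that by (induction rule: lt_plus_induct) (use step in auto)
  moreover have "Q b" using b by (simp add: Q_def)
  ultimately have "Q a" using ab by blast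
  \<comment> \<open>In the second alternative of \<open>Q\<close>, \<open>a\<close> is the codomain
    of a face below \<open>c0\<close> and not internal, so it equals
    \<open>gam S c0\<close>.\<close>
  then have "le_plus ?R j a b"
    unfolding Q_def using gam_constant[OF k] a upj by metis
  then show ?thesis using ab irr by blast
qed

text \<open>Dual to \<open>lower_lt_plus\<close> except in the dimension just below
  \<open>k\<close>, where the removed steps need not be codomains; that case is
  \<open>upper_lt_plus_pred\<close>. For \<open>j = k\<close> a chain that starts in
  \<open>upper\<close> stays there.\<close>

lemma upper_lt_plus:
  assumes a: "a \<in> upper j" and b: "b \<in> upper j" and ab: "(a, b) \<in> lt_plus S j"
  shows "(a, b) \<in> lt_plus (sub_hypergraph S upper) j"
proof -
  consider "Suc j < k" | "k = Suc j" | "j = k" | "k < j" by linarith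
  then show ?thesis
  proof cases
    case 1
    have "x \<in> gams S (faces S (Suc (Suc j)))" if "d \<in> D (Suc k)" "Suc (Suc j) = k" "x \<in> iota S d" for x d
      using that DS[of "Suc k"] delF[of d k] by (auto simp: iota_def gams_def)
    then have "faces S (Suc j) - gams S (faces S (Suc (Suc j))) \<subseteq> upper (Suc j)"
      using 1 by (cases "Suc (Suc j) = k") (auto simp: upper_def iotas_def)
    then show ?thesis using lt_plus_without_gams[OF upper_closed _ ab] by blast
  next
    case 2
    then show ?thesis using upper_lt_plus_pred a b ab by blast
  next
    case 3
    have "x \<in> upper k \<longrightarrow> y \<in> upper k \<and> (x, y) \<in> lt_plus (sub_hypergraph S upper) k" if "(x, y) \<in> lt_plus S k" for x y
      using that
    proof (induction rule: lt_plus_induct)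
      case (step c x)
      have "c \<in> upper (Suc k)" if "x \<in> upper k" using that step(1,4) by (auto simp: upper_def dels_def)
      then show ?case using sub_lt_plusI[OF upper_closed _ step(4)] upper_closed unfolding subclosed_def by blast
    next
      case (trans x y z)
      then show ?case using lt_plus_trans by metis
    qed
    then show ?thesis using a ab 3 by blast
  next
    case 4
    have "x \<notin> D j \<longrightarrow> (x, y) \<in> lt_plus (sub_hypergraph S upper) j" if "(x, y) \<in> lt_plus S j" for x y
      using that
    proof (induction rule: lt_plus_induct)
      case (step c x)
      then have "x \<notin> D j \<longrightarrow> c \<in> upper (Suc j)" using Ddel[OF 4] 4 by (simp add: upper_def)
      then show ?case using sub_lt_plusI[OF upper_closed _ step(4)] by blast
    next
      case (trans x y z)
      then show ?case using lt_plus_trans D_lt[OF 4] by metis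
    qed
    then show ?thesis using a ab 4 by (simp add: upper_def)
  qed
qed

abbreviation "Lo \<equiv> sub_hypergraph S lower"
abbreviation "Up \<equiv> sub_hypergraph S upper"

lemma upper_opetopic_cardinal: "positive_opetopic_cardinal Up"
proof (rule sub_opetopic_cardinal[OF upper_closed])
  show "upper k \<noteq> {}" using c0 irr unfolding upper_k by blast
qed (rule upper_lt_plus)

text \<open>This guarantees that no \<open>k\<close>-face is removed from both parts.\<close>

lemma gamU_delD: "gams S (faces S (Suc k) - D (Suc k)) \<inter> dels S (D (Suc k)) = {}"
  using Dfirst by (auto simp: gams_def dels_def)

text \<open>The equality is one of records, dummy values included. Both sides are therefore written
  as \<open>sub_hypergraph\<close> with the same face family \<open>G\<close>, and on
  \<open>G\<close> the two parts inherit \<open>gam\<close> and \<open>del\<close> from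
  \<open>S\<close>.\<close>

lemma cod_part_eq_dom_part: "cod_part k Lo = dom_part k Up"
proof -
  have pos: "gam Lo a = gam S a \<and> del Lo a = del S a" if "a \<in> lower (Suc l)" for a l
    using sub_hypergraph_pos[where G = lower, OF that] by blast
  have pos': "gam Up a = gam S a \<and> del Up a = del S a" if "a \<in> upper (Suc l)" for a l
    using sub_hypergraph_pos[where G = upper, OF that] by blast
  have lowD: "lower (Suc k) = D (Suc k)" by (simp add: lower_def)
  have upU: "upper (Suc k) = faces S (Suc k) - D (Suc k)" by (simp add: upper_def)
  have dL: "dels Lo (faces Lo (Suc k)) = dels S (D (Suc k))"
    using pos[of _ k] by (auto simp: dels_def lowD)
  have gU: "gams Up (faces Up (Suc k)) = gams S (faces S (Suc k) - D (Suc k))"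
    using pos'[of _ k] by (auto simp: gams_def upU)
  have iL: "iotas Lo (faces Lo (Suc k)) = iotas S (D (Suc k))" if k: "k = Suc j" for j
  proof -
    have "iota Lo d = iota S d" if d: "d \<in> D (Suc k)" for d
    proof -
      have dl: "d \<in> lower (Suc k)" using d lowD by simp
      have "e \<in> lower (Suc j)" if "e \<in> del S d" for e using lower_closed dl that k unfolding subclosed_def by blast
      then have "gam Lo e = gam S e" "del Lo e = del S e" if "e \<in> del S d" for e using pos that by blast+
      then show ?thesis using pos[OF dl] by (auto simp: iota_def dels_def gams_def)
    qed
    then show ?thesis by (simp add: iotas_def lowD)
  qed
  define G where "G l = (if l < k then upper l else if l = k then upper k - gams S (faces S (Suc k) - D (Suc k)) else {})" for l
  have dG: "dom_part k Up = sub_hypergraph Up G"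
    unfolding dom_part_def gU by (rule arg_cong[where f = "sub_hypergraph Up"]) (rule ext, simp add: G_def)
  have "(\<lambda>l. if Suc l < k then faces Lo l else if Suc l = k then faces Lo l - iotas Lo (faces Lo (Suc k))
     else if l = k then faces Lo k - dels Lo (faces Lo (Suc k)) else {}) = G"
  proof
    fix l
    consider "Suc l < k" | "Suc l = k" | "l = k" | "k < l" by linarith
    then show "(if Suc l < k then faces Lo l else if Suc l = k then faces Lo l - iotas Lo (faces Lo (Suc k))
     else if l = k then faces Lo k - dels Lo (faces Lo (Suc k)) else {}) = G l"
    proof cases
      case 1
      then show ?thesis by (simp add: G_def lower_def upper_def)
    next
      case 2
      then show ?thesis using iL[of l] by (simp add: G_def lower_def[of l] upper_def)
    next
      case 3
      then show ?thesis unfolding dL by (auto simp: G_def lower_def[of k] upper_def)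
    qed (simp add: G_def)
  qed
  then have cG: "cod_part k Lo = sub_hypergraph Lo G" unfolding cod_part_def by (rule arg_cong)
  have "gam Lo a = gam S a \<and> del Lo a = del S a \<and> gam Up a = gam S a \<and> del Up a = del S a" if "a \<in> G (Suc l)" for a l
  proof -
    have "a \<in> upper (Suc l)" "a \<in> lower (Suc l)" using that by (auto simp: G_def lower_def upper_def split: if_splits)
    then show ?thesis using pos pos' by blast
  qed
  then have "sub_hypergraph Lo G = sub_hypergraph Up G"
    unfolding sub_hypergraph_def[of _ G] by (auto simp: fun_eq_iff)
  then show ?thesis using cG dG by simp
qed

lemma cut_glue: "glue (dom_part k Up) Up Lo S (\<lambda>a\<in>all_faces Up. a) (\<lambda>a\<in>all_faces Lo. a)"
  unfolding glue_def
proof (intro conjI allI ballI impI)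
  show "hypergraph_morphism Up S (\<lambda>a\<in>all_faces Up. a)" "hypergraph_morphism Lo S (\<lambda>a\<in>all_faces Lo. a)"
    using sub_hypergraph_morphism[OF ph upper_closed] sub_hypergraph_morphism[OF ph lower_closed] by auto
  show "inj_on (\<lambda>a\<in>all_faces Up. a) (all_faces Up)" "inj_on (\<lambda>a\<in>all_faces Lo. a) (all_faces Lo)"
    by (auto simp: inj_on_def)
  have all: "x \<in> all_faces Up \<longleftrightarrow> (\<exists>l. x \<in> upper l)" "x \<in> all_faces Lo \<longleftrightarrow> (\<exists>l. x \<in> lower l)" for x
    by (auto simp: all_faces_def)
  have sub: "upper l \<subseteq> faces S l" "lower l \<subseteq> faces S l" for l
    using upper_closed lower_closed by (auto simp: subclosed_def)
  have pos': "gam Up a = gam S a \<and> del Up a = del S a" if "a \<in> upper (Suc l)" for a l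
    using sub_hypergraph_pos[where G = upper, OF that] by blast
  have upU: "upper (Suc k) = faces S (Suc k) - D (Suc k)" by (simp add: upper_def)
  have gU: "gams Up (faces Up (Suc k)) = gams S (faces S (Suc k) - D (Suc k))"
    using pos'[of _ k] by (auto simp: gams_def upU)
  have R: "faces (dom_part k Up) l = upper l \<inter> lower l" for l
    unfolding faces_dom_part gU using iotas_def by (auto simp: upper_def lower_def)
  show "faces S l = (\<lambda>a\<in>all_faces Up. a) ` faces Up l \<union> (\<lambda>a\<in>all_faces Lo. a) ` faces Lo l" for l
  proof -
    have "(\<lambda>a\<in>all_faces Up. a) ` faces Up l = upper l" "(\<lambda>a\<in>all_faces Lo. a) ` faces Lo l = lower l"
      using all by (auto simp: image_iff)
    moreover have "faces S l = upper l \<union> lower l"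
      using gamU_delD DS[of l] by (auto simp: upper_def lower_def split: if_splits)
    ultimately show ?thesis by simp
  qed
  show "(\<lambda>a\<in>all_faces Up. a) a = (\<lambda>a\<in>all_faces Lo. a) a" if "a \<in> all_faces (dom_part k Up)" for a
    using that R all unfolding all_faces_def[of "dom_part k Up"] by auto
  fix a b assume ab: "a \<in> all_faces Up" "b \<in> all_faces Lo" "(\<lambda>a\<in>all_faces Up. a) a = (\<lambda>a\<in>all_faces Lo. a) b"
  then show "a = b" by simp
  obtain l l' where l: "a \<in> upper l" "a \<in> lower l'" using ab all by auto
  then have "l = l'" using sub ph_dim[OF ph, of a l l'] by blast
  then show "a \<in> all_faces (dom_part k Up)" using l R all_facesI[of a "dom_part k Up" l] by simp
qed

end


section \<open>Decomposition of opetopic cardinals that are not opetopes\<close>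

context opetopic_cardinal begin

lemma faces_nonempty_iff: "faces S l \<noteq> {} \<longleftrightarrow> l \<le> hdim S"
proof -
  let ?K = "{k. faces S k \<noteq> {}}"
  have fin: "finite ?K" by (rule ph_finite_dims[OF ph])
  have "0 \<in> ?K" using ne0 by simp
  then have top: "hdim S \<in> ?K" unfolding hdim_def using Max_in[OF fin] by blast
  have down: "faces S (l + i) \<noteq> {} \<Longrightarrow> faces S l \<noteq> {}" for i l
  proof (induction i)
    case (Suc i)
    then show ?case using gamF[of _ "l + i"] by auto
  qed simp
  show ?thesis
  proof
    assume "faces S l \<noteq> {}"
    then show "l \<le> hdim S" unfolding hdim_def by (intro Max_ge[OF fin]) simp
  next
    assume "l \<le> hdim S"
    then obtain i where "hdim S = l + i" using le_Suc_ex by blast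
    then show "faces S l \<noteq> {}" using top down[of l i] by simp
  qed
qed

lemma top_faces_nonempty: "l \<le> hdim S \<Longrightarrow> faces S l - dels S (faces S (Suc l)) \<noteq> {}"
proof -
  assume "l \<le> hdim S"
  then obtain a where a: "a \<in> faces S l" using faces_nonempty_iff by blast
  have "\<exists>b\<in>faces S l - dels S (faces S (Suc l)). True \<and> le_plus S l a b"
    by (rule maximal_above[OF a]) simp_all
  then show ?thesis by blast
qed

text \<open>Every dimension up to \<open>hdim S\<close> has a maximal face, so failure of the
  opetope condition means two of them. Vertices are linearly ordered, so this happens in positive
  dimension, written \<open>Suc k\<close>.\<close>

lemma not_opetope_two_tops:
  assumes "\<not> positive_opetope S"
  shows "\<exists>k m m'. m \<in> faces S (Suc k) - dels S (faces S (Suc (Suc k))) \<and>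
     m' \<in> faces S (Suc k) - dels S (faces S (Suc (Suc k))) \<and> m \<noteq> m'"
proof -
  obtain l where l: "l \<le> hdim S" "card (faces S l - dels S (faces S (Suc l))) \<noteq> 1"
    using assms poc by (auto simp: positive_opetope_def)
  obtain m where m: "m \<in> faces S l - dels S (faces S (Suc l))" using top_faces_nonempty[OF l(1)] by blast
  have "faces S l - dels S (faces S (Suc l)) \<noteq> {m}" using l(2) by (metis is_singletonI is_singleton_altdef)
  then obtain m' where m': "m' \<in> faces S l - dels S (faces S (Suc l))" "m \<noteq> m'" using m by blast
  show ?thesis
  proof (cases l)
    case 0
    then have "(m, m') \<in> lt_plus S 0 \<or> (m', m) \<in> lt_plus S 0" using tot0[of m m'] m m' by auto
    then show ?thesis using lt_imp_dels m m' 0 by blast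
  next
    case (Suc k)
    then show ?thesis using m m' by blast
  qed
qed

text \<open>\<open>D\<close> consists of the faces whose iterated codomain in dimension
  \<open>Suc k\<close> lies weakly below \<open>m\<close>. Maximality of \<open>m\<close> makes
  \<open>D\<close> saturated, and \<open>min\<close> yields the condition \<open>Dfirst\<close> of a
  cut.\<close>

lemma principal_cut_exists:
  assumes m: "m \<in> faces S (Suc k) - dels S (faces S (Suc (Suc k)))"
    and min: "\<And>m'. m' \<in> faces S (Suc k) - dels S (faces S (Suc (Suc k))) \<Longrightarrow> (gam S m', gam S m) \<notin> lt_plus S k"
    and D_def: "D = (\<lambda>j. {a \<in> faces S j. k < j \<and> le_plus S (Suc k) ((gam S ^^ (j - Suc k)) a) m})"
  shows "principal_cut S k D (gam S m)"
proof -
  have mS: "m \<in> faces S (Suc k)" and top: "(m, a) \<notin> lt_plus S (Suc k)" for a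
    using m lt_imp_dels by auto
  have D1: "w \<in> D (Suc k) \<longleftrightarrow> w \<in> faces S (Suc k) \<and> le_plus S (Suc k) w m" for w by (simp add: D_def)
  have Dg: "gam S a \<in> D j \<longleftrightarrow> a \<in> D (Suc j)" if "k < j" "a \<in> faces S (Suc j)" for j a
  proof -
    have "\<exists>i. j = Suc (k + i)" using less_imp_Suc_add[OF that(1)] .
    then obtain i where "j = Suc (k + i)" ..
    then have "(gam S ^^ (Suc j - Suc k)) a = (gam S ^^ (j - Suc k)) (gam S a)"
      by (simp add: Suc_diff_le funpow_Suc_right del: funpow.simps)
    then show ?thesis using that gamF[OF that(2)] by (auto simp: D_def)
  qed
  have Dlt: "a \<in> D j \<longleftrightarrow> b \<in> D j"
    if j: "k < j" and Ddel: "\<And>a b. a \<in> faces S (Suc j) \<Longrightarrow> b \<in> del S a \<Longrightarrow> b \<in> D j \<longleftrightarrow> a \<in> D (Suc j)" and ab: "(a, b) \<in> lt_plus S j"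
    for j a b
    using ab by (induction rule: lt_plus_induct) (simp_all add: Dg[OF j] Ddel)
  have Ddel: "b \<in> D j \<longleftrightarrow> a \<in> D (Suc j)" if "k < j" "a \<in> faces S (Suc j)" "b \<in> del S a" for j a b
    using that
  proof (induction j arbitrary: a b rule: less_induct)
    case (less j)
    have bS: "b \<in> faces S j" using delF[OF less(3,4)] .
    have bg: "(b, gam S a) \<in> lt_plus S j" using ltI[OF less(3,4)] .
    \<comment> \<open>In the lowest dimension, if \<open>b\<close> is below \<open>m\<close>, then
      \<open>gam S a\<close> and \<open>m\<close> both lie above \<open>b\<close>, hence are
      comparable, and \<open>m\<close> is maximal. In higher dimensions \<open>gam_mono\<close>
      moves the question to the codomains, one dimension down.\<close>
    have "b \<in> D j \<longleftrightarrow> gam S a \<in> D j"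
    proof (cases "j = Suc k")
      case True
      have gS: "gam S a \<in> faces S (Suc k)" using gamF[OF less(3)] True by simp
      show ?thesis
      proof
        assume "b \<in> D j"
        then have "le_plus S (Suc k) b m" using D1 True by simp
        moreover have "b \<noteq> m" using bg top True by auto
        ultimately have "le_plus S (Suc k) (gam S a) m"
          using above_linear[of b "gam S a" "Suc k" m] bg top True by auto
        then show "gam S a \<in> D j" using D1 gS True by simp
      next
        assume "gam S a \<in> D j"
        then have "le_plus S (Suc k) (gam S a) m" using D1 True by simp
        then show "b \<in> D j" using D1 True bS bg lt_le_plus by metis
      qed
    next
      case False
      then obtain i where i: "j = Suc i" "k < i" using less(2) by (cases j) auto
      have IH: "\<And>a b. a \<in> faces S (Suc i) \<Longrightarrow> b \<in> del S a \<Longrightarrow> b \<in> D i \<longleftrightarrow> a \<in> D (Suc i)"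
        using less(1)[of i] i by blast
      have "le_plus S i (gam S b) (gam S (gam S a))" using gam_mono[of b "gam S a" i] bg i by simp
      then have "gam S b \<in> D i \<longleftrightarrow> gam S (gam S a) \<in> D i" using Dlt[OF i(2) IH] by metis
      then show ?thesis using Dg[OF i(2), of b] Dg[OF i(2), of "gam S a"] bS gamF[OF less(3)] i by simp
    qed
    then show ?case using Dg[OF less(2,3)] by simp
  qed
  have Dlt1: "a \<in> D (Suc k) \<longleftrightarrow> b \<in> D (Suc k)" if "(a, b) \<in> lt_plus S (Suc k)" for a b
    using Dlt[of "Suc k" a b] Ddel that by blast
  \<comment> \<open>Suppose \<open>gam S u\<close> is consumed by \<open>d\<close>. A maximal face
    \<open>m1\<close> above \<open>u\<close> is outside \<open>D\<close> and has the same codomain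
    as \<open>u\<close>; otherwise a face below \<open>m1\<close> would share a pencil with
    \<open>d\<close> and pull \<open>m1\<close> into \<open>D\<close>. Then \<open>gam S m1\<close>
    lies strictly below \<open>gam S m\<close>, against \<open>min\<close>.\<close>
  have first: "gam S u \<notin> del S d" if u: "u \<in> faces S (Suc k) - D (Suc k)" and d: "d \<in> D (Suc k)" for u d
  proof
    assume ud: "gam S u \<in> del S d"
    have dS: "d \<in> faces S (Suc k)" "le_plus S (Suc k) d m" using d D1 by auto
    have uS: "u \<in> faces S (Suc k)" using u by blast
    have "\<exists>b\<in>faces S (Suc k) - dels S (faces S (Suc (Suc k))). True \<and> le_plus S (Suc k) u b"
      by (rule maximal_above[OF uS]) simp_all
    then obtain m1 where m1: "m1 \<in> faces S (Suc k) - dels S (faces S (Suc (Suc k)))" "le_plus S (Suc k) u m1" by blast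
    have m1D: "m1 \<notin> D (Suc k)" using u m1(2) Dlt1[of u m1] by blast
    have "gam S u = gam S m1"
    proof (rule ccontr)
      assume "gam S u \<noteq> gam S m1"
      then obtain u' where u': "(u', m1) \<in> lt_plus S (Suc k)" "gam S u \<in> del S u'" using m1(2) gam_below[of u m1 k] by blast
      have "le_plus S (Suc k) u' d \<or> (d, u') \<in> lt_plus S (Suc k)"
        using pencil_del[of u' k d] lt_plus_faces[OF u'(1)] dS(1) u'(2) ud by blast
      then have "u' \<in> D (Suc k)" using d Dlt1[of u' d] Dlt1[of d u'] by blast
      then show False using Dlt1[OF u'(1)] m1D by blast
    qed
    then have "(gam S m1, gam S d) \<in> lt_plus S k" using ltI[OF dS(1) ud] by simp
    then have "(gam S m1, gam S m) \<in> lt_plus S k" using gam_mono'[OF dS(2)] by (rule lt_le_plus)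
    then show False using min[OF m1(1)] by blast
  qed
  \<comment> \<open>If all faces with codomain \<open>c\<close> are in \<open>D\<close>, then by
    \<open>first\<close> so are all faces whose codomain is consumed by one of these. Descending
    from \<open>c\<close> thus shows that everything strictly below \<open>c\<close> is consumed by
    \<open>D\<close>.\<close>
  have pre: "e \<in> dels S (D (Suc k))"
    if c: "c \<in> faces S k" "\<And>w. w \<in> faces S (Suc k) \<Longrightarrow> gam S w = c \<Longrightarrow> w \<in> D (Suc k)" and ec: "(e, c) \<in> lt_plus S k" for e c
    using c(2) ec
  proof (induction c rule: wf_induct_rule[OF wf_lt[of k]])
    case (1 c)
    obtain w x where w: "w \<in> faces S (Suc k)" "gam S w = c" "x \<in> del S w" "x \<in> faces S k" "le_plus S k e x"
      using 1(3) by (rule lt_plus_last)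
    have wD: "w \<in> D (Suc k)" using 1(2)[OF w(1,2)] .
    have "v \<in> D (Suc k)" if "v \<in> faces S (Suc k)" "gam S v = x" for v
      using first[of v w] that wD w(3) by blast
    moreover have "(x, c) \<in> lt_plus S k" using ltI[OF w(1,3)] w(2) by simp
    moreover have "x \<in> dels S (D (Suc k))" using wD w(3) by (auto simp: dels_def)
    ultimately show ?case using 1(1)[of x] w(5) by blast
  qed
  show ?thesis
  proof unfold_locales
    show "D j \<subseteq> faces S j" for j by (auto simp: D_def)
    show "gam S m \<in> faces S k" by (rule gamF[OF mS])
    show "le_plus S k (gam S d) (gam S m)" if "d \<in> D (Suc k)" for d using gam_mono'[of d m k] that D1 by blast
    fix e assume e: "(e, gam S m) \<in> lt_plus S k"
    show "e \<in> dels S (D (Suc k))"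
    proof (rule pre[OF gamF[OF mS] _ e])
      fix w assume w: "w \<in> faces S (Suc k)" "gam S w = gam S m"
      then show "w \<in> D (Suc k)" using pencil_gam[OF w(1) mS w(2)] top D1 by blast
    qed
  qed (use Dg Ddel first in auto)
qed

text \<open>The cut is proper on both sides: \<open>m\<close> is absent from the upper part, and a
  second maximal face \<open>m'\<close>, which cannot lie below \<open>m\<close>, is absent from the
  lower part. The strict inclusions are what the later induction runs on.\<close>

lemma decomposition_exists:
  assumes "\<not> positive_opetope S"
  shows "\<exists>k T L. positive_opetopic_cardinal T \<and> positive_opetopic_cardinal L \<and> cod_part k L = dom_part k T \<and>
    glue (dom_part k T) T L S (\<lambda>a\<in>all_faces T. a) (\<lambda>a\<in>all_faces L. a) \<and>
    all_faces T \<subset> all_faces S \<and> all_faces L \<subset> all_faces S"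
proof -
  obtain k where "\<exists>m m'. m \<in> faces S (Suc k) - dels S (faces S (Suc (Suc k))) \<and>
     m' \<in> faces S (Suc k) - dels S (faces S (Suc (Suc k))) \<and> m \<noteq> m'"
    using not_opetope_two_tops[OF assms] by blast
  then obtain m0 m1 where m01: "m0 \<in> faces S (Suc k) - dels S (faces S (Suc (Suc k)))"
     "m1 \<in> faces S (Suc k) - dels S (faces S (Suc (Suc k)))" "m0 \<noteq> m1" by blast
  let ?M = "faces S (Suc k) - dels S (faces S (Suc (Suc k)))"
  have "gam S m0 \<in> gam S ` ?M" using m01 by blast
  from wfE_min[OF wf_lt[of k] this] obtain z where z: "z \<in> gam S ` ?M" "\<And>y. (y, z) \<in> lt_plus S k \<Longrightarrow> y \<notin> gam S ` ?M" by blast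
  obtain m where m: "m \<in> ?M" "z = gam S m" using z(1) by blast
  define D where "D = (\<lambda>j. {a \<in> faces S j. k < j \<and> le_plus S (Suc k) ((gam S ^^ (j - Suc k)) a) m})"
  have "(gam S m', gam S m) \<notin> lt_plus S k" if "m' \<in> ?M" for m' using z(2) m that by blast
  then interpret principal_cut S k D "gam S m" using principal_cut_exists[OF m(1) _ D_def] by blast
  obtain m' where m': "m' \<in> ?M" "m' \<noteq> m" using m01 by metis
  have mD: "m \<in> D (Suc k)" using m by (simp add: D_def)
  have m'D: "m' \<notin> D (Suc k)" using m' lt_imp_dels by (auto simp: D_def)
  have sub: "upper l \<subseteq> faces S l" "lower l \<subseteq> faces S l" for l
    using upper_closed lower_closed by (auto simp: subclosed_def)
  have lowD: "lower (Suc k) = D (Suc k)" and upU: "upper (Suc k) = faces S (Suc k) - D (Suc k)"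
    by (simp_all add: lower_def upper_def)
  have "lower (Suc k) \<noteq> {}" using mD lowD by blast
  then have L: "positive_opetopic_cardinal Lo" by (rule lower_opetopic_cardinal)
  have all: "x \<in> all_faces Up \<longleftrightarrow> (\<exists>l. x \<in> upper l)" "x \<in> all_faces Lo \<longleftrightarrow> (\<exists>l. x \<in> lower l)" for x
    by (auto simp: all_faces_def)
  have mS: "m \<in> faces S (Suc k)" and m'S: "m' \<in> faces S (Suc k)" using m m' by auto
  have "m \<notin> all_faces Up"
  proof
    assume "m \<in> all_faces Up"
    then obtain l where l: "m \<in> upper l" using all by blast
    then have "l = Suc k" using sub ph_dim[OF ph mS, of l] by blast
    then show False using l upU mD by blast
  qed
  moreover have "m' \<notin> all_faces Lo"
  proof
    assume "m' \<in> all_faces Lo"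
    then obtain l where l: "m' \<in> lower l" using all by blast
    then have "l = Suc k" using sub ph_dim[OF ph m'S, of l] by blast
    then show False using l lowD m'D by blast
  qed
  moreover have "all_faces Up \<subseteq> all_faces S" "all_faces Lo \<subseteq> all_faces S"
    using sub unfolding all_faces_def by (simp_all add: UN_mono)
  moreover have "m \<in> all_faces S" "m' \<in> all_faces S" using mS m'S by (auto intro: all_facesI)
  ultimately have "all_faces Up \<subset> all_faces S" "all_faces Lo \<subset> all_faces S" by blast+
  then show ?thesis using upper_opetopic_cardinal L cod_part_eq_dom_part cut_glue by blast
qed

end

section \<open>Maps out of opetopes\<close>

text \<open>The unique maximal \<open>l\<close>-face is a codomain: it lies weakly above
  \<open>gam Q c\<close> for a face \<open>c\<close> of dimension \<open>Suc l\<close>, which exists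
  because \<open>l < hdim Q\<close>. A face \<open>b\<close> touching nothing in that dimension
  would be a second maximal one.\<close>

lemma opetope_face:
  assumes Q: "positive_opetope Q" and l: "l < hdim Q" and b: "b \<in> faces Q l"
  shows "\<exists>c\<in>faces Q (Suc l). b = gam Q c \<or> b \<in> del Q c"
proof (rule ccontr)
  assume neg: "\<not> ?thesis"
  interpret opetopic_cardinal Q using Q by unfold_locales (simp add: positive_opetope_def)
  have card: "card (faces Q l - dels Q (faces Q (Suc l))) = 1" using Q l by (auto simp: positive_opetope_def)
  obtain c where c: "c \<in> faces Q (Suc l)" using faces_nonempty_iff[of "Suc l"] l by auto
  have "\<exists>x\<in>faces Q l - dels Q (faces Q (Suc l)). True \<and> le_plus Q l (gam Q c) x"
    by (rule maximal_above[OF gamF[OF c]]) simp_all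
  then obtain x where x: "x \<in> faces Q l - dels Q (faces Q (Suc l))" "le_plus Q l (gam Q c) x" by blast
  have "x \<in> gams Q (faces Q (Suc l))" using x(2) lt_imp_gams c by (auto simp: gams_def)
  then have "x \<noteq> b" using neg by (auto simp: gams_def)
  moreover have "b \<in> faces Q l - dels Q (faces Q (Suc l))" using b neg by (auto simp: dels_def)
  ultimately show False using card x(1) by (metis is_singleton_altdef is_singletonE singletonD)
qed

lemma opetope_top:
  assumes Q: "positive_opetope Q" shows "\<exists>m. faces Q (hdim Q) = {m}"
proof -
  interpret opetopic_cardinal Q using Q by unfold_locales (simp add: positive_opetope_def)
  have "faces Q (Suc (hdim Q)) = {}" using faces_nonempty_iff[of "Suc (hdim Q)"] by auto
  then have "card (faces Q (hdim Q)) = 1" using Q by (auto simp: positive_opetope_def dels_def)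
  then show ?thesis by (metis is_singleton_altdef is_singletonE)
qed

text \<open>The inclusion descends from the top: by \<open>opetope_face\<close> every face is
  reached by \<open>gam\<close> or \<open>del\<close> from the next dimension, and both morphisms
  respect these.\<close>

lemma opetope_image:
  assumes Q: "positive_opetope Q" and f: "hypergraph_morphism Q P f" and g: "hypergraph_morphism T P g"
    and T: "positive_hypergraph T" and top: "f ` faces Q (hdim Q) \<subseteq> g ` faces T (hdim Q)"
  shows "f ` faces Q l \<subseteq> g ` faces T l"
proof (cases "l \<le> hdim Q")
  case False
  interpret opetopic_cardinal Q using Q by unfold_locales (simp add: positive_opetope_def)
  show ?thesis using False faces_nonempty_iff[of l] by auto
next
  case True
  then show ?thesis
  proof (induction l rule: inc_induct)
    case base
    then show ?case by (rule top)
  next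
    case (step l)
    have phQ: "positive_hypergraph Q" using Q by (simp add: positive_opetope_def positive_opetopic_cardinal_def)
    show ?case
    proof (rule image_subsetI)
      fix b assume b: "b \<in> faces Q l"
      obtain c where c: "c \<in> faces Q (Suc l)" "b = gam Q c \<or> b \<in> del Q c" using opetope_face[OF Q step(2) b] by blast
      obtain d where d: "d \<in> faces T (Suc l)" "f c = g d" using step(3) c(1) by blast
      from c(2) show "f b \<in> g ` faces T l"
      proof
        assume "b = gam Q c"
        then have "f b = gam P (g d)" using hm_gam[OF f c(1)] d(2) by simp
        also have "\<dots> = g (gam T d)" by (simp add: hm_gam[OF g d(1)])
        finally have "f b = g (gam T d)" .
        moreover have "gam T d \<in> faces T l" using ph_gam[OF T d(1)] .
        ultimately show ?thesis by blast
      next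
        assume "b \<in> del Q c"
        then have "f b \<in> del P (g d)" using hm_del[OF f c(1)] d(2) by auto
        then obtain y where "y \<in> del T d" "f b = g y" unfolding hm_del[OF g d(1)] by blast
        moreover have "z \<in> faces T l" if "z \<in> del T d" for z using ph_del[OF T d(1) that] .
        ultimately show ?thesis by blast
      qed
    qed
  qed
qed

text \<open>The factor is \<open>f\<close> followed by the inverse of \<open>g\<close> on its image.
  It is bijective on domains because the injective \<open>g\<close> can be cancelled from the
  bijection induced by \<open>f\<close>.\<close>

lemma factor_through_mono:
  assumes Q: "positive_hypergraph Q" and T: "positive_hypergraph T"
    and f: "hypergraph_morphism Q P f" and g: "hypergraph_morphism T P g" and inj: "inj_on g (all_faces T)"
    and im: "\<And>l. f ` faces Q l \<subseteq> g ` faces T l"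
  shows "\<exists>h. hypergraph_morphism Q T h \<and> (\<forall>a\<in>all_faces Q. g (h a) = f a)"
proof -
  define h where "h = (\<lambda>a\<in>all_faces Q. inv_into (all_faces T) g (f a))"
  have h: "h a \<in> faces T l \<and> g (h a) = f a" if a: "a \<in> faces Q l" for a l
  proof -
    obtain t where t: "t \<in> faces T l" "f a = g t" using im a by blast
    then have "h a = t" using inj all_facesI[OF a] all_facesI[OF t(1)] by (simp add: h_def)
    then show ?thesis using t by simp
  qed
  have "hypergraph_morphism Q T h"
    unfolding hypergraph_morphism_def
  proof (intro conjI allI ballI)
    show "h \<in> extensional (all_faces Q)" by (simp add: h_def)
    show "h ` faces Q k \<subseteq> faces T k" for k using h by blast
    fix a assume "a \<in> pos_faces Q"
    then obtain l where a: "a \<in> faces Q (Suc l)" by (rule pos_facesE)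
    note ha = h[OF a]
    have gt: "gam T (h a) \<in> faces T l" using ph_gam[OF T] ha by blast
    have "g (h (gam Q a)) = g (gam T (h a))"
      using h[OF ph_gam[OF Q a]] hm_gam[OF f a] hm_gam[OF g, of "h a" l] ha by simp
    then show "h (gam Q a) = gam T (h a)"
      using inj_onD[OF inj] h[OF ph_gam[OF Q a]] gt all_facesI by metis
    have comp: "bij_betw (g \<circ> h) (del Q a) (del P (g (h a)))"
      using hm_bij[OF f a] ha by (subst bij_betw_cong[of _ _ f]) (simp_all add: h[OF ph_del[OF Q a]])
    have injd: "inj_on g (del T (h a) \<union> h ` del Q a)"
    proof (rule inj_on_subset[OF inj])
      have "del T (h a) \<subseteq> faces T l" using ph_del[OF T] ha by blast
      moreover have "h ` del Q a \<subseteq> faces T l" using h ph_del[OF Q a] by blast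
      ultimately show "del T (h a) \<union> h ` del Q a \<subseteq> all_faces T" by (auto intro: all_facesI)
    qed
    have "g ` (h ` del Q a) = g ` del T (h a)"
      using comp hm_del[OF g, of "h a" l] ha by (simp add: bij_betw_def image_comp)
    then have "h ` del Q a = del T (h a)" by (rule iffD1[OF inj_on_image_eq_iff[OF injd Un_upper2 Un_upper1]])
    moreover have "inj_on h (del Q a)" using comp inj_on_imageI2 by (auto simp: bij_betw_def)
    ultimately show "bij_betw h (del Q a) (del T (h a))" by (simp add: bij_betw_def)
  qed
  then show ?thesis using h by (metis all_facesE)
qed

section \<open>Opetopes over a fixed cardinal are bounded\<close>

text \<open>In an opetope all but one face of dimension \<open>l\<close> lie in the domain of a face
  one dimension up, and a domain has as many elements as its counterpart in
  \<open>S\<close>.\<close>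

lemma opetope_card_faces:
  assumes Q: "positive_opetope Q" and S: "positive_hypergraph S" and f: "hypergraph_morphism Q S f"
  shows "card (faces Q l) \<le> 1 + card (faces Q (Suc l)) * card (faces S l)"
proof (cases "l \<le> hdim Q")
  interpret opetopic_cardinal Q using Q by unfold_locales (simp add: positive_opetope_def)
  case True
  have "card (del Q c) \<le> card (faces S l)" if c: "c \<in> faces Q (Suc l)" for c
  proof -
    have "card (del Q c) = card (del S (f c))" using bij_betw_same_card[OF hm_bij[OF f c]] .
    also have "\<dots> \<le> card (faces S l)" using ph_del[OF S hm_face[OF f c]] ph_finite[OF S] by (intro card_mono) auto
    finally show ?thesis .
  qed
  then have "card (dels Q (faces Q (Suc l))) \<le> card (faces Q (Suc l)) * card (faces S l)"
  proof -
    assume le: "\<And>c. c \<in> faces Q (Suc l) \<Longrightarrow> card (del Q c) \<le> card (faces S l)"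
    have "card (dels Q (faces Q (Suc l))) \<le> (\<Sum>c\<in>faces Q (Suc l). card (del Q c))"
      unfolding dels_def by (rule card_UN_le[OF ph_finite[OF ph]])
    also have "\<dots> \<le> of_nat (card (faces Q (Suc l))) * card (faces S l)" by (rule sum_bounded_above) (rule le)
    finally show ?thesis by simp
  qed
  moreover have "card (faces Q l) - card (dels Q (faces Q (Suc l))) \<le> card (faces Q l - dels Q (faces Q (Suc l)))"
  proof (rule diff_card_le_card_Diff, rule finite_subset[OF _ ph_finite[OF ph]])
    show "dels Q (faces Q (Suc l)) \<subseteq> faces Q l" using delF by (auto simp: dels_def)
  qed
  moreover have "card (faces Q l - dels Q (faces Q (Suc l))) = 1" using Q True by (auto simp: positive_opetope_def)
  ultimately show ?thesis by linarith
next
  interpret opetopic_cardinal Q using Q by unfold_locales (simp add: positive_opetope_def)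
  case False
  then show ?thesis using faces_nonempty_iff[of l] by simp
qed

text \<open>The previous estimate bounds each dimension by the next. The recursion starts above
  \<open>hdim S\<close>, where \<open>Q\<close> has no faces because morphisms preserve
  dimension.\<close>

lemma opetope_bound:
  assumes S: "positive_opetopic_cardinal S"
  shows "\<exists>B. \<forall>Q f. positive_opetope Q \<and> hypergraph_morphism Q S f \<longrightarrow> card (all_faces Q) \<le> B"
proof -
  interpret S: opetopic_cardinal S by unfold_locales (rule S)
  let ?N = "hdim S"
  have empty: "faces Q l = {}" if "hypergraph_morphism Q S f" "?N < l" for Q f l
    using hm_face[OF that(1)] S.faces_nonempty_iff[of l] that(2) by fastforce
  \<comment> \<open>Stage \<open>i\<close> covers the top \<open>i\<close> dimensions up to
    \<open>?N\<close> and everything above, so stage \<open>Suc ?N\<close> covers all of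
    them.\<close>
  have "\<exists>B. \<forall>Q f l. positive_opetope Q \<and> hypergraph_morphism Q S f \<and> ?N < l + i \<longrightarrow> card (faces Q l) \<le> B" for i
  proof (induction i)
    case 0
    then show ?case using empty by (intro exI[of _ 0]) auto
  next
    case (Suc i)
    then obtain B where B: "\<And>Q f l. positive_opetope Q \<Longrightarrow> hypergraph_morphism Q S f \<Longrightarrow> ?N < l + i \<Longrightarrow> card (faces Q l) \<le> B" by blast
    show ?case
    proof (intro exI[of _ "B + (1 + B * card (faces S (?N - i)))"] allI impI)
      fix Q f l assume Q: "positive_opetope Q \<and> hypergraph_morphism Q S f \<and> ?N < l + Suc i"
      show "card (faces Q l) \<le> B + (1 + B * card (faces S (?N - i)))"
      proof (cases "?N < l + i")
        case True
        then show ?thesis using B[of Q f l] Q by linarith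
      next
        case False
        then have l: "l = ?N - i" "?N < Suc l + i" using Q by auto
        have "card (faces Q l) \<le> 1 + card (faces Q (Suc l)) * card (faces S l)"
          using opetope_card_faces[OF _ S.ph] Q by blast
        also have "\<dots> \<le> 1 + B * card (faces S l)" using B[of Q f "Suc l"] Q l(2) by simp
        finally show ?thesis using l(1) by simp
      qed
    qed
  qed
  then obtain B where B: "\<And>Q f l. positive_opetope Q \<Longrightarrow> hypergraph_morphism Q S f \<Longrightarrow> ?N < l + Suc ?N \<Longrightarrow> card (faces Q l) \<le> B"
    by blast
  show ?thesis
  proof (intro exI[of _ "Suc ?N * B"] allI impI)
    fix Q f assume Q: "positive_opetope Q \<and> hypergraph_morphism Q S f"
    have "l \<le> ?N" if "a \<in> faces Q l" for a l using empty[of Q f l] Q that by (metis empty_iff leI)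
    then have "all_faces Q = (\<Union>l\<le>?N. faces Q l)" unfolding all_faces_def by blast
    also have "card \<dots> \<le> (\<Sum>l\<le>?N. card (faces Q l))" by (rule card_UN_le) simp
    also have "\<dots> \<le> (\<Sum>l\<le>?N. B)" by (rule sum_mono) (use B Q in auto)
    finally show "card (all_faces Q) \<le> Suc ?N * B" by simp
  qed
qed

text \<open>The code records a hypergraph over \<open>S\<close> through a numbering \<open>h\<close> of its faces; it determines
  the hypergraph up to isomorphism over \<open>S\<close>.\<close>

definition code :: "'f hypergraph \<Rightarrow> ('f \<Rightarrow> 'f) \<Rightarrow> ('f \<Rightarrow> nat) \<Rightarrow>
    (nat \<times> nat) set \<times> (nat \<times> nat) set \<times> (nat \<times> nat) set \<times> (nat \<times> 'f) set" where
  "code Q f h = ({(l, h a) |l a. a \<in> faces Q l}, {(h a, h (gam Q a)) |a. a \<in> pos_faces Q},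
     {(h a, h b) |a b. a \<in> pos_faces Q \<and> b \<in> del Q a}, {(h a, f a) |a. a \<in> all_faces Q})"

text \<open>Faces with the same number correspond. The codes record dimension, \<open>gam\<close>,
  \<open>del\<close> and the map to \<open>S\<close>, so this matching is a morphism compatible with
  the maps.\<close>

lemma code_eq_factor:
  assumes Q: "positive_hypergraph Q" and Q': "positive_hypergraph Q'"
    and inj: "inj_on h (all_faces Q)" and inj': "inj_on h' (all_faces Q')" and eq: "code Q f h = code Q' f' h'"
  shows "\<exists>u. hypergraph_morphism Q Q' u \<and> (\<forall>a\<in>all_faces Q. f' (u a) = f a)"
proof -
  have e1: "{(l, h a) |l a. a \<in> faces Q l} = {(l, h' a) |l a. a \<in> faces Q' l}"
    and e2: "{(h a, h (gam Q a)) |a. a \<in> pos_faces Q} = {(h' a, h' (gam Q' a)) |a. a \<in> pos_faces Q'}"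
    and e3: "{(h a, h b) |a b. a \<in> pos_faces Q \<and> b \<in> del Q a} = {(h' a, h' b) |a b. a \<in> pos_faces Q' \<and> b \<in> del Q' a}"
    and e4: "{(h a, f a) |a. a \<in> all_faces Q} = {(h' a, f' a) |a. a \<in> all_faces Q'}"
    using eq by (simp_all add: code_def)
  define u where "u = (\<lambda>a\<in>all_faces Q. inv_into (all_faces Q') h' (h a))"
  have u: "u a \<in> faces Q' l \<and> h' (u a) = h a" if a: "a \<in> faces Q l" for a l
  proof -
    have "(l, h a) \<in> {(l, h' a) |l a. a \<in> faces Q' l}" using a e1 by blast
    then obtain a' where a': "a' \<in> faces Q' l" "h a = h' a'" by blast
    then have "u a = a'" using inj' all_facesI[OF a] all_facesI[OF a'(1)] by (simp add: u_def)
    then show ?thesis using a' by simp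
  qed
  have uall: "u a \<in> all_faces Q' \<and> h' (u a) = h a" if "a \<in> all_faces Q" for a
    using that u by (metis all_facesE all_facesI)
  have same: "a' = u a" if "a \<in> all_faces Q" "a' \<in> all_faces Q'" "h' a' = h a" for a a'
    using inj_onD[OF inj', of a' "u a"] that uall by simp
  have "hypergraph_morphism Q Q' u"
    unfolding hypergraph_morphism_def
  proof (intro conjI allI ballI)
    show "u \<in> extensional (all_faces Q)" by (simp add: u_def)
    show "u ` faces Q k \<subseteq> faces Q' k" for k using u by blast
    fix a assume ap: "a \<in> pos_faces Q"
    then obtain l where a: "a \<in> faces Q (Suc l)" by (rule pos_facesE)
    have aa: "a \<in> all_faces Q" and ga: "gam Q a \<in> all_faces Q" using a ph_gam[OF Q a] by (auto intro: all_facesI)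
    have da: "b \<in> all_faces Q" if "b \<in> del Q a" for b using ph_del[OF Q a that] by (rule all_facesI)
    have da': "b \<in> all_faces Q'" if "c \<in> pos_faces Q'" "b \<in> del Q' c" for b c
      using that ph_del[OF Q'] by (metis pos_facesE all_facesI)
    have "(h a, h (gam Q a)) \<in> {(h' a, h' (gam Q' a)) |a. a \<in> pos_faces Q'}" using e2 ap by blast
    then obtain a' where a': "a' \<in> pos_faces Q'" "h' a' = h a" "h' (gam Q' a') = h (gam Q a)" by auto
    have "gam Q' a' \<in> all_faces Q'" using a'(1) ph_gam[OF Q'] by (metis pos_facesE all_facesI)
    then show "u (gam Q a) = gam Q' (u a)"
      using same[OF aa pos_faces_all[OF a'(1)] a'(2)] same[OF ga _ a'(3)] by simp
    have "u b \<in> del Q' (u a)" if b: "b \<in> del Q a" for b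
    proof -
      have "(h a, h b) \<in> {(h' a, h' b) |a b. a \<in> pos_faces Q' \<and> b \<in> del Q' a}" using e3 ap b by blast
      then obtain c d where cd: "c \<in> pos_faces Q'" "d \<in> del Q' c" "h' c = h a" "h' d = h b" by auto
      then show ?thesis using same[OF aa pos_faces_all[OF cd(1)] cd(3)] same[OF da[OF b] da'[OF cd(1,2)] cd(4)] by simp
    qed
    moreover have "d \<in> u ` del Q a" if d: "d \<in> del Q' (u a)" for d
    proof -
      have up: "u a \<in> pos_faces Q'" using u[OF a] by (auto intro: pos_facesI)
      have "(h' (u a), h' d) \<in> {(h a, h b) |a b. a \<in> pos_faces Q \<and> b \<in> del Q a}" using e3 up d by blast
      then obtain a3 b3 where 3: "a3 \<in> pos_faces Q" "b3 \<in> del Q a3" "h a3 = h' (u a)" "h b3 = h' d" by auto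
      have "a3 = a" using inj_onD[OF inj _ pos_faces_all[OF 3(1)] aa] 3(3) u[OF a] by simp
      then have "d = u b3" using same[OF da[of b3] da'[OF up d]] 3 by simp
      then show ?thesis using 3 \<open>a3 = a\<close> by blast
    qed
    moreover have "inj_on u (del Q a)"
      by (rule inj_onI) (metis da inj inj_onD uall)
    ultimately show "bij_betw u (del Q a) (del Q' (u a))" unfolding bij_betw_def by blast
  qed
  moreover have "f' (u a) = f a" if a: "a \<in> all_faces Q" for a
  proof -
    have "(h a, f a) \<in> {(h' a, f' a) |a. a \<in> all_faces Q'}" using e4 a by blast
    then obtain a' where "a' \<in> all_faces Q'" "h' a' = h a" "f' a' = f a" by auto
    then show ?thesis using same[OF a] by simp
  qed
  ultimately show ?thesis by blast
qed

text \<open>With the number of faces bounded by \<open>B\<close>, numberings take values below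
  \<open>B\<close> and only finitely many codes occur. One representative per code is enough; this
  is the finite family that smallness of the limit requires.\<close>

lemma opetopes_over_finite:
  assumes S: "positive_opetopic_cardinal (S :: 'f hypergraph)"
  defines "\<O> \<equiv> {(Q, f). positive_opetope Q \<and> hypergraph_morphism Q S f}"
  shows "\<exists>I. finite I \<and> I \<subseteq> \<O> \<and> (\<forall>(Q, f)\<in>\<O>. \<exists>(Q', f')\<in>I. \<exists>u. hypergraph_morphism Q Q' u \<and> (\<forall>a\<in>all_faces Q. f' (u a) = f a))"
proof -
  interpret S: opetopic_cardinal S by unfold_locales (rule S)
  obtain B where B: "\<And>Q f. positive_opetope Q \<Longrightarrow> hypergraph_morphism Q S f \<Longrightarrow> card (all_faces Q) \<le> B"
    using opetope_bound[OF S] by blast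
  have phO: "positive_hypergraph Q" if "(Q, f) \<in> \<O>" for Q f
    using that by (simp add: \<O>_def positive_opetope_def positive_opetopic_cardinal_def)
  have "\<exists>h. inj_on h (all_faces Q) \<and> h ` all_faces Q \<subseteq> {..<B}" if Qf: "(Q, f) \<in> \<O>" for Q f
  proof -
    obtain h where h: "bij_betw h (all_faces Q) {0..<card (all_faces Q)}"
      using ex_bij_betw_finite_nat[OF finite_all_faces[OF phO[OF Qf]]] by blast
    have "card (all_faces Q) \<le> B" using B[of Q f] Qf by (simp add: \<O>_def)
    then show ?thesis using h unfolding bij_betw_def by (intro exI[of _ h]) auto
  qed
  note numbering = this
  define H :: "'f hypergraph \<Rightarrow> 'f \<Rightarrow> nat" where "H Q = (SOME h. inj_on h (all_faces Q) \<and> h ` all_faces Q \<subseteq> {..<B})" for Q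
  have H: "inj_on (H Q) (all_faces Q)" "H Q ` all_faces Q \<subseteq> {..<B}" if "(Q, f) \<in> \<O>" for Q f
    using someI_ex[OF numbering[OF that]] unfolding H_def by auto
  define c where "c = (\<lambda>(Q, f). code Q f (H Q))"
  let ?K = "Pow ({..hdim S} \<times> {..<B}) \<times> Pow ({..<B} \<times> {..<B}) \<times> Pow ({..<B} \<times> {..<B}) \<times> Pow ({..<B} \<times> all_faces S)"
  have cK: "c ` \<O> \<subseteq> ?K"
  proof (rule image_subsetI)
    fix x assume x: "x \<in> \<O>"
    then obtain Q f where x': "x = (Q, f)" "(Q, f) \<in> \<O>" by (cases x) auto
    have f: "hypergraph_morphism Q S f" using x' by (simp add: \<O>_def)
    note Q = phO[OF x'(2)]
    have hB: "H Q a < B" if "a \<in> all_faces Q" for a using H(2)[OF x'(2)] that by blast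
    have "l \<le> hdim S" if "a \<in> faces Q l" for a l using hm_face[OF f that] S.faces_nonempty_iff by blast
    moreover have "gam Q a \<in> all_faces Q" "b \<in> del Q a \<Longrightarrow> b \<in> all_faces Q" if "a \<in> pos_faces Q" for a b
      using that ph_gam[OF Q] ph_del[OF Q] by (metis pos_facesE all_facesI)+
    ultimately show "c x \<in> ?K"
      unfolding x'(1) c_def code_def using hB hm_all[OF f] pos_faces_all[of _ Q] all_facesI[of _ Q] by auto
  qed
  have "finite ?K" using finite_all_faces[OF S.ph] by simp
  then have fin: "finite (c ` \<O>)" using cK finite_subset by blast
  define I where "I = inv_into \<O> c ` (c ` \<O>)"
  have "\<exists>(Q', f')\<in>I. \<exists>u. hypergraph_morphism Q Q' u \<and> (\<forall>a\<in>all_faces Q. f' (u a) = f a)" if x: "(Q, f) \<in> \<O>" for Q f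
  proof -
    obtain Q' f' where x': "(Q', f') = inv_into \<O> c (c (Q, f))" by (metis surj_pair)
    have "(Q', f') \<in> \<O>" "c (Q', f') = c (Q, f)" unfolding x' using x by (auto intro: inv_into_into f_inv_into_f)
    then have "\<exists>u. hypergraph_morphism Q Q' u \<and> (\<forall>a\<in>all_faces Q. f' (u a) = f a)"
      using code_eq_factor[OF phO[OF x] phO[of Q' f'] H(1)[OF x] H(1)[of Q' f']] by (simp add: c_def)
    moreover have "(Q', f') \<in> I" unfolding I_def x' using x by blast
    ultimately show ?thesis by blast
  qed
  moreover have "I \<subseteq> \<O>" unfolding I_def by (rule image_subsetI) (rule inv_into_into)
  moreover have "finite I" unfolding I_def using fin by simp
  ultimately show ?thesis by blast
qed


section \<open>The category of opetopic cardinals\<close>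

lemma hm_id: "hypergraph_morphism S S (\<lambda>a\<in>all_faces S. a)" if "positive_hypergraph S"
  by (rule incl_morphismI) (use ph_gam[OF that] ph_del[OF that] in auto)

lemma hm_comp:
  assumes S: "positive_hypergraph S" and f: "hypergraph_morphism S T f" and g: "hypergraph_morphism T V g"
  shows "hypergraph_morphism S V (\<lambda>a\<in>all_faces S. g (f a))"
  unfolding hypergraph_morphism_def
proof (intro conjI allI ballI)
  let ?h = "\<lambda>a\<in>all_faces S. g (f a)"
  have h: "?h a = g (f a)" if "a \<in> faces S l" for a l using all_facesI[OF that] by simp
  show "?h ` faces S k \<subseteq> faces V k" for k
  proof (rule image_subsetI)
    fix a assume a: "a \<in> faces S k"
    show "?h a \<in> faces V k" unfolding h[OF a] by (rule hm_face[OF g hm_face[OF f a]])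
  qed
  fix a assume "a \<in> pos_faces S"
  then obtain l where a: "a \<in> faces S (Suc l)" by (rule pos_facesE)
  show "?h (gam S a) = gam V (?h a)"
    unfolding h[OF a] h[OF ph_gam[OF S a]] by (simp add: hm_gam[OF f a] hm_gam[OF g hm_face[OF f a]])
  have "bij_betw (g \<circ> f) (del S a) (del V (g (f a)))"
    using hm_bij[OF f a] hm_bij[OF g hm_face[OF f a]] by (rule bij_betw_trans)
  then show "bij_betw ?h (del S a) (del V (?h a))"
    unfolding h[OF a] by (rule iffD1[OF bij_betw_cong, rotated]) (simp add: all_facesI[OF ph_del[OF S a]])
qed simp

lemma pHg_simps:
  "Ob pHg = {S. positive_hypergraph S}"
  "(S, f, T) \<in> Ar pHg \<longleftrightarrow> positive_hypergraph S \<and> positive_hypergraph T \<and> hypergraph_morphism S T f"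
  "Src pHg (S, f, T) = S" "Tgt pHg (S, f, T) = T"
  "Idn pHg S = (S, \<lambda>a\<in>all_faces S. a, S)"
  "Cmp pHg (T, g, V) (S, f, T') = (S, \<lambda>a\<in>all_faces S. g (f a), V)"
  by (simp_all add: pHg_def)

lemma category_pHg: "category pHg"
  unfolding category_def
proof (intro conjI ballI impI)
  fix a assume "a \<in> Ar pHg"
  then obtain S f T where a: "a = (S, f, T)" "positive_hypergraph S" "positive_hypergraph T" "hypergraph_morphism S T f"
    by (cases a) (auto simp: pHg_simps)
  show "Src pHg a \<in> Ob pHg" "Tgt pHg a \<in> Ob pHg" using a by (simp_all add: pHg_simps)
  have ext: "(\<lambda>x\<in>all_faces S. f x) = f" using hm_ext[OF a(4)] by (rule extensional_restrict)
  have "(\<lambda>x\<in>all_faces S. f ((\<lambda>a\<in>all_faces S. a) x)) = f" "(\<lambda>x\<in>all_faces S. (\<lambda>a\<in>all_faces T. a) (f x)) = f"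
    by (rule trans[OF restrict_ext ext], simp add: hm_all[OF a(4)])+
  then show "Cmp pHg a (Idn pHg (Src pHg a)) = a" "Cmp pHg (Idn pHg (Tgt pHg a)) a = a"
    unfolding a(1) pHg_simps by simp_all
next
  fix S :: "'a hypergraph" assume "S \<in> Ob pHg"
  then show "Idn pHg S \<in> Ar pHg" "Src pHg (Idn pHg S) = S" "Tgt pHg (Idn pHg S) = S"
    by (simp_all add: pHg_simps hm_id)
next
  fix a b assume "a \<in> Ar pHg" "b \<in> Ar pHg" "Tgt pHg a = Src pHg b"
  then obtain S f T g V where "a = (S, f, T)" "b = (T, g, V)" "positive_hypergraph S" "positive_hypergraph T"
      "positive_hypergraph V" "hypergraph_morphism S T f" "hypergraph_morphism T V g"
    by (cases a, cases b) (auto simp: pHg_simps)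
  then show "Cmp pHg b a \<in> Ar pHg" "Src pHg (Cmp pHg b a) = Src pHg a" "Tgt pHg (Cmp pHg b a) = Tgt pHg b"
    by (simp_all add: pHg_simps hm_comp)
next
  fix a b c assume "a \<in> Ar pHg" "b \<in> Ar pHg" "c \<in> Ar pHg" "Tgt pHg a = Src pHg b" "Tgt pHg b = Src pHg c"
  then obtain S f T g V h W where *: "a = (S, f, T)" "b = (T, g, V)" "c = (V, h, W)" "hypergraph_morphism S T f"
    by (cases a, cases b, cases c) (auto simp: pHg_simps)
  show "Cmp pHg c (Cmp pHg b a) = Cmp pHg (Cmp pHg c b) a"
    unfolding * pHg_simps by (auto intro!: restrict_ext simp: hm_all[OF *(4)])
qed

lemma pOpeCard_simps:
  "Ob pOpeCard = {S. positive_opetopic_cardinal S}"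
  "(S, f, T) \<in> Ar pOpeCard \<longleftrightarrow> positive_opetopic_cardinal S \<and> positive_opetopic_cardinal T \<and> hypergraph_morphism S T f"
  "Src pOpeCard (S, f, T) = S" "Tgt pOpeCard (S, f, T) = T"
  "Idn pOpeCard S = (S, \<lambda>a\<in>all_faces S. a, S)"
  "Cmp pOpeCard (T, g, V) (S, f, T') = (S, \<lambda>a\<in>all_faces S. g (f a), V)"
  by (auto simp: pOpeCard_def pHg_simps positive_opetopic_cardinal_def)

lemma category_pOpeCard: "category pOpeCard"
  unfolding pOpeCard_def by (rule category_full_subcat[OF category_pHg])

text \<open>The Kan extension argument is set up for a full subcategory cut out by a predicate, so
  \<open>pOpe\<close> has to be seen inside \<open>pOpeCard\<close> and not inside
  \<open>pHg\<close>.\<close>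

lemma pOpe_full_subcat: "pOpe = full_subcat pOpeCard positive_opetope"
proof -
  have "positive_opetope S \<longleftrightarrow> positive_opetopic_cardinal S \<and> positive_opetope S" for S :: "'a hypergraph"
    by (auto simp: positive_opetope_def)
  then show ?thesis unfolding pOpe_def pOpeCard_def full_subcat_def by (auto intro!: arg_cong2[where f = "\<lambda>A B. pHg\<lparr>Ob := A, Ar := B\<rparr>"])
qed

lemma pOpeCard_arrowE:
  assumes "a \<in> Ar pOpeCard" "Src pOpeCard a = S" "Tgt pOpeCard a = T"
  obtains f where "a = (S, f, T)" "hypergraph_morphism S T f" "positive_opetopic_cardinal S" "positive_opetopic_cardinal T"
  using assms by (cases a) (auto simp: pOpeCard_simps)

lemma dom_part_incl:
  assumes R: "positive_hypergraph (dom_part k S)"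
  shows "hypergraph_morphism (dom_part k S) S (\<lambda>a\<in>all_faces (dom_part k S). a)"
proof (rule incl_morphismI)
  show "faces (dom_part k S) l \<subseteq> faces S l" for l by (auto simp: faces_dom_part)
  fix a l assume a: "a \<in> faces (dom_part k S) (Suc l)"
  show "gam (dom_part k S) a = gam S a \<and> del (dom_part k S) a = del S a \<and>
      gam (dom_part k S) a \<in> faces (dom_part k S) l \<and> del (dom_part k S) a \<subseteq> faces (dom_part k S) l"
    using dom_part_pos[OF a] ph_gam[OF R a] ph_del[OF R a] by blast
qed

lemma cod_part_incl:
  assumes R: "positive_hypergraph (cod_part k S)"
  shows "hypergraph_morphism (cod_part k S) S (\<lambda>a\<in>all_faces (cod_part k S). a)"
proof (rule incl_morphismI)
  show "faces (cod_part k S) l \<subseteq> faces S l" for l by (auto simp: faces_cod_part)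
  fix a l assume a: "a \<in> faces (cod_part k S) (Suc l)"
  show "gam (cod_part k S) a = gam S a \<and> del (cod_part k S) a = del S a \<and>
      gam (cod_part k S) a \<in> faces (cod_part k S) l \<and> del (cod_part k S) a \<subseteq> faces (cod_part k S) l"
    using cod_part_pos[OF a] ph_gam[OF R a] ph_del[OF R a] by blast
qed

lemma poc_ph: "positive_opetopic_cardinal S \<Longrightarrow> positive_hypergraph S"
  by (simp add: positive_opetopic_cardinal_def)

lemma restrict_eq_iff: "restrict f A = restrict g A \<longleftrightarrow> (\<forall>a\<in>A. f a = g a)"
  by (metis restrict_apply' restrict_ext)

section \<open>Gluings are pushouts of cardinals, and special pushouts are gluings\<close>

lemma glue_pushout:
  assumes R: "positive_opetopic_cardinal R" and T: "positive_opetopic_cardinal T" and S: "positive_opetopic_cardinal S"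
    and P: "positive_opetopic_cardinal P" and gl: "glue R T S P g s"
    and RT: "hypergraph_morphism R T (\<lambda>a\<in>all_faces R. a)" and RS: "hypergraph_morphism R S (\<lambda>a\<in>all_faces R. a)"
  shows "is_pushout pOpeCard (incl_arrow R T) (incl_arrow R S) (T, g, P) (S, s, P)"
  unfolding is_pushout_def is_pullback_def op_cat_simps incl_arrow_def
proof (intro conjI ballI impI)
  show "{(R, \<lambda>a\<in>all_faces R. a, T), (R, \<lambda>a\<in>all_faces R. a, S), (T, g, P), (S, s, P)} \<subseteq> Ar pOpeCard"
    using assms glue_morphisms[OF gl] by (simp add: pOpeCard_simps)
  show "Cmp pOpeCard (T, g, P) (R, \<lambda>a\<in>all_faces R. a, T) = Cmp pOpeCard (S, s, P) (R, \<lambda>a\<in>all_faces R. a, S)"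
    using glue_agree[OF gl] by (auto simp: pOpeCard_simps intro!: restrict_ext)
  fix p q assume p: "p \<in> Ar pOpeCard" and q: "q \<in> Ar pOpeCard"
    and e: "Tgt pOpeCard p = Tgt pOpeCard q \<and> Src pOpeCard p = Tgt pOpeCard (R, \<lambda>a\<in>all_faces R. a, T) \<and>
      Src pOpeCard q = Tgt pOpeCard (R, \<lambda>a\<in>all_faces R. a, S) \<and>
      Cmp pOpeCard p (R, \<lambda>a\<in>all_faces R. a, T) = Cmp pOpeCard q (R, \<lambda>a\<in>all_faces R. a, S)"
  let ?V = "Tgt pOpeCard p"
  obtain u where u: "p = (T, u, ?V)" "hypergraph_morphism T ?V u" "positive_opetopic_cardinal ?V"
    using pOpeCard_arrowE[OF p, of T ?V] e by (auto simp: pOpeCard_simps)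
  obtain v where v: "q = (S, v, ?V)" "hypergraph_morphism S ?V v"
    using pOpeCard_arrowE[OF q, of S ?V] e by (auto simp: pOpeCard_simps)
  have "Cmp pOpeCard (T, u, ?V) (R, \<lambda>a\<in>all_faces R. a, T) = Cmp pOpeCard (S, v, ?V) (R, \<lambda>a\<in>all_faces R. a, S)"
    using e u(1) v(1) by metis
  then have uv: "u a = v a" if "a \<in> all_faces R" for a using that by (auto simp: pOpeCard_simps restrict_eq_iff)
  have ex: "\<exists>!w. hypergraph_morphism P ?V w \<and> (\<forall>a\<in>all_faces T. w (g a) = u a) \<and> (\<forall>a\<in>all_faces S. w (s a) = v a)"
    by (rule glue_universal[OF poc_ph[OF T] poc_ph[OF S] poc_ph[OF P] gl u(2) v(2) uv])
  then obtain w where w: "hypergraph_morphism P ?V w" "\<forall>a\<in>all_faces T. w (g a) = u a" "\<forall>a\<in>all_faces S. w (s a) = v a"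
    by blast
  have wu: "w' = w"
    if "hypergraph_morphism P ?V w'" "\<forall>a\<in>all_faces T. w' (g a) = u a" "\<forall>a\<in>all_faces S. w' (s a) = v a" for w'
    using ex w that by blast
  have tri: "Cmp pOpeCard (P, w', ?V) (T, g, P) = p \<longleftrightarrow> (\<forall>a\<in>all_faces T. w' (g a) = u a)"
     "Cmp pOpeCard (P, w', ?V) (S, s, P) = q \<longleftrightarrow> (\<forall>a\<in>all_faces S. w' (s a) = v a)" for w'
  proof -
    have "u = restrict u (all_faces T)" "v = restrict v (all_faces S)"
      using hm_ext[OF u(2)] hm_ext[OF v(2)] by (simp_all add: extensional_restrict)
    then have p': "p = (T, restrict u (all_faces T), ?V)" and q': "q = (S, restrict v (all_faces S), ?V)" using u(1) v(1) by auto
    show "Cmp pOpeCard (P, w', ?V) (T, g, P) = p \<longleftrightarrow> (\<forall>a\<in>all_faces T. w' (g a) = u a)"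
      by (subst (2) p') (simp add: pOpeCard_simps restrict_eq_iff)
    show "Cmp pOpeCard (P, w', ?V) (S, s, P) = q \<longleftrightarrow> (\<forall>a\<in>all_faces S. w' (s a) = v a)"
      by (subst q') (simp add: pOpeCard_simps restrict_eq_iff)
  qed
  show "\<exists>!h. h \<in> Ar pOpeCard \<and> Tgt pOpeCard h = Tgt pOpeCard p \<and> Src pOpeCard h = Tgt pOpeCard (T, g, P) \<and>
      Cmp pOpeCard h (T, g, P) = p \<and> Cmp pOpeCard h (S, s, P) = q"
  proof (rule ex1I[of _ "(P, w, ?V)"])
    show "(P, w, ?V) \<in> Ar pOpeCard \<and> Tgt pOpeCard (P, w, ?V) = Tgt pOpeCard p \<and> Src pOpeCard (P, w, ?V) = Tgt pOpeCard (T, g, P) \<and>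
      Cmp pOpeCard (P, w, ?V) (T, g, P) = p \<and> Cmp pOpeCard (P, w, ?V) (S, s, P) = q"
      unfolding tri using P u(3) w by (simp add: pOpeCard_simps)
    fix h assume h: "h \<in> Ar pOpeCard \<and> Tgt pOpeCard h = Tgt pOpeCard p \<and> Src pOpeCard h = Tgt pOpeCard (T, g, P) \<and>
      Cmp pOpeCard h (T, g, P) = p \<and> Cmp pOpeCard h (S, s, P) = q"
    then obtain w' where w': "h = (P, w', ?V)" "hypergraph_morphism P ?V w'"
      using pOpeCard_arrowE[of h P ?V] by (auto simp: pOpeCard_simps)
    then show "h = (P, w, ?V)" using wu[OF w'(2)] h tri by metis
  qed
qed (simp_all add: pOpeCard_simps)

text \<open>The universal property of the gluing \<open>P0\<close> among hypergraphs gives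
  \<open>w\<close> from \<open>P0\<close> to \<open>P\<close>, which makes \<open>P0\<close> a
  cardinal; only then does the pushout property of \<open>P\<close> give \<open>q\<close> in the
  other direction. Injectivity of the legs and their overlap are transported along \<open>q\<close>,
  joint surjectivity along \<open>w\<close>.\<close>

lemma special_pushout_glue:
  fixes T S :: "'f hypergraph"
  assumes inf: "infinite (UNIV :: 'f set)" and sp: "special_pushout k T S jT jS"
  obtains P g s where "jT = (T, g, P)" "jS = (S, s, P)" "glue (dom_part k T) T S P g s"
    "positive_opetopic_cardinal (dom_part k T)" "positive_opetopic_cardinal T" "positive_opetopic_cardinal S"
    "positive_opetopic_cardinal P" "cod_part k S = dom_part k T"
proof -
  let ?R = "dom_part k T"
  have eq: "cod_part k S = ?R" and T: "positive_opetopic_cardinal T" and S: "positive_opetopic_cardinal S"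
    using sp by (auto simp: special_pushout_def pOpeCard_simps)
  have po: "is_pullback (op_cat pOpeCard) (?R, \<lambda>a\<in>all_faces ?R. a, T) (?R, \<lambda>a\<in>all_faces ?R. a, S) jT jS"
    using sp unfolding special_pushout_def is_pushout_def incl_arrow_def eq by blast
  have ar: "(?R, \<lambda>a\<in>all_faces ?R. a, T) \<in> Ar pOpeCard" "(?R, \<lambda>a\<in>all_faces ?R. a, S) \<in> Ar pOpeCard" "jT \<in> Ar pOpeCard" "jS \<in> Ar pOpeCard"
    "Src pOpeCard jT = T" "Src pOpeCard jS = S" "Tgt pOpeCard jS = Tgt pOpeCard jT"
    "Cmp pOpeCard jT (?R, \<lambda>a\<in>all_faces ?R. a, T) = Cmp pOpeCard jS (?R, \<lambda>a\<in>all_faces ?R. a, S)"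
    using po unfolding is_pullback_def op_cat_simps by (auto simp: pOpeCard_simps)
  have R: "positive_opetopic_cardinal ?R" and RT: "hypergraph_morphism ?R T (\<lambda>a\<in>all_faces ?R. a)"
    and RS: "hypergraph_morphism ?R S (\<lambda>a\<in>all_faces ?R. a)" using ar(1,2) by (simp_all add: pOpeCard_simps)
  have univ: "\<exists>!h. h \<in> Ar pOpeCard \<and> Tgt pOpeCard h = Tgt pOpeCard p' \<and> Src pOpeCard h = Tgt pOpeCard jT \<and>
         Cmp pOpeCard h jT = p' \<and> Cmp pOpeCard h jS = q'"
    if "p' \<in> Ar pOpeCard" "q' \<in> Ar pOpeCard" "Tgt pOpeCard p' = Tgt pOpeCard q'" "Src pOpeCard p' = T" "Src pOpeCard q' = S"
      "Cmp pOpeCard p' (?R, \<lambda>a\<in>all_faces ?R. a, T) = Cmp pOpeCard q' (?R, \<lambda>a\<in>all_faces ?R. a, S)" for p' q'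
  proof -
    have H: "\<forall>p'\<in>Ar pOpeCard. \<forall>q'\<in>Ar pOpeCard.
        Tgt pOpeCard p' = Tgt pOpeCard q' \<and> Src pOpeCard p' = Tgt pOpeCard (?R, \<lambda>a\<in>all_faces ?R. a, T) \<and>
        Src pOpeCard q' = Tgt pOpeCard (?R, \<lambda>a\<in>all_faces ?R. a, S) \<and>
        Cmp pOpeCard p' (?R, \<lambda>a\<in>all_faces ?R. a, T) = Cmp pOpeCard q' (?R, \<lambda>a\<in>all_faces ?R. a, S) \<longrightarrow>
        (\<exists>!u. u \<in> Ar pOpeCard \<and> Tgt pOpeCard u = Tgt pOpeCard p' \<and> Src pOpeCard u = Tgt pOpeCard jT \<and>
              Cmp pOpeCard u jT = p' \<and> Cmp pOpeCard u jS = q')"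
      using po unfolding is_pullback_def op_cat_simps by (elim conjE)
    show ?thesis
      by (rule H[rule_format, OF that(1,2)]) (use that(3-) in \<open>simp only: pOpeCard_simps simp_thms\<close>)
  qed
  define P where "P = Tgt pOpeCard jT"
  obtain g where g: "jT = (T, g, P)" "hypergraph_morphism T P g" "positive_opetopic_cardinal P"
    using pOpeCard_arrowE[OF ar(3,5)] P_def by metis
  obtain s where s: "jS = (S, s, P)" "hypergraph_morphism S P s"
    using pOpeCard_arrowE[OF ar(4,6)] P_def ar(7) by metis
  have gs: "g a = s a" if "a \<in> all_faces ?R" for a
    using ar(8) that unfolding g(1) s(1) by (auto simp: pOpeCard_simps restrict_eq_iff)
  obtain P0 g0 s0 where P0: "positive_hypergraph P0" "glue ?R T S P0 g0 s0"
    using glue_exists[OF inf poc_ph[OF T] poc_ph[OF S] poc_ph[OF R] RT RS] by blast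
  obtain w where w: "hypergraph_morphism P0 P w" "\<And>a. a \<in> all_faces T \<Longrightarrow> w (g0 a) = g a" "\<And>a. a \<in> all_faces S \<Longrightarrow> w (s0 a) = s a"
    using glue_universal[OF poc_ph[OF T] poc_ph[OF S] P0(1,2) g(2) s(2) gs] by blast
  have pocP0: "positive_opetopic_cardinal P0"
    by (rule glue_opetopic_cardinal[OF T S eq P0(2,1) w(1) g(3)])
  have "(T, g0, P0) \<in> Ar pOpeCard" "(S, s0, P0) \<in> Ar pOpeCard" using T S pocP0 glue_morphisms[OF P0(2)] by (simp_all add: pOpeCard_simps)
  moreover have "Cmp pOpeCard (T, g0, P0) (?R, \<lambda>a\<in>all_faces ?R. a, T) = Cmp pOpeCard (S, s0, P0) (?R, \<lambda>a\<in>all_faces ?R. a, S)"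
    using glue_agree[OF P0(2)] by (auto simp: pOpeCard_simps intro!: restrict_ext)
  ultimately obtain h where h: "h \<in> Ar pOpeCard" "Tgt pOpeCard h = P0" "Src pOpeCard h = P"
     "Cmp pOpeCard h jT = (T, g0, P0)" "Cmp pOpeCard h jS = (S, s0, P0)"
    using univ[of "(T, g0, P0)" "(S, s0, P0)"] by (auto simp: pOpeCard_simps P_def)
  obtain q where q: "h = (P, q, P0)" "hypergraph_morphism P P0 q" using pOpeCard_arrowE[OF h(1,3,2)] by blast
  have "(\<lambda>a\<in>all_faces T. q (g a)) = g0" "(\<lambda>a\<in>all_faces S. q (s a)) = s0"
    using h(4,5) unfolding q(1) g(1) s(1) by (simp_all add: pOpeCard_simps)
  then have qg: "q (g a) = g0 a" if "a \<in> all_faces T" for a using that by auto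
  have qs: "q (s a) = s0 a" if "a \<in> all_faces S" for a
    using that \<open>(\<lambda>a\<in>all_faces S. q (s a)) = s0\<close> by auto
  have gT: "g a \<in> all_faces P" if "a \<in> all_faces T" for a using hm_all[OF g(2) that] .
  have sS: "s a \<in> all_faces P" if "a \<in> all_faces S" for a using hm_all[OF s(2) that] .
  \<comment> \<open>Both \<open>w\<close> after \<open>q\<close> and the identity fix the two legs,
    so uniqueness in the pushout identifies them.\<close>
  have wq: "w (q p) = p" if p: "p \<in> all_faces P" for p
  proof -
    let ?c = "(P, \<lambda>a\<in>all_faces P. w (q a), P)" and ?i = "(P, \<lambda>a\<in>all_faces P. a, P)"
    have ci: "?c \<in> Ar pOpeCard" "?i \<in> Ar pOpeCard"
      using g(3) hm_comp[OF poc_ph[OF g(3)] q(2) w(1)] hm_id[OF poc_ph[OF g(3)]] by (simp_all add: pOpeCard_simps)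
    have gext: "(\<lambda>a\<in>all_faces T. g a) = g" "(\<lambda>a\<in>all_faces S. s a) = s"
      using hm_ext[OF g(2)] hm_ext[OF s(2)] by (simp_all add: extensional_restrict)
    have c: "Cmp pOpeCard ?c jT = jT" "Cmp pOpeCard ?c jS = jS"
    proof -
      have "(\<lambda>a\<in>all_faces T. (\<lambda>a\<in>all_faces P. w (q a)) (g a)) = (\<lambda>a\<in>all_faces T. g a)"
        by (rule restrict_ext) (simp add: gT qg w)
      then show "Cmp pOpeCard ?c jT = jT" unfolding g(1) pOpeCard_simps gext by simp
      have "(\<lambda>a\<in>all_faces S. (\<lambda>a\<in>all_faces P. w (q a)) (s a)) = (\<lambda>a\<in>all_faces S. s a)"
        by (rule restrict_ext) (simp add: sS qs w)
      then show "Cmp pOpeCard ?c jS = jS" unfolding s(1) pOpeCard_simps gext by simp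
    qed
    have i: "Cmp pOpeCard ?i jT = jT" "Cmp pOpeCard ?i jS = jS"
    proof -
      have "(\<lambda>a\<in>all_faces T. (\<lambda>a\<in>all_faces P. a) (g a)) = (\<lambda>a\<in>all_faces T. g a)"
        by (rule restrict_ext) (simp add: gT)
      then show "Cmp pOpeCard ?i jT = jT" unfolding g(1) pOpeCard_simps gext by simp
      have "(\<lambda>a\<in>all_faces S. (\<lambda>a\<in>all_faces P. a) (s a)) = (\<lambda>a\<in>all_faces S. s a)"
        by (rule restrict_ext) (simp add: sS)
      then show "Cmp pOpeCard ?i jS = jS" unfolding s(1) pOpeCard_simps gext by simp
    qed
    have "Tgt pOpeCard ?c = Tgt pOpeCard jT" "Src pOpeCard ?c = Tgt pOpeCard jT" "Tgt pOpeCard ?i = Tgt pOpeCard jT" "Src pOpeCard ?i = Tgt pOpeCard jT"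
      by (simp_all add: pOpeCard_simps P_def)
    then have "?c = ?i" using univ[OF ar(3,4) ar(7)[symmetric] ar(5,6,8)] ci c i by blast
    then have "(\<lambda>a\<in>all_faces P. w (q a)) = (\<lambda>a\<in>all_faces P. a)" by simp
    then show ?thesis using p by (simp add: restrict_eq_iff)
  qed
  have "glue ?R T S P g s"
    unfolding glue_def
  proof (intro conjI allI ballI impI)
    show "hypergraph_morphism T P g" "hypergraph_morphism S P s" by fact+
    show "inj_on g (all_faces T)"
      using inj_onD[OF glue_inj(1)[OF P0(2)]] qg by (intro inj_onI) metis
    show "inj_on s (all_faces S)"
      using inj_onD[OF glue_inj(2)[OF P0(2)]] qs by (intro inj_onI) metis
    fix l show "faces P l = g ` faces T l \<union> s ` faces S l"
    proof
      show "g ` faces T l \<union> s ` faces S l \<subseteq> faces P l" using hm_face[OF g(2)] hm_face[OF s(2)] by blast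
      show "faces P l \<subseteq> g ` faces T l \<union> s ` faces S l"
      proof
        fix p assume p: "p \<in> faces P l"
        then have "q p \<in> g0 ` faces T l \<union> s0 ` faces S l" using hm_face[OF q(2)] glue_faces[OF P0(2)] by blast
        moreover have "w (q p) = p" using wq p by (auto dest: all_facesI)
        ultimately show "p \<in> g ` faces T l \<union> s ` faces S l" using w(2)[OF all_facesI[of _ T l]] w(3)[OF all_facesI[of _ S l]] by force
      qed
    qed
  next
    fix a b assume "a \<in> all_faces T" "b \<in> all_faces S" "g a = s b"
    then have "a = b \<and> a \<in> all_faces ?R" using glue_overlap[OF P0(2)] qg qs by metis
    then show "a = b" "a \<in> all_faces ?R" by auto
  qed (rule gs)
  then show ?thesis using that g s R T S eq by blast
qed

section \<open>Presheaves on opetopes\<close>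

context
  fixes \<U> :: "'u set set"
  assumes U: "set_universe \<U>"
begin

interpretation K: full_inclusion "pOpeCard :: ('f hypergraph, 'f hyper_arrow) cat" positive_opetope \<U>
  by unfold_locales (rule category_pOpeCard, rule U)

lemma over_iff:
  "positive_opetopic_cardinal P \<Longrightarrow> a \<in> K.over P \<longleftrightarrow> (\<exists>Q f. a = (Q, f, P) \<and> positive_opetope Q \<and> hypergraph_morphism Q P f)"
  by (cases a) (auto simp: K.over_def pOpeCard_simps positive_opetope_def)

text \<open>A statement about faces becomes one about maps from opetopes: the single top face
  decides the leg, injectivity of the legs lets arrows be cancelled, and a map into both parts has
  its image in \<open>R\<close> by \<open>glue_overlap\<close>.\<close>

lemma glue_glued:
  assumes R: "positive_opetopic_cardinal R" and T: "positive_opetopic_cardinal T" and S: "positive_opetopic_cardinal S"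
    and P: "positive_opetopic_cardinal P" and gl: "glue R T S P g s"
    and RT: "hypergraph_morphism R T (\<lambda>a\<in>all_faces R. a)" and RS: "hypergraph_morphism R S (\<lambda>a\<in>all_faces R. a)"
  shows "K.glued (incl_arrow R T) (incl_arrow R S) (T, g, P) (S, s, P)"
proof -
  note g = glue_morphisms(1)[OF gl] and s = glue_morphisms(2)[OF gl]
  note ing = glue_inj(1)[OF gl] and ins = glue_inj(2)[OF gl]
  have ph: "positive_hypergraph Q" if "positive_opetope Q" for Q :: "'f hypergraph"
    using that by (simp add: positive_opetope_def poc_ph)
  have factor: "\<exists>h\<in>K.over T'. (Q, f, P) = Cmp pOpeCard (T', g', P) h"
    if T': "positive_opetopic_cardinal T'" and g': "hypergraph_morphism T' P g'" "inj_on g' (all_faces T')"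
      and Q: "positive_opetope Q" and f: "hypergraph_morphism Q P f" and top: "f ` faces Q (hdim Q) \<subseteq> g' ` faces T' (hdim Q)"
    for T' g' Q f
  proof -
    have "f ` faces Q l \<subseteq> g' ` faces T' l" for l by (rule opetope_image[OF Q f g'(1) poc_ph[OF T'] top])
    then obtain h where h: "hypergraph_morphism Q T' h" "\<forall>a\<in>all_faces Q. g' (h a) = f a"
      using factor_through_mono[OF ph[OF Q] poc_ph[OF T'] f g'] by blast
    have "(\<lambda>a\<in>all_faces Q. g' (h a)) = (\<lambda>a\<in>all_faces Q. f a)" using h(2) by (intro restrict_ext) simp
    then have "(Q, f, P) = Cmp pOpeCard (T', g', P) (Q, h, T')"
      using hm_ext[OF f] by (simp add: pOpeCard_simps extensional_restrict)
    moreover have "(Q, h, T') \<in> K.over T'" using over_iff[OF T'] Q h(1) by blast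
    ultimately show ?thesis by blast
  qed
  have mono: "inj_on (Cmp pOpeCard (T', g', P)) (K.over T')"
    if T': "positive_opetopic_cardinal T'" and inj: "inj_on g' (all_faces T')" for T' g'
  proof (rule inj_onI)
    fix a b assume "a \<in> K.over T'" "b \<in> K.over T'" and e: "Cmp pOpeCard (T', g', P) a = Cmp pOpeCard (T', g', P) b"
    then obtain Q h Q' h' where ab: "a = (Q, h, T')" "hypergraph_morphism Q T' h" "b = (Q', h', T')" "hypergraph_morphism Q' T' h'"
      unfolding over_iff[OF T'] by blast
    have "Q = Q'" "(\<lambda>a\<in>all_faces Q. g' (h a)) = (\<lambda>a\<in>all_faces Q'. g' (h' a))"
      using e unfolding ab(1,3) pOpeCard_simps prod.inject by blast+
    then have "h a = h' a" if "a \<in> all_faces Q" for a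
      using that inj_onD[OF inj _ hm_all[OF ab(2) that] hm_all[OF ab(4)]] by (simp add: restrict_eq_iff)
    then have "h = h'" using extensionalityI[OF hm_ext[OF ab(2)]] hm_ext[OF ab(4)] \<open>Q = Q'\<close> by blast
    then show "a = b" using ab \<open>Q = Q'\<close> by simp
  qed
  show ?thesis
    unfolding K.glued_def incl_arrow_def pOpeCard_simps
  proof (intro conjI ballI impI)
    show "{(R, \<lambda>a\<in>all_faces R. a, T), (R, \<lambda>a\<in>all_faces R. a, S), (T, g, P), (S, s, P)} \<subseteq> Ar pOpeCard"
      using assms g s by (simp add: pOpeCard_simps)
    show "(R, \<lambda>a\<in>all_faces R. g ((\<lambda>a\<in>all_faces R. a) a), P) = (R, \<lambda>a\<in>all_faces R. s ((\<lambda>a\<in>all_faces R. a) a), P)"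
      using glue_agree[OF gl] by (auto intro!: restrict_ext)
    show "inj_on (Cmp pOpeCard (T, g, P)) (K.over T)" by (rule mono[OF T ing])
    show "inj_on (Cmp pOpeCard (S, s, P)) (K.over S)" by (rule mono[OF S ins])
  next
    fix f assume "f \<in> K.over P"
    then obtain Q f' where f: "f = (Q, f', P)" "positive_opetope Q" "hypergraph_morphism Q P f'" unfolding over_iff[OF P] by blast
    obtain m where m: "faces Q (hdim Q) = {m}" using opetope_top[OF f(2)] by blast
    have "f' m \<in> g ` faces T (hdim Q) \<union> s ` faces S (hdim Q)"
      using hm_face[OF f(3), of m "hdim Q"] m glue_faces[OF gl] by simp
    then consider "f' ` faces Q (hdim Q) \<subseteq> g ` faces T (hdim Q)" | "f' ` faces Q (hdim Q) \<subseteq> s ` faces S (hdim Q)"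
      unfolding m by auto
    then show "(\<exists>h\<in>K.over T. f = Cmp pOpeCard (T, g, P) h) \<or> (\<exists>h\<in>K.over S. f = Cmp pOpeCard (S, s, P) h)"
      using factor[OF T g ing f(2,3)] factor[OF S s ins f(2,3)] unfolding f(1) by blast
  next
    fix a b assume "a \<in> K.over T" "b \<in> K.over S" and e: "Cmp pOpeCard (T, g, P) a = Cmp pOpeCard (S, s, P) b"
    then obtain Q h Q' h' where ab: "a = (Q, h, T)" "hypergraph_morphism Q T h" "b = (Q', h', S)" "hypergraph_morphism Q' S h'" "positive_opetope Q"
      unfolding over_iff[OF T] over_iff[OF S] by blast
    have QQ: "Q' = Q" "(\<lambda>a\<in>all_faces Q. g (h a)) = (\<lambda>a\<in>all_faces Q. s (h' a))"
      using e unfolding ab(1,3) by (auto simp: pOpeCard_simps)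
    have hh: "h a = h' a \<and> h a \<in> all_faces R" if "a \<in> all_faces Q" for a
    proof -
      have "g (h a) = s (h' a)" using QQ(2) that by (simp add: restrict_eq_iff)
      moreover have "h' a \<in> all_faces S" using hm_all[OF ab(4)] that QQ(1) by simp
      ultimately show ?thesis using glue_overlap[OF gl hm_all[OF ab(2) that]] by blast
    qed
    have iR: "(\<lambda>a\<in>all_faces R. a) ` faces R l = faces R l" for l using all_facesI[of _ R l] by force
    have "h ` faces Q l \<subseteq> faces R l" for l
    proof (rule image_subsetI)
      fix a assume a: "a \<in> faces Q l"
      \<comment> \<open>So far \<open>h a\<close> is only known to be a face of \<open>R\<close> in
        some dimension; the inclusion into \<open>T\<close> shows that it is
        \<open>l\<close>.\<close>
      then obtain l' where l': "h a \<in> faces R l'" using hh all_facesI by (metis all_facesE)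
      then have "h a \<in> faces T l'" using hm_face[OF RT l'] all_facesI[OF l'] by simp
      then show "h a \<in> faces R l" using ph_dim[OF poc_ph[OF T] hm_face[OF ab(2) a]] l' by simp
    qed
    then have "\<exists>r. hypergraph_morphism Q R r \<and> (\<forall>a\<in>all_faces Q. (\<lambda>a\<in>all_faces R. a) (r a) = h a)"
      using iR by (intro factor_through_mono[OF ph[OF ab(5)] poc_ph[OF R] ab(2) RT]) (auto simp: inj_on_def)
    then obtain r where r: "hypergraph_morphism Q R r" "\<forall>a\<in>all_faces Q. (\<lambda>a\<in>all_faces R. a) (r a) = h a" by blast
    have "(\<lambda>a\<in>all_faces Q. (\<lambda>a\<in>all_faces R. a) (r a)) = (\<lambda>a\<in>all_faces Q. h a)"
      "(\<lambda>a\<in>all_faces Q. (\<lambda>a\<in>all_faces R. a) (r a)) = (\<lambda>a\<in>all_faces Q. h' a)"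
      using r(2) hh by (auto intro!: restrict_ext)
    then have "a = Cmp pOpeCard (R, \<lambda>a\<in>all_faces R. a, T) (Q, r, R)" "b = Cmp pOpeCard (R, \<lambda>a\<in>all_faces R. a, S) (Q, r, R)"
      using hm_ext[OF ab(2)] hm_ext[OF ab(4)] unfolding ab(1,3) QQ by (simp_all add: pOpeCard_simps extensional_restrict)
    moreover have "(Q, r, R) \<in> K.over R" using over_iff[OF R] ab(5) r(1) by blast
    ultimately show "\<exists>r\<in>K.over R. a = Cmp pOpeCard (R, \<lambda>a\<in>all_faces R. a, T) r \<and> b = Cmp pOpeCard (R, \<lambda>a\<in>all_faces R. a, S) r"
      by blast
  qed simp_all
qed

lemma pointwise_Ran_exists:
  assumes X: "presheaf (pOpe :: ('f hypergraph, 'f hyper_arrow) cat) \<U> X"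
  shows "\<exists>R e. K.pointwise X R e"
proof (rule K.pointwise_exists)
  show "presheaf K.A \<U> X" using X by (simp only: pOpe_full_subcat)
  fix S :: "'f hypergraph" assume "S \<in> Ob pOpeCard"
  then have S: "positive_opetopic_cardinal S" by (simp add: pOpeCard_simps)
  let ?O = "{(Q, f). positive_opetope Q \<and> hypergraph_morphism Q S f}"
  obtain I where I: "finite I" "I \<subseteq> ?O"
    "\<forall>(Q, f)\<in>?O. \<exists>(Q', f')\<in>I. \<exists>u. hypergraph_morphism Q Q' u \<and> (\<forall>a\<in>all_faces Q. f' (u a) = f a)"
    using opetopes_over_finite[OF S] by blast
  show "\<exists>I. finite I \<and> I \<subseteq> K.over S \<and>
      (\<forall>f\<in>K.over S. \<exists>i\<in>I. \<exists>g\<in>Ar pOpeCard. Src pOpeCard g = Src pOpeCard f \<and> Tgt pOpeCard g = Src pOpeCard i \<and> f = Cmp pOpeCard i g)"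
  proof (intro exI[of _ "(\<lambda>(Q, f). (Q, f, S)) ` I"] conjI ballI)
    show "finite ((\<lambda>(Q, f). (Q, f, S)) ` I)" using I(1) by simp
    show "(\<lambda>(Q, f). (Q, f, S)) ` I \<subseteq> K.over S" using I(2) over_iff[OF S] by auto
    fix a assume "a \<in> K.over S"
    then obtain Q f where a: "a = (Q, f, S)" "positive_opetope Q" "hypergraph_morphism Q S f" unfolding over_iff[OF S] by blast
    then have "(Q, f) \<in> ?O" by simp
    then obtain Q' f' u where u: "(Q', f') \<in> I" "hypergraph_morphism Q Q' u" "\<forall>a\<in>all_faces Q. f' (u a) = f a"
      using I(3) by fast
    have "positive_opetope Q'" using u(1) I(2) by auto
    then have "(Q, u, Q') \<in> Ar pOpeCard" using a(2) u(2) by (simp add: pOpeCard_simps positive_opetope_def)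
    moreover have "(\<lambda>a\<in>all_faces Q. f' (u a)) = (\<lambda>a\<in>all_faces Q. f a)" using u(3) by (intro restrict_ext) simp
    then have "a = Cmp pOpeCard (Q', f', S) (Q, u, Q')"
      unfolding a(1) using hm_ext[OF a(3)] by (simp add: pOpeCard_simps extensional_restrict)
    moreover have "(Q', f', S) \<in> (\<lambda>(Q, f). (Q, f, S)) ` I" using u(1) by force
    ultimately show "\<exists>i\<in>(\<lambda>(Q, f). (Q, f, S)) ` I. \<exists>g\<in>Ar pOpeCard. Src pOpeCard g = Src pOpeCard a \<and>
        Tgt pOpeCard g = Src pOpeCard i \<and> a = Cmp pOpeCard i g"
      unfolding a(1) by (intro bexI[of _ "(Q', f', S)"] bexI[of _ "(Q, u, Q')"]) (auto simp: pOpeCard_simps)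
  qed
qed

lemma pointwise_preserves_special:
  fixes R :: "('f, 'u) psh"
  assumes inf: "infinite (UNIV :: 'f set)" and pw: "K.pointwise X R e"
  shows "preserves_special \<U> R"
  unfolding preserves_special_def
proof (intro allI impI)
  fix k and T S :: "'f hypergraph" and jT jS assume sp: "special_pushout k T S jT jS"
  obtain P g s where *: "jT = (T, g, P)" "jS = (S, s, P)" "glue (dom_part k T) T S P g s"
    "positive_opetopic_cardinal (dom_part k T)" "positive_opetopic_cardinal T" "positive_opetopic_cardinal S"
    "positive_opetopic_cardinal P" "cod_part k S = dom_part k T"
    using special_pushout_glue[OF inf sp] .
  have "hypergraph_morphism (dom_part k T) T (\<lambda>a\<in>all_faces (dom_part k T). a)"
    "hypergraph_morphism (dom_part k T) S (\<lambda>a\<in>all_faces (dom_part k T). a)"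
    using dom_part_incl[OF poc_ph[OF *(4)]] cod_part_incl[of k S] poc_ph[OF *(4)] *(8) by simp_all
  then have "K.glued (incl_arrow (dom_part k T) T) (incl_arrow (dom_part k T) S) jT jS"
    unfolding *(1,2) by (rule glue_glued[OF *(4-7,3)])
  then show "is_pullback (set_cat \<U>) (arm R (incl_arrow (dom_part k T) T)) (arm R (incl_arrow (cod_part k S) S)) (arm R jT) (arm R jS)"
    using K.glued_pullback pw unfolding *(8) K.pointwise_def by blast
qed

text \<open>Induction on the number of faces. A decomposition is a special pushout by
  \<open>glue_pushout\<close>, so \<open>Y\<close> sends it to a pullback, and
  \<open>glued_ev_bij\<close> applies since \<open>T\<close>, \<open>L\<close> and
  \<open>dom_part k T\<close> all have fewer faces than \<open>S\<close>.\<close>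

lemma preserves_special_pointwise:
  assumes Y: "presheaf (pOpeCard :: ('f hypergraph, 'f hyper_arrow) cat) \<U> Y" and sp: "preserves_special \<U> Y"
  shows "K.pointwise (K.rst Y) Y (K.idt Y)"
proof -
  note e = K.idt_trans[OF Y]
  have "bij_betw (K.ev Y (K.idt Y) S) (obm Y S) (K.cones (K.rst Y) S)" if "positive_opetopic_cardinal S" for S
    using that
  proof (induction "card (all_faces S)" arbitrary: S rule: less_induct)
    case less
    interpret S: opetopic_cardinal S by unfold_locales (rule less(2))
    have finS: "finite (all_faces S)" by (rule finite_all_faces[OF S.ph])
    show ?case
    proof (cases "positive_opetope S")
      case True
      then show ?thesis using K.ev_idt_bij[OF Y] less(2) by (simp add: pOpeCard_simps)
    next
      case False
      obtain k T L where *: "positive_opetopic_cardinal T" "positive_opetopic_cardinal L" "cod_part k L = dom_part k T"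
        "glue (dom_part k T) T L S (\<lambda>a\<in>all_faces T. a) (\<lambda>a\<in>all_faces L. a)"
        "all_faces T \<subset> all_faces S" "all_faces L \<subset> all_faces S"
        using S.decomposition_exists[OF False] by blast
      let ?R = "dom_part k T"
      interpret T: opetopic_cardinal T by unfold_locales (rule *)
      have R: "positive_opetopic_cardinal ?R" by (rule T.dom_part_opetopic_cardinal)
      have RT: "hypergraph_morphism ?R T (\<lambda>a\<in>all_faces ?R. a)" "hypergraph_morphism ?R L (\<lambda>a\<in>all_faces ?R. a)"
        using dom_part_incl[OF poc_ph[OF R]] cod_part_incl[of k L] poc_ph[OF R] *(3) by simp_all
      have "all_faces ?R \<subseteq> all_faces T" by (auto simp: all_faces_def faces_dom_part split: if_splits)
      then have small: "card (all_faces ?R) < card (all_faces S)" "card (all_faces T) < card (all_faces S)" "card (all_faces L) < card (all_faces S)"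
        using *(5,6) finS by (auto intro!: psubset_card_mono)
      let ?jT = "(T, \<lambda>a\<in>all_faces T. a, S)" and ?jL = "(L, \<lambda>a\<in>all_faces L. a, S)"
      have "special_pushout k T L ?jT ?jL"
        unfolding special_pushout_def *(3)
        using glue_pushout[OF R *(1,2) less(2) *(4) RT] * by (simp add: pOpeCard_simps)
      then have pb: "is_pullback (set_cat \<U>) (arm Y (incl_arrow ?R T)) (arm Y (incl_arrow ?R L)) (arm Y ?jT) (arm Y ?jL)"
        using sp[unfolded preserves_special_def, rule_format, of k T L] *(3) by simp
      have gl: "K.glued (incl_arrow ?R T) (incl_arrow ?R L) ?jT ?jL"
        by (rule glue_glued[OF R *(1,2) less(2) *(4) RT])
      show ?thesis
        using K.glued_ev_bij[OF Y e gl pb] less(1)[OF small(1) R] less(1)[OF small(2) *(1)] less(1)[OF small(3) *(2)]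
        by (simp add: pOpeCard_simps incl_arrow_def)
    qed
  qed
  then show ?thesis unfolding K.pointwise_def using Y e by (simp add: pOpeCard_simps)
qed

lemma incl_func_eq: "incl_func = K.incl"
  by (simp add: incl_func_def K.incl_def pOpe_full_subcat)

lemma incl_star_eq: "incl_star \<U> = K.incl_pre"
  by (simp add: incl_star_def incl_func_eq pOpe_full_subcat)

lemma is_Ran_exists: "\<exists>(Ran :: (('f, 'u) psh, ('f, 'u) psh_arrow, ('f, 'u) psh, ('f, 'u) psh_arrow) func) \<eta> \<epsilon>. is_Ran \<U> Ran \<eta> \<epsilon>"
  using K.Kan_adjunction_exists pointwise_Ran_exists
  unfolding is_Ran_def incl_star_eq incl_func_eq pOpe_full_subcat by blast

text \<open>No particular construction of \<open>Ran\<close> enters: its values are pointwise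
  because some pointwise extension exists for each presheaf.\<close>

lemma is_Ran_equivalence:
  fixes Ran :: "(('f, 'u) psh, ('f, 'u) psh_arrow, ('f, 'u) psh, ('f, 'u) psh_arrow) func"
  assumes inf: "infinite (UNIV :: 'f set)" and ran: "is_Ran \<U> Ran \<eta> \<epsilon>"
  shows "adjoint_equivalence (sPb \<U>) (presheaves pOpe \<U>)
    (restrict_func (incl_star \<U>) (sPb \<U>)) Ran (restrict \<eta> (Ob (sPb \<U>))) \<epsilon>"
  unfolding sPb_def incl_star_eq pOpe_full_subcat
proof (rule K.Kan_adjoint_equivalence)
  show "\<exists>R e. K.pointwise X R e" if "presheaf K.A \<U> X" for X
    using pointwise_Ran_exists that by (simp only: pOpe_full_subcat)
  show "adjunction (presheaves pOpeCard \<U>) (presheaves K.A \<U>) K.incl_pre Ran \<eta> \<epsilon>"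
    using ran by (simp only: is_Ran_def incl_star_eq pOpe_full_subcat)
  show "right_Kan_extension (op_cat K.A) (op_cat pOpeCard) (set_cat \<U>) K.incl X (obm Ran X) (fst (snd (\<epsilon> X)))"
    if "presheaf K.A \<U> X" for X
    using ran that K.presheaves_simps(1) by (simp only: is_Ran_def incl_func_eq pOpe_full_subcat) blast
  show "preserves_special \<U> R" if "presheaf K.A \<U> X" "K.pointwise X R e" for X and R :: "('f, 'u) psh" and e
    using pointwise_preserves_special[OF inf] that by blast
  show "K.pointwise (K.rst Y) Y (K.idt Y)" if "presheaf pOpeCard \<U> Y" "preserves_special \<U> Y" for Y :: "('f, 'u) psh"
    using preserves_special_pointwise that by blast
qed

end

theorem proposition13p1:
  fixes \<U> :: "'u set set"
  assumes "infinite (UNIV :: 'f set)"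
    and "set_universe \<U>"
  shows "(\<exists>(Ran :: (('f, 'u) psh, ('f, 'u) psh_arrow, ('f, 'u) psh, ('f, 'u) psh_arrow) func) \<eta> \<epsilon>.
            is_Ran \<U> Ran \<eta> \<epsilon>) \<and>
         (\<forall>(Ran :: (('f, 'u) psh, ('f, 'u) psh_arrow, ('f, 'u) psh, ('f, 'u) psh_arrow) func) \<eta> \<epsilon>.
            is_Ran \<U> Ran \<eta> \<epsilon> \<longrightarrow>
            adjoint_equivalence (sPb \<U>) (presheaves pOpe \<U>)
              (restrict_func (incl_star \<U>) (sPb \<U>)) Ran (restrict \<eta> (Ob (sPb \<U>))) \<epsilon>)"
  using is_Ran_exists[OF assms(2)] is_Ran_equivalence[OF assms(2,1)] by blast

end
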